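(* Let $E \subset \mathbb{C}$ be a compact set with $\mathrm{cap}(E)>0$, where $\mathrm{cap}(E)$ denotes the logarithmic capacity of $E$ and $\mu_E$ its equilibrium measure. Let $d_E(z):=\max_{t\in E}|z-t|$ for $z\in\mathbb{C}$. Suppose that $\nu_j$, $j=1,\ldots,m$, are positive compactly supported Borel measures with potentials $p_j(z)=\int\log|z-t|\,d\nu_j(t)$, such that the total mass of $\sum_{j=1}^m \nu_j$ equals $1$. Then \[ \sum_{j=1}^m \sup_E p_j \le C_E + \sup_E \sum_{j=1}^m p_j, \] where \[ C_E := \int \log d_E(z)\, d\mu_E(z) - \log\mathrm{cap}(E), \] and $C_E$ cannot be replaced by a smaller constant. *)

theory Defs
  imports "HOL-Probability.Probability"
begin

definition log_pos :: "complex \<Rightarrow> complex \<Rightarrow> ennreal" where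
  "log_pos z t = (if z = t then 0 else ennreal (ln (cmod (z - t))))"

definition log_neg :: "complex \<Rightarrow> complex \<Rightarrow> ennreal" where
  "log_neg z t = (if z = t then \<infinity> else ennreal (- ln (cmod (z - t))))"

(* logarithmic potential p(z) = \<integral> log|z-t| d\<nu>(t), with values in [-\<infinity>,\<infinity>) *)
definition pot :: "complex measure \<Rightarrow> complex \<Rightarrow> ereal" where
  "pot \<nu> z = enn2ereal (\<integral>\<^sup>+ t. log_pos z t \<partial>\<nu>) - enn2ereal (\<integral>\<^sup>+ t. log_neg z t \<partial>\<nu>)"

definition energy :: "complex measure \<Rightarrow> ereal" where
  "energy \<mu> = enn2ereal (\<integral>\<^sup>+ z. (\<integral>\<^sup>+ t. log_neg z t \<partial>\<mu>) \<partial>\<mu>)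
              - enn2ereal (\<integral>\<^sup>+ z. (\<integral>\<^sup>+ t. log_pos z t \<partial>\<mu>) \<partial>\<mu>)"

definition prob_on :: "complex set \<Rightarrow> complex measure \<Rightarrow> bool" where
  "prob_on E \<mu> \<longleftrightarrow> sets \<mu> = sets borel \<and> prob_space \<mu> \<and> emeasure \<mu> (UNIV - E) = 0"

definition robin :: "complex set \<Rightarrow> ereal" where
  "robin E = (INF \<mu> \<in> {\<mu>. prob_on E \<mu>}. energy \<mu>)"

definition log_capacity :: "complex set \<Rightarrow> real" where
  "log_capacity E = (if robin E = \<infinity> then 0 else exp (- real_of_ereal (robin E)))"

definition is_equilibrium_measure :: "complex set \<Rightarrow> complex measure \<Rightarrow> bool" where
  "is_equilibrium_measure E \<mu> \<longleftrightarrow> prob_on E \<mu> \<and> energy \<mu> = robin E"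

definition dE :: "complex set \<Rightarrow> complex \<Rightarrow> real" where
  "dE E z = Sup ((\<lambda>t. cmod (z - t)) ` E)"

definition C_E :: "complex set \<Rightarrow> complex measure \<Rightarrow> real" where
  "C_E E \<mu> = (\<integral> z. ln (dE E z) \<partial>\<mu>) - ln (log_capacity E)"

definition admissible_family :: "nat \<Rightarrow> (nat \<Rightarrow> complex measure) \<Rightarrow> bool" where
  "admissible_family m \<nu> \<longleftrightarrow>
     (\<forall>j\<in>{1..m}. sets (\<nu> j) = sets borel \<and> (\<exists>K. compact K \<and> emeasure (\<nu> j) (UNIV - K) = 0))
     \<and> (\<Sum>j=1..m. emeasure (\<nu> j) UNIV) = 1"

end

theory Submission
  imports Defs "HOL-Computational_Algebra.Fundamental_Theorem_Algebra"
begin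

text \<open>
  Write \<open>U\<close> for the potential of \<open>\<mu>\<close>, \<open>L = log cap E\<close> and \<open>\<nu> = \<Sum>\<^sub>j \<nu>\<^sub>j\<close>. If \<open>c\<^sub>j \<in> E\<close> nearly maximises \<open>p\<^sub>j\<close>,
  then \<open>\<Sum>\<^sub>j p\<^sub>j(c\<^sub>j) \<le> \<integral> log max\<^sub>j \<bar>t - c\<^sub>j\<bar> d\<nu>(t)\<close>. Instead of representing \<open>log max\<^sub>j \<bar>t - c\<^sub>j\<bar>\<close> as a
  potential, it is replaced by \<open>1/k log \<bar>P(t)\<bar>\<close> for \<open>P(t) = \<Sum>\<^sub>j s\<^sub>j (t - c\<^sub>j)^k\<close> with integers \<open>s\<^sub>j \<in> {1..N}\<close>: averaging
  over the \<open>s\<^sub>j\<close> shows that some choice loses only \<open>o(k)\<close> in \<open>\<integral> log \<bar>P\<bar> d\<nu>\<close>. This integral is \<open>log\<close> of the leading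
  coefficient plus the sum of \<open>p\<^sub>\<nu>(r)\<close> over the roots \<open>r\<close> of \<open>P\<close>; by the Bernstein--Walsh inequality
  \<open>p\<^sub>\<nu> \<le> sup\<^sub>E p\<^sub>\<nu> - L + U\<close> it is at most \<open>k (sup\<^sub>E p\<^sub>\<nu> - L) + \<integral> log \<bar>P\<bar> d\<mu>\<close>, and \<open>\<bar>P\<bar> \<le> m N d\<^sub>E^k\<close> on \<open>E\<close>.

  For sharpness, \<open>{z \<in> E. U z \<ge> L + \<eta>}\<close> is a compact set carrying no measure of finite energy, hence it carries
  measures with arbitrarily negative potential on it. Mixing a little of such a measure into \<open>\<mu>\<close> gives a \<open>\<nu>\<close> with
  \<open>p\<^sub>\<nu> \<le> L + 2 \<eta>\<close> on \<open>E\<close>; cutting \<open>\<nu>\<close> into pieces of small diameter makes \<open>\<Sum>\<^sub>j sup\<^sub>E p\<^sub>j\<close> close to \<open>\<integral> log d\<^sub>E d\<nu>\<close>.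
\<close>

section \<open>A space-filling curve\<close>

text \<open>The coefficients \<open>s j\<close> have to be chosen because the powers
  \<open>(t - c j) ^ k\<close> may cancel. Taking them as positive integers prevents cancellation at
  the top degree, so P has exactly k roots. The loss from the choice has a part growing linearly in
  k, but this part carries a factor 1/N; hence k tends to infinity first and N afterwards.

  Bernstein--Walsh rests on \<open>U \<ge> L\<close>, which minimality of the energy yields only
  \<mu>-almost everywhere. The set S where it holds is compact by upper semicontinuity and carries
  \<mu>, so the maximum principle is run on the complement of S. Regularising the potential of \<nu>
  makes it continuous and strictly subharmonic, so a discrete Laplacian suffices.

  \<mu> itself need not witness sharpness: U exceeds L at irregular points of E, for instance at
  isolated points. The admixture pushes the potential down there. Its existence comes from a
  compactness argument for point configurations in the plane, and the curve of this section carries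
  that argument over to an interval.\<close>

definition schoenberg_bump :: "real \<Rightarrow> real" where
  "schoenberg_bump t = max 0 (min 1 (1 / 2 - cos (pi * t)))"

lemma schoenberg_bump_shift: "schoenberg_bump (2 * of_nat n + t) = schoenberg_bump t"
proof -
  have "cos (pi * (2 * of_nat n + t)) = cos (pi * t + 2 * of_nat n * pi)"
    by (simp add: algebra_simps)
  also have "\<dots> = cos (pi * t)" by (simp add: cos_add cos_2npi sin_2npi)
  finally show ?thesis by (simp add: schoenberg_bump_def)
qed

lemma schoenberg_bump_0: "0 \<le> t \<Longrightarrow> t \<le> 1 / 3 \<Longrightarrow> schoenberg_bump t = 0"
proof -
  assume t: "0 \<le> t" "t \<le> 1 / 3"
  have "cos (pi * t) \<ge> cos (pi / 3)" using t by (intro cos_monotone_0_pi_le) (auto simp: field_simps)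
  then show ?thesis by (simp add: schoenberg_bump_def cos_60)
qed

lemma schoenberg_bump_1: "2 / 3 \<le> t \<Longrightarrow> t \<le> 1 \<Longrightarrow> schoenberg_bump t = 1"
proof -
  assume t: "2 / 3 \<le> t" "t \<le> 1"
  have "cos (pi * t) \<le> cos (2 * pi / 3)" using t by (intro cos_monotone_0_pi_le) (auto simp: field_simps)
  also have "cos (2 * pi / 3) = - 1 / 2"
    using cos_double_cos[of "pi / 3"] by (simp add: cos_60 power2_eq_square)
  finally show ?thesis by (simp add: schoenberg_bump_def)
qed

lemma schoenberg_bump_bounds: "0 \<le> schoenberg_bump t" "schoenberg_bump t \<le> 1"
  by (auto simp: schoenberg_bump_def)

definition binary_sum :: "(nat \<Rightarrow> real) \<Rightarrow> real" where
  "binary_sum a = (\<Sum>k. a k / 2 ^ Suc k)"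

lemma exists_binary_expansion:
  fixes x :: real
  assumes "0 \<le> x" "x \<le> 1"
  obtains a :: "nat \<Rightarrow> real" where "\<And>k. a k \<in> {0, 1}" "binary_sum a = x"
proof -
  \<comment> \<open>Orbit of the doubling map. At the threshold the digit is 1, so 1 is a fixed
    point whose digits are all 1, which covers the right endpoint.\<close>
  define y where "y = rec_nat x (\<lambda>_ y. 2 * y - (if y \<ge> 1/2 then 1 else 0))"
  define a :: "nat \<Rightarrow> real" where "a k = (if y k \<ge> 1/2 then 1 else 0)" for k
  have y0: "y 0 = x" and yS: "y (Suc k) = 2 * y k - a k" for k by (simp_all add: y_def a_def)
  have yb: "0 \<le> y k \<and> y k \<le> 1" for k
    by (induction k) (use assms in \<open>auto simp: y0 yS a_def\<close>)
  have part: "(\<Sum>k<n. a k / 2 ^ Suc k) = x - y n / 2 ^ n" for n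
    by (induction n) (auto simp: y0 yS field_simps)
  have "(\<lambda>n. y n / 2 ^ n) \<longlonglongrightarrow> 0"
  proof (rule tendsto_sandwich[OF _ _ tendsto_const])
    show "\<forall>\<^sub>F n in sequentially. y n / 2 ^ n \<le> (1/2) ^ n"
      using yb by (intro always_eventually) (auto simp: field_simps)
    show "(\<lambda>n. (1/2) ^ n) \<longlonglongrightarrow> (0::real)" by (rule LIMSEQ_realpow_zero) auto
  qed (use yb in auto)
  then have "(\<lambda>n. x - y n / 2 ^ n) \<longlonglongrightarrow> x - 0" by (intro tendsto_intros)
  then have "(\<lambda>k. a k / 2 ^ Suc k) sums x" unfolding sums_def part by simp
  then have "binary_sum a = x" unfolding binary_sum_def by (rule sums_unique[symmetric])
  moreover have "a k \<in> {0, 1}" for k by (auto simp: a_def)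
  ultimately show ?thesis using that by blast
qed

text \<open>Ternary digits 0 and 2 encode the sequence. The shifted sums \<open>T j\<close> lie in
  [0,1] and satisfy \<open>3 * T j = 2 * a j + T (Suc j)\<close>, so \<open>3 ^ k * T 0\<close>
  differs from \<open>T k\<close> by an even integer, a multiple of the period of the bump. Finally
  \<open>T k\<close> lies in [0,1/3] or in [2/3,1] according to \<open>a k\<close>, that is, on one
  of the two plateaus.\<close>

lemma exists_common_ternary_point:
  fixes a :: "nat \<Rightarrow> real"
  assumes a: "\<And>k. a k \<in> {0, 1}"
  obtains t where "0 \<le> t" "t \<le> 1" "\<And>k. schoenberg_bump (3 ^ k * t) = a k"
proof -
  define f where "f j k = 2 * a (k + j) / 3 ^ Suc k" for j k
  have geo: "(\<lambda>k. 2 / 3 ^ Suc k) sums (1::real)"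
  proof -
    have "(\<lambda>k. 2 / 3 * (1 / 3) ^ k) sums (2 / 3 * (1 / (1 - 1 / 3)) :: real)"
      by (intro sums_mult geometric_sums) auto
    then show ?thesis by (simp add: power_one_over field_simps)
  qed
  have a01: "0 \<le> a k" "a k \<le> 1" for k using a[of k] by auto
  have fb: "0 \<le> f j k" "f j k \<le> 2 / 3 ^ Suc k" for j k
    using a01[of "k + j"] by (auto simp: f_def field_simps)
  have fs: "summable (f j)" for j
    by (rule summable_comparison_test'[OF sums_summable[OF geo], of 0]) (use fb in auto)
  define T where "T j = suminf (f j)" for j
  have T0: "0 \<le> T j" for j unfolding T_def using fb by (intro suminf_nonneg fs) auto
  have T1: "T j \<le> 1" for j unfolding T_def sums_unique[OF geo]
    using fb by (intro suminf_le fs sums_summable[OF geo]) auto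
  have rec: "3 * T j = 2 * a j + T (Suc j)" for j
  proof -
    have "T j = f j 0 + (\<Sum>k. f j (Suc k))" unfolding T_def using suminf_split_head[OF fs, of j] by linarith
    also have "(\<Sum>k. f j (Suc k)) = (\<Sum>k. f (Suc j) k / 3)" by (simp add: f_def)
    also have "\<dots> = T (Suc j) / 3" unfolding T_def by (rule suminf_divide[OF fs])
    finally show ?thesis by (simp add: f_def field_simps)
  qed
  have pow: "\<exists>n::nat. 3 ^ k * T 0 = 2 * real n + T k" for k
  proof (induction k)
    case (Suc k)
    then obtain n where n: "3 ^ k * T 0 = 2 * real n + T k" by blast
    have "3 ^ Suc k * T 0 = 2 * (3 * real n + a k) + T (Suc k)" using n rec[of k] by simp
    moreover have "\<exists>n'::nat. 3 * real n + a k = real n'"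
      using a[of k] by (auto intro: exI[of _ "3*n"] exI[of _ "3*n+1"])
    ultimately show ?case by metis
  qed (auto intro: exI[of _ 0])
  have "schoenberg_bump (3 ^ k * T 0) = a k" for k
  proof -
    obtain n where n: "3 ^ k * T 0 = 2 * real n + T k" using pow by blast
    have "schoenberg_bump (3 ^ k * T 0) = schoenberg_bump (T k)" by (simp only: n schoenberg_bump_shift)
    also have "\<dots> = a k"
    proof (cases "a k = 0")
      case True
      then show ?thesis using rec[of k] T0[of k] T1[of "Suc k"] by (auto intro!: schoenberg_bump_0)
    next
      case False
      then have "a k = 1" using a[of k] by auto
      then show ?thesis using rec[of k] T0[of "Suc k"] T1[of "k"] by (auto intro!: schoenberg_bump_1)
    qed
    finally show ?thesis .
  qed
  then show ?thesis using that T0 T1 by blast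
qed

lemma continuous_on_binary_sum_schoenberg:
  "continuous_on UNIV (\<lambda>t. binary_sum (\<lambda>k. schoenberg_bump (3 ^ g k * t)))"
proof -
  have "uniform_limit UNIV (\<lambda>n t. \<Sum>k<n. schoenberg_bump (3 ^ g k * t) / 2 ^ Suc k)
      (\<lambda>t. \<Sum>k. schoenberg_bump (3 ^ g k * t) / 2 ^ Suc k) sequentially"
  proof (rule Weierstrass_m_test)
    show "summable (\<lambda>k. (1/2::real) ^ Suc k)" by (subst summable_Suc_iff) (intro summable_geometric, simp)
    show "norm (schoenberg_bump (3 ^ g k * t) / 2 ^ Suc k) \<le> (1/2) ^ Suc k" for k t
      using schoenberg_bump_bounds[of "3 ^ g k * t"] by (simp add: field_simps)
  qed
  then show ?thesis unfolding binary_sum_def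
    by (rule uniform_limit_theorem[rotated]) (auto intro!: always_eventually continuous_intros simp: schoenberg_bump_def)
qed

text \<open>Schoenberg's curve: the coordinates read the bump at even and at odd powers of 3 of the
  same parameter. Interleaving the binary digits of the two rescaled coordinates therefore produces
  a parameter that hits the given point.\<close>

lemma exists_space_filling_curve:
  fixes R :: real
  obtains \<phi> :: "real \<Rightarrow> complex" where "continuous_on UNIV \<phi>" "cball 0 R \<subseteq> \<phi> ` {0..1}"
proof (cases "R > 0")
  case False
  have "x = 0" if "x \<in> cball 0 R" for x :: complex
    using that False norm_ge_zero[of x] order_trans[of "norm x" R 0] by (simp del: norm_ge_zero)
  then have "cball (0::complex) R \<subseteq> (\<lambda>_. 0) ` {0..1::real}" by (intro subsetI image_eqI[of _ _ 0]) auto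
  then show ?thesis using that[of "\<lambda>_. 0"] by auto
next
  case True
  define X where "X t = binary_sum (\<lambda>k. schoenberg_bump (3 ^ (2 * k) * t))" for t
  define Y where "Y t = binary_sum (\<lambda>k. schoenberg_bump (3 ^ (2 * k + 1) * t))" for t
  define \<phi> where "\<phi> t = Complex (2 * R * X t - R) (2 * R * Y t - R)" for t
  have cX: "continuous_on UNIV X" "continuous_on UNIV Y"
    unfolding X_def Y_def by (rule continuous_on_binary_sum_schoenberg)+
  have "continuous_on UNIV \<phi>"
    unfolding \<phi>_def Complex_eq by (intro continuous_intros cX)
  moreover have "z \<in> \<phi> ` {0..1}" if "z \<in> cball 0 R" for z
  proof -
    have "\<bar>Re z\<bar> \<le> R" "\<bar>Im z\<bar> \<le> R" using that abs_Re_le_cmod[of z] abs_Im_le_cmod[of z] by auto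
    then have b: "0 \<le> (Re z + R) / (2 * R)" "(Re z + R) / (2 * R) \<le> 1"
      "0 \<le> (Im z + R) / (2 * R)" "(Im z + R) / (2 * R) \<le> 1" using True by (auto simp: field_simps)
    obtain a where a: "\<And>k. a k \<in> {0, 1}" "binary_sum a = (Re z + R) / (2 * R)"
      using exists_binary_expansion[OF b(1,2)] by blast
    obtain b where b: "\<And>k. b k \<in> {0, 1}" "binary_sum b = (Im z + R) / (2 * R)"
      using exists_binary_expansion[OF b(3,4)] by blast
    define c where "c k = (if even k then a (k div 2) else b (k div 2))" for k
    have "\<And>k. c k \<in> {0, 1}" using a b by (simp add: c_def)
    then obtain t where t: "0 \<le> t" "t \<le> 1" "\<And>k. schoenberg_bump (3 ^ k * t) = c k"
      using exists_common_ternary_point by blast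
    have "X t = binary_sum a" "Y t = binary_sum b" unfolding X_def Y_def t(3) by (simp_all add: c_def)
    then have "\<phi> t = z" unfolding \<phi>_def using a b True by (simp add: complex_eq_iff)
    then show ?thesis using t by auto
  qed
  ultimately show ?thesis using that by blast
qed

section \<open>Choosing coefficients by averaging\<close>

text \<open>At most one of the points \<open>u + s v\<close> can be much smaller than \<open>max (norm u) (norm v)\<close>.\<close>

lemma sum_ln_max_affine_ge:
  fixes u v :: complex and B \<tau> R :: real and N :: nat
  assumes "0 < \<tau>" "\<tau> \<le> B" "B \<le> R" "norm u \<le> R" "norm v \<le> R" "N \<ge> 1"
  shows "(\<Sum>s=1..N. ln (max B (norm (u + of_nat s * v))))
     \<ge> N * (ln (max B (max (norm u) (norm v))) - ln (4 * real N)) - ln (R / \<tau>)"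
proof -
  define X where "X = max B (max (norm u) (norm v))"
  have X: "X > 0" "X \<le> R" "B \<le> X" "\<tau> \<le> X" using assms by (auto simp: X_def)
  define f where "f s = ln (max B (norm (u + of_nat s * v)))" for s :: nat
  \<comment> \<open>The factor 4 makes two bad values contradictory: their difference gives
    \<open>norm v < X / (2 * N)\<close>, so \<open>N * norm v\<close> is at most X/2 and
    \<open>norm u < X / 4 + X / 2\<close>. All three entries of the maximum defining X would then
    lie below X.\<close>
  define bad where "bad = {s \<in> {1..N}. max B (norm (u + of_nat s * v)) < X / (4 * real N)}"
  have fin: "finite bad" by (simp add: bad_def)
  have card: "card bad \<le> 1"
  proof (rule ccontr)
    assume "\<not> card bad \<le> 1"
    then obtain s s' where s: "s \<in> bad" "s' \<in> bad" "s \<noteq> s'"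
      using card_le_Suc0_iff_eq[OF fin] unfolding One_nat_def by blast
    have N1: "real N \<ge> 1" using assms by simp
    have a: "norm (u + of_nat s * v) < X / (4 * real N)" "norm (u + of_nat s' * v) < X / (4 * real N)"
        "B < X / (4 * real N)" "s \<le> N"
      using s by (auto simp: bad_def)
    have "norm v \<le> norm (of_int (int s - int s') * v)"
    proof -
      have "\<bar>real_of_int (int s - int s')\<bar> \<ge> 1" using s(3) by linarith
      then show ?thesis by (simp only: norm_mult norm_of_int) (simp add: mult_le_cancel_right1)
    qed
    also have "\<dots> = norm ((u + of_nat s * v) - (u + of_nat s' * v))"
      by (simp add: algebra_simps)
    also have "\<dots> \<le> norm (u + of_nat s * v) + norm (u + of_nat s' * v)" by (rule norm_triangle_ineq4)
    also have "\<dots> < X / (2 * real N)" using a N1 by (simp add: field_simps)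
    finally have v: "norm v < X / (2 * real N)" .
    have "norm u = norm ((u + of_nat s * v) - of_nat s * v)" by simp
    also have "\<dots> \<le> norm (u + of_nat s * v) + norm (of_nat s * v)" by (rule norm_triangle_ineq4)
    also have "norm (of_nat s * v) \<le> real N * norm v" using a(4) by (simp add: norm_mult mult_right_mono)
    also have "real N * norm v \<le> X / 2" using v N1 by (simp add: field_simps)
    also have "norm (u + of_nat s * v) + X / 2 < X / 4 + X / 2"
    proof -
      have "X / (4 * real N) \<le> X / 4" using X N1 by (simp add: field_simps)
      then show ?thesis using a by linarith
    qed
    finally have "norm u < X" using X by simp
    moreover have "X / (4 * real N) \<le> X" "X / (2 * real N) \<le> X" using X N1 by (simp_all add: field_simps)
    ultimately show False using v a X_def by (auto simp: max_def split: if_splits)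
  qed
  have lnR: "ln (R / \<tau>) = ln R - ln \<tau>" using assms X by (simp add: ln_div)
  have lnXR: "ln X \<le> ln R" using X by simp
  have low: "f s \<ge> ln X - ln (4 * real N)" if "s \<in> {1..N} - bad" for s
  proof -
    have "X / (4 * real N) \<le> max B (norm (u + of_nat s * v))" using that by (auto simp: bad_def)
    then have "ln (X / (4 * real N)) \<le> f s"
      unfolding f_def using X assms by (subst ln_le_cancel_iff) auto
    then show ?thesis using X assms by (simp add: ln_div)
  qed
  \<comment> \<open>A bad value is still at least \<open>ln \<tau>\<close>. Its deficit
    \<open>ln (R / \<tau>)\<close> is paid at most once, so it is divided by N when
    averaging.\<close>
  have lowb: "f s \<ge> (ln X - ln (4 * real N)) - ln (R / \<tau>)" if "s \<in> bad" for s
  proof -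
    have "ln \<tau> \<le> f s" unfolding f_def using assms by (subst ln_le_cancel_iff) auto
    moreover have "ln (4 * real N) \<ge> 0" using assms by simp
    ultimately show ?thesis using lnR lnXR by linarith
  qed
  have nn: "ln (R / \<tau>) \<ge> 0" using assms by simp
  have "(\<Sum>s=1..N. f s) = sum f ({1..N} - bad) + sum f bad"
    by (rule sum.subset_diff) (auto simp: bad_def)
  also have "\<dots> \<ge> (\<Sum>s\<in>{1..N} - bad. ln X - ln (4 * real N)) + (\<Sum>s\<in>bad. (ln X - ln (4 * real N)) - ln (R / \<tau>))"
    by (intro add_mono sum_mono low lowb) auto
  also have "(\<Sum>s\<in>{1..N} - bad. ln X - ln (4 * real N)) + (\<Sum>s\<in>bad. (ln X - ln (4 * real N)) - ln (R / \<tau>))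
     = (\<Sum>s=1..N. ln X - ln (4 * real N)) - card bad * ln (R / \<tau>)"
  proof -
    have "(\<Sum>s=1..N. ln X - ln (4 * real N)) = (\<Sum>s\<in>{1..N} - bad. ln X - ln (4 * real N)) + (\<Sum>s\<in>bad. ln X - ln (4 * real N))"
      by (rule sum.subset_diff) (auto simp: bad_def)
    moreover have "(\<Sum>s\<in>bad. (ln X - ln (4 * real N)) - ln (R / \<tau>)) = (\<Sum>s\<in>bad. ln X - ln (4 * real N)) - card bad * ln (R / \<tau>)"
      by (simp only: sum_subtractf sum_constant)
    ultimately show ?thesis by linarith
  qed
  also have "\<dots> \<ge> N * (ln X - ln (4 * real N)) - ln (R / \<tau>)"
  proof -
    have "real (card bad) * ln (R / \<tau>) \<le> 1 * ln (R / \<tau>)" using card nn by (intro mult_right_mono) auto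
    then show ?thesis by simp
  qed
  finally show ?thesis unfolding f_def X_def by simp
qed

text \<open>The floor \<tau> keeps the logarithm of the maximum bounded below. The recursion on m
  matches the induction that fixes the coefficients one at a time.\<close>

fun max_norm :: "real \<Rightarrow> (nat \<Rightarrow> complex \<Rightarrow> complex) \<Rightarrow> nat \<Rightarrow> complex \<Rightarrow> real" where
  "max_norm \<tau> w 0 z = \<tau>"
| "max_norm \<tau> w (Suc m) z = max (max_norm \<tau> w m z) (norm (w (Suc m) z))"

lemma max_norm_ge: "\<tau> \<le> max_norm \<tau> w m z" "j \<in> {1..m} \<Longrightarrow> norm (w j z) \<le> max_norm \<tau> w m z"
  by (induction m) (auto simp: le_max_iff_disj le_Suc_eq)

lemma max_norm_le: "\<tau> \<le> R \<Longrightarrow> (\<And>j. j \<in> {1..m} \<Longrightarrow> norm (w j z) \<le> R) \<Longrightarrow> max_norm \<tau> w m z \<le> R"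
  by (induction m) auto

lemma max_norm_measurable [measurable]:
  assumes "\<And>j. j \<in> {1..m} \<Longrightarrow> w j \<in> borel_measurable borel"
  shows "max_norm \<tau> w m \<in> borel_measurable borel"
  using assms
proof (induction m)
  case 0
  show ?case by (subst measurable_cong[OF max_norm.simps(1)]) simp
next
  case (Suc m)
  have [measurable]: "max_norm \<tau> w m \<in> borel_measurable borel" "w (Suc m) \<in> borel_measurable borel"
    using Suc by auto
  show ?case by (subst measurable_cong[OF max_norm.simps(2)]) measurable
qed

context finite_measure begin

lemma integrable_ln_between:
  fixes g :: "'a \<Rightarrow> real"
  assumes [measurable]: "g \<in> borel_measurable M"
    and "0 < \<tau>" "AE t in M. \<tau> \<le> g t \<and> g t \<le> R"
  shows "integrable M (\<lambda>t. ln (g t))"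
proof (rule integrable_const_bound[where B = "max \<bar>ln \<tau>\<bar> \<bar>ln R\<bar>"])
  show "AE x in M. norm (ln (g x)) \<le> max \<bar>ln \<tau>\<bar> \<bar>ln R\<bar>"
    using assms(3)
  proof eventually_elim
    case (elim t)
    have "ln \<tau> \<le> ln (g t)" "ln (g t) \<le> ln R" using elim assms by auto
    then show ?case by (auto simp: abs_if max_def)
  qed
qed simp

end

text \<open>Induction on m in which u absorbs the terms whose coefficients are already fixed and n
  counts them. Integrating \<open>sum_ln_max_affine_ge\<close> shows that the average over
  \<open>s \<in> {1..N}\<close> loses little, so some s does as well as the average.\<close>

lemma exists_coefficients_integral_ln_ge:
  fixes M :: "complex measure" and w :: "nat \<Rightarrow> complex \<Rightarrow> complex" and u :: "complex \<Rightarrow> complex"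
  assumes "prob_space M" and sets: "sets M = sets borel"
    and wm: "\<And>j. j \<in> {1..m} \<Longrightarrow> w j \<in> borel_measurable borel"
    and um: "u \<in> borel_measurable borel"
    and N: "N \<ge> 1" and tau: "0 < \<tau>" "\<tau> \<le> R"
    and bound: "AE t in M. (\<forall>j\<in>{1..m}. norm (w j t) \<le> R) \<and> norm (u t) \<le> (1 + real (n * N)) * R"
  shows "\<exists>s. (\<forall>j\<in>{1..m}. s j \<in> {1..N}) \<and>
     (\<integral>t. ln (max \<tau> (norm (u t + (\<Sum>j=1..m. of_nat (s j) * w j t)))) \<partial>M)
      \<ge> (\<integral>t. ln (max (norm (u t)) (max_norm \<tau> w m t)) \<partial>M)
         - m * (ln (4 * real N) + ln ((1 + real ((n + m) * N)) * R / \<tau>) / N)"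
proof -
  interpret prob_space M by fact
  show ?thesis
    using wm um bound
  proof (induction m arbitrary: u n)
    case 0
    then show ?case by (simp add: max_norm.simps max.commute)
  next
    case (Suc m)
    note [measurable_cong] = sets
    have wm: "\<And>j. j \<in> {1..m} \<Longrightarrow> w j \<in> borel_measurable borel" using Suc.prems by auto
    have [measurable]: "max_norm \<tau> w m \<in> borel_measurable borel" "w (Suc m) \<in> borel_measurable borel"
      "u \<in> borel_measurable borel"
      using Suc.prems max_norm_measurable[OF wm] by auto
    \<comment> \<open>Since \<open>n + Suc m = (n + 1) + m\<close>, the induction hypothesis is met
      with the same Q, and every coefficient costs the same loss c.\<close>
    define Q where "Q = (1 + real ((n + Suc m) * N)) * R"
    have Rp: "R > 0" using tau by simp
    have RQ: "R \<le> Q" unfolding Q_def using Rp by (simp add: mult_le_cancel_right1 algebra_simps)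
    define u' where "u' s t = u t + of_nat s * w (Suc m) t" for s :: nat and t
    have [measurable]: "u' s \<in> borel_measurable borel" for s unfolding u'_def by measurable
    have Qn: "(1 + real (n * N)) * R \<le> Q" "(1 + real ((n+1) * N)) * R \<le> Q"
      unfolding Q_def using Rp by (auto intro!: mult_right_mono simp: algebra_simps)
    have u'b: "AE t in M. (\<forall>s\<in>{1..N}. norm (u' s t) \<le> (1 + real ((n+1) * N)) * R)"
      using Suc.prems(3)
    proof eventually_elim
      case (elim t)
      show ?case
      proof
        fix s assume s: "s \<in> {1..N}"
        have "norm (u' s t) \<le> norm (u t) + real s * norm (w (Suc m) t)"
          unfolding u'_def by (metis norm_triangle_ineq norm_mult norm_of_nat)
        also have "\<dots> \<le> (1 + real (n * N)) * R + real N * R"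
          using elim s by (intro add_mono mult_mono) auto
        finally show "norm (u' s t) \<le> (1 + real ((n+1) * N)) * R" by (simp add: algebra_simps)
      qed
    qed
    \<comment> \<open>G is the logarithm before the coefficient of \<open>w (Suc m)\<close> is
      fixed; \<open>H s\<close> is the one handed to the induction hypothesis if the coefficient is
      s.\<close>
    define G where "G t = ln (max (norm (u t)) (max_norm \<tau> w (Suc m) t))" for t
    define H where "H s t = ln (max (norm (u' s t)) (max_norm \<tau> w m t))" for s t
    define c where "c = ln (4 * real N) + ln (Q / \<tau>) / N"
    have intG: "integrable M G" unfolding G_def
    proof (rule integrable_ln_between[where \<tau>=\<tau> and R=Q])
      show "AE t in M. \<tau> \<le> max (norm (u t)) (max_norm \<tau> w (Suc m) t) \<and> max (norm (u t)) (max_norm \<tau> w (Suc m) t) \<le> Q"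
        using Suc.prems(3)
      proof eventually_elim
        case (elim t)
        have "max_norm \<tau> w (Suc m) t \<le> R" using elim tau by (intro max_norm_le) auto
        then have "max_norm \<tau> w (Suc m) t \<le> Q" using RQ by linarith
        moreover have "cmod (u t) \<le> Q" using elim Qn by linarith
        ultimately show ?case using max_norm_ge(1)[of \<tau> w "Suc m" t] by (simp add: le_max_iff_disj del: max_norm.simps)
      qed
      have "max_norm \<tau> w (Suc m) \<in> borel_measurable borel" by (rule max_norm_measurable[OF Suc.prems(1)])
      then show "(\<lambda>t. max (norm (u t)) (max_norm \<tau> w (Suc m) t)) \<in> borel_measurable M"
        by measurable
    qed (use tau in auto)
    have intH: "integrable M (H s)" if "s \<in> {1..N}" for s unfolding H_def
    proof (rule integrable_ln_between[where \<tau>=\<tau> and R=Q])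
      show "AE t in M. \<tau> \<le> max (norm (u' s t)) (max_norm \<tau> w m t) \<and> max (norm (u' s t)) (max_norm \<tau> w m t) \<le> Q"
        using Suc.prems(3) u'b
      proof eventually_elim
        case (elim t)
        have "max_norm \<tau> w m t \<le> R" using elim tau by (intro max_norm_le) auto
        moreover have "norm (u' s t) \<le> Q" using elim that Qn by force
        ultimately show ?case using RQ max_norm_ge(1)[of \<tau> w m t] by (auto simp: le_max_iff_disj)
      qed
    qed (use tau in auto)
    have ptw: "AE t in M. (\<Sum>s=1..N. H s t) \<ge> N * (G t - c)"
      using Suc.prems(3)
    proof eventually_elim
      case (elim t)
      have "max_norm \<tau> w m t \<le> R" using elim tau by (intro max_norm_le) auto
      moreover have "norm (w (Suc m) t) \<le> R" using elim by auto
      moreover note RQ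
      ultimately have "(\<Sum>s=1..N. ln (max (max_norm \<tau> w m t) (norm (u t + of_nat s * w (Suc m) t))))
       \<ge> N * (ln (max (max_norm \<tau> w m t) (max (norm (u t)) (norm (w (Suc m) t)))) - ln (4 * real N)) - ln (Q / \<tau>)"
        using elim Qn N tau by (intro sum_ln_max_affine_ge max_norm_ge) linarith+
      then have "(\<Sum>s=1..N. H s t) \<ge> N * (G t - ln (4 * real N)) - ln (Q / \<tau>)"
        by (simp add: H_def G_def u'_def max_norm.simps max.commute max.left_commute)
      moreover have "N * (G t - ln (4 * real N)) - ln (Q / \<tau>) = N * (G t - c)"
        unfolding c_def using N by (simp add: field_simps)
      ultimately show ?case by simp
    qed
    have "(\<Sum>s=1..N. integral\<^sup>L M (H s)) = (\<integral>t. (\<Sum>s=1..N. H s t) \<partial>M)"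
      using intH by (simp add: Bochner_Integration.integral_sum)
    also have "\<dots> \<ge> (\<integral>t. N * (G t - c) \<partial>M)"
      using ptw intH intG by (intro integral_mono_AE) auto
    also have "(\<integral>t. N * (G t - c) \<partial>M) = N * (integral\<^sup>L M G - c)"
      using intG by (simp add: prob_space)
    finally have sum_ge: "(\<Sum>s=1..N. integral\<^sup>L M (H s)) \<ge> N * (integral\<^sup>L M G - c)" .
    have "\<exists>s\<in>{1..N}. integral\<^sup>L M (H s) \<ge> integral\<^sup>L M G - c"
    proof (rule ccontr)
      assume "\<not> ?thesis"
      then have "(\<Sum>s=1..N. integral\<^sup>L M (H s)) < (\<Sum>s=1..N. integral\<^sup>L M G - c)"
        using N by (intro sum_strict_mono) (auto simp: not_le)
      then show False using sum_ge by simp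
    qed
    then obtain s0 where s0: "s0 \<in> {1..N}" "integral\<^sup>L M (H s0) \<ge> integral\<^sup>L M G - c" by blast
    have "AE t in M. (\<forall>j\<in>{1..m}. norm (w j t) \<le> R) \<and> norm (u' s0 t) \<le> (1 + real ((n+1) * N)) * R"
      using Suc.prems(3) u'b by eventually_elim (use s0 in auto)
    from Suc.IH[OF wm _ this] obtain s where s: "\<forall>j\<in>{1..m}. s j \<in> {1..N}"
       "(\<integral>t. ln (max \<tau> (norm (u' s0 t + (\<Sum>j=1..m. of_nat (s j) * w j t)))) \<partial>M)
        \<ge> integral\<^sup>L M (H s0) - m * c"
      by (auto simp: H_def[abs_def] c_def Q_def)
    define s' where "s' = s(Suc m := s0)"
    have eq: "u' s0 t + (\<Sum>j=1..m. of_nat (s j) * w j t) = u t + (\<Sum>j=1..Suc m. of_nat (s' j) * w j t)" for t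
    proof -
      have "(\<Sum>j=1..m. of_nat (s' j) * w j t) = (\<Sum>j=1..m. of_nat (s j) * w j t)"
        by (rule sum.cong) (auto simp: s'_def)
      then show ?thesis by (simp add: u'_def s'_def)
    qed
    have "integral\<^sup>L M G - Suc m * c \<le> integral\<^sup>L M (H s0) - m * c" using s0 by (simp add: algebra_simps)
    also note s(2)
    finally have "integral\<^sup>L M G - Suc m * c
        \<le> (\<integral>t. ln (max \<tau> (norm (u t + (\<Sum>j=1..Suc m. of_nat (s' j) * w j t)))) \<partial>M)"
      by (simp only: eq)
    moreover have "\<forall>j\<in>{1..Suc m}. s' j \<in> {1..N}" using s s0 by (auto simp: s'_def le_Suc_eq)
    ultimately show ?case unfolding G_def c_def Q_def by (intro exI[of _ s'] conjI)
  qed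
qed

section \<open>The regularised logarithm\<close>

text \<open>Decreases to \<open>ln (norm w)\<close> as e decreases to 0, but is finite at 0 and
  strictly subharmonic, with Laplacian \<open>2 e^2 / (|w|^2 + e^2)^2\<close>. Strictness is what
  the maximum principle below exploits.\<close>

definition logreg :: "real \<Rightarrow> complex \<Rightarrow> real" where
  "logreg e w = ln ((norm w)\<^sup>2 + e\<^sup>2) / 2"

text \<open>Multiplicative form of strict subharmonicity: the factors are
  \<open>exp (2 * logreg)\<close> at the four points of a cross, and exponentiation turns the
  discrete Laplacian into a polynomial identity. The condition on h makes
  \<open>4 e^2 - 2 h^2\<close> at least \<open>2 e^2\<close>, so all corrections to
  \<open>B^4\<close> are nonnegative.\<close>

lemma four_point_product:
  fixes x y e h :: real
  assumes "h\<^sup>2 \<le> e\<^sup>2"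
  defines "B \<equiv> x\<^sup>2 + y\<^sup>2 + e\<^sup>2"
  shows "((x+h)\<^sup>2 + y\<^sup>2 + e\<^sup>2) * ((x-h)\<^sup>2 + y\<^sup>2 + e\<^sup>2) * (x\<^sup>2 + (y+h)\<^sup>2 + e\<^sup>2) * (x\<^sup>2 + (y-h)\<^sup>2 + e\<^sup>2)
     \<ge> B^4 + 2 * h\<^sup>2 * e\<^sup>2 * B\<^sup>2"
proof -
  define A where "A = B + h\<^sup>2"
  have B0: "B \<ge> 0" by (simp add: B_def)
  have AB: "A \<ge> B" "A \<ge> h\<^sup>2" using B0 by (auto simp: A_def)
  have eq: "((x+h)\<^sup>2 + y\<^sup>2 + e\<^sup>2) * ((x-h)\<^sup>2 + y\<^sup>2 + e\<^sup>2) * (x\<^sup>2 + (y+h)\<^sup>2 + e\<^sup>2) * (x\<^sup>2 + (y-h)\<^sup>2 + e\<^sup>2)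
     = B^4 + A\<^sup>2 * h\<^sup>2 * (4 * e\<^sup>2 - 2 * h\<^sup>2) + 16 * h^4 * x\<^sup>2 * y\<^sup>2 + h^6 * (4 * A - h\<^sup>2)"
    unfolding A_def B_def by algebra
  have "A\<^sup>2 * h\<^sup>2 * (4 * e\<^sup>2 - 2 * h\<^sup>2) \<ge> B\<^sup>2 * h\<^sup>2 * (2 * e\<^sup>2)"
  proof (rule mult_mono)
    show "B\<^sup>2 * h\<^sup>2 \<le> A\<^sup>2 * h\<^sup>2" using AB B0 by (intro mult_right_mono power_mono) auto
  qed (use assms in auto)
  moreover have "h^6 * (4 * A - h\<^sup>2) \<ge> 0" using AB B0 zero_le_even_power[of 6 h]
    by (intro mult_nonneg_nonneg) auto
  moreover have "16 * h^4 * x\<^sup>2 * y\<^sup>2 \<ge> 0" by (simp add: zero_le_even_power)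
  moreover have "B\<^sup>2 * h\<^sup>2 * (2 * e\<^sup>2) = 2 * h\<^sup>2 * e\<^sup>2 * B\<^sup>2" by simp
  ultimately show ?thesis unfolding eq by linarith
qed

lemma logreg_four_point:
  assumes "e > 0" "h\<^sup>2 \<le> e\<^sup>2" "(norm w)\<^sup>2 + e\<^sup>2 \<le> R"
  shows "(logreg e (w + of_real h) + logreg e (w - of_real h) + logreg e (w + \<i> * of_real h) + logreg e (w - \<i> * of_real h))
     - 4 * logreg e w \<ge> ln (1 + 2 * h\<^sup>2 * e\<^sup>2 / R\<^sup>2) / 2"
proof -
  define x y where "x = Re w" and "y = Im w"
  define B where "B = x\<^sup>2 + y\<^sup>2 + e\<^sup>2"
  define P1 P2 P3 P4 where "P1 = (x+h)\<^sup>2 + y\<^sup>2 + e\<^sup>2" and "P2 = (x-h)\<^sup>2 + y\<^sup>2 + e\<^sup>2"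
    and "P3 = x\<^sup>2 + (y+h)\<^sup>2 + e\<^sup>2" and "P4 = x\<^sup>2 + (y-h)\<^sup>2 + e\<^sup>2"
  have e2: "e\<^sup>2 > 0" using assms by simp
  have pos: "B > 0" "P1 > 0" "P2 > 0" "P3 > 0" "P4 > 0"
    using e2 by (auto simp: B_def P1_def P2_def P3_def P4_def add_nonneg_pos)
  have eqs: "logreg e (w + of_real h) = ln P1 / 2" "logreg e (w - of_real h) = ln P2 / 2"
     "logreg e (w + \<i> * of_real h) = ln P3 / 2" "logreg e (w - \<i> * of_real h) = ln P4 / 2" "logreg e w = ln B / 2"
    by (simp_all add: logreg_def cmod_power2 P1_def P2_def P3_def P4_def B_def x_def y_def)
  have BR: "B \<le> R" using assms by (simp add: B_def cmod_power2 x_def y_def)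
  have "1 + 2 * h\<^sup>2 * e\<^sup>2 / R\<^sup>2 \<le> 1 + 2 * h\<^sup>2 * e\<^sup>2 / B\<^sup>2"
    using BR pos by (intro add_left_mono divide_left_mono power_mono) auto
  also have "\<dots> = (B^4 + 2 * h\<^sup>2 * e\<^sup>2 * B\<^sup>2) / B^4" using pos by (simp add: field_simps eval_nat_numeral)
  also have "\<dots> \<le> (P1 * P2 * P3 * P4) / B^4"
    using four_point_product[OF assms(2), of x y] pos by (intro divide_right_mono) (auto simp: B_def P1_def P2_def P3_def P4_def)
  finally have "ln (1 + 2 * h\<^sup>2 * e\<^sup>2 / R\<^sup>2) \<le> ln ((P1 * P2 * P3 * P4) / B^4)"
    using pos by (subst ln_le_cancel_iff) (auto simp: add_pos_nonneg)
  also have "\<dots> = ln P1 + ln P2 + ln P3 + ln P4 - 4 * ln B"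
    using pos by (simp add: ln_div ln_mult ln_realpow)
  finally show ?thesis unfolding eqs by simp
qed

text \<open>The four displacements are the fourth roots of \<open>h^4\<close>, so the four values
  multiply to \<open>w^4 - h^4\<close> and the discrete Laplacian of the harmonic function is only
  of order \<open>h^4\<close>. That is negligible against the gain of order \<open>h^2\<close> in
  \<open>logreg_four_point\<close>.\<close>

lemma ln_norm_four_point:
  fixes w :: complex and h \<rho> :: real
  assumes "\<rho> > 0" "\<rho> \<le> norm w" "0 < h" "h < \<rho>"
  shows "(ln (norm (w + of_real h)) + ln (norm (w - of_real h)) + ln (norm (w + \<i> * of_real h)) + ln (norm (w - \<i> * of_real h)))
     - 4 * ln (norm w) \<le> h^4 / \<rho>^4"
proof -
  have h: "norm (of_real h :: complex) = h" "norm (\<i> * of_real h :: complex) = h" using assms by (auto simp: norm_mult)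
  have nz: "w + c \<noteq> 0" "w - c \<noteq> 0" if "norm c = h" for c
    using that assms by (auto simp: add_eq_0_iff2)
  note nz1 = nz[OF h(1)] nz[OF h(2)]
  have w0: "w \<noteq> 0" using assms by auto
  have "(w + of_real h) * (w - of_real h) * (w + \<i> * of_real h) * (w - \<i> * of_real h) = (w\<^sup>2 - (of_real h)\<^sup>2) * (w\<^sup>2 - (\<i> * of_real h)\<^sup>2)"
    by (simp only: power2_eq_square) (simp add: algebra_simps)
  also have "\<dots> = w^4 - of_real h^4" by (simp add: power_mult_distrib power2_eq_square eval_nat_numeral algebra_simps)
  finally have prod: "norm (w + of_real h) * norm (w - of_real h) * norm (w + \<i> * of_real h) * norm (w - \<i> * of_real h) = norm (w^4 - of_real h^4)"
    by (metis norm_mult)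
  have "norm (w + of_real h) * norm (w - of_real h) * norm (w + \<i> * of_real h) * norm (w - \<i> * of_real h) \<noteq> 0"
    using nz1 by simp
  then have Ppos: "norm (w^4 - of_real h^4) > 0" unfolding prod by simp
  have "ln (norm (w + of_real h)) + ln (norm (w - of_real h)) + ln (norm (w + \<i> * of_real h)) + ln (norm (w - \<i> * of_real h))
      = ln (norm (w + of_real h) * norm (w - of_real h) * norm (w + \<i> * of_real h) * norm (w - \<i> * of_real h))"
    using nz1 by (simp add: ln_mult)
  also have "\<dots> = ln (norm (w^4 - of_real h^4))" by (simp only: prod)
  also have "\<dots> - 4 * ln (norm w) = ln (norm (w^4 - of_real h^4) / norm w^4)"
    using Ppos w0 by (simp add: ln_div ln_realpow)
  also have "\<dots> \<le> norm (w^4 - of_real h^4) / norm w^4 - 1"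
    using Ppos w0 by (intro ln_le_minus_one) simp
  also have "\<dots> \<le> (norm w^4 + h^4) / norm w^4 - 1"
  proof -
    have "norm (w^4 - of_real h^4) \<le> norm w^4 + h^4"
      using norm_triangle_ineq4[of "w^4" "of_real h^4"] assms by (simp add: norm_power)
    then show ?thesis by (intro diff_right_mono divide_right_mono) auto
  qed
  also have "\<dots> = h^4 / norm w^4" using w0 by (simp add: field_simps)
  also have "\<dots> \<le> h^4 / \<rho>^4" using assms by (intro divide_left_mono power_mono) (auto simp: w0)
  finally show ?thesis .
qed

lemma continuous_on_logreg [continuous_intros]: "e > 0 \<Longrightarrow> continuous_on A f \<Longrightarrow> continuous_on A (\<lambda>x. logreg e (f x))"
  unfolding logreg_def by (intro continuous_intros) (auto simp: sum_power2_eq_zero_iff)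

lemma logreg_measurable [measurable]: "logreg e \<in> borel_measurable borel"
  unfolding logreg_def by measurable

lemma logreg_ge_ln_norm: "w \<noteq> 0 \<Longrightarrow> ln (norm w) \<le> logreg e w"
proof -
  assume "w \<noteq> 0"
  then have "2 * ln (norm w) = ln ((norm w)\<^sup>2)" by (simp add: ln_realpow)
  also have "\<dots> \<le> ln ((norm w)\<^sup>2 + e\<^sup>2)" using \<open>w \<noteq> 0\<close> by (subst ln_le_cancel_iff) (auto simp: add_pos_nonneg)
  finally show ?thesis by (simp add: logreg_def)
qed

lemma logreg_ge_ln: "e > 0 \<Longrightarrow> ln e \<le> logreg e w"
proof -
  assume "e > 0"
  then have "2 * ln e = ln (e\<^sup>2)" by (simp add: ln_realpow)
  also have "\<dots> \<le> ln ((norm w)\<^sup>2 + e\<^sup>2)" using \<open>e > 0\<close> by (subst ln_le_cancel_iff) (auto simp: add_nonneg_pos)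
  finally show ?thesis by (simp add: logreg_def)
qed

lemma logreg_mono: "0 < e \<Longrightarrow> e \<le> e' \<Longrightarrow> logreg e w \<le> logreg e' w"
  unfolding logreg_def by (intro divide_right_mono) (auto simp: add_nonneg_pos power_mono)

lemma logreg_le: "e > 0 \<Longrightarrow> norm w \<le> R \<Longrightarrow> logreg e w \<le> ln (R + e)"
proof -
  assume e: "e > 0" "norm w \<le> R"
  then have R: "R \<ge> 0" using norm_ge_zero order_trans by blast
  have "(norm w)\<^sup>2 + e\<^sup>2 \<le> R\<^sup>2 + e\<^sup>2" using e by (intro add_right_mono power_mono) auto
  also have "\<dots> \<le> (R + e)\<^sup>2" using R e by (simp add: power2_eq_square algebra_simps)
  finally have "ln ((norm w)\<^sup>2 + e\<^sup>2) \<le> ln ((R + e)\<^sup>2)" using e R by (subst ln_le_cancel_iff) (auto intro: add_nonneg_pos)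
  then show ?thesis using e R by (simp add: logreg_def ln_realpow)
qed

section \<open>Logarithmic potentials\<close>

text \<open>\<open>log (D / \<bar>z - t\<bar>)\<close> is nonnegative on sets of diameter at most \<open>D\<close>, so potentials and energies
  become \<open>ennreal\<close> integrals up to an additive constant.\<close>

definition log_kernel :: "real \<Rightarrow> complex \<Rightarrow> complex \<Rightarrow> ennreal" where
  "log_kernel D z t = (if z = t then \<infinity> else ennreal (ln D - ln (cmod (z - t))))"

lemma pred_diagonal [measurable]:
  "Measurable.pred (borel \<Otimes>\<^sub>M borel) (\<lambda>p :: complex \<times> complex. fst p = snd p)"
proof -
  have "closed {p :: complex \<times> complex. fst p = snd p}" by (intro closed_Collect_eq continuous_intros)
  then show ?thesis unfolding pred_def borel_prod by simp
qed

lemma log_pos_measurable [measurable]: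
  "(\<lambda>p. log_pos (fst p) (snd p)) \<in> borel_measurable (borel \<Otimes>\<^sub>M borel)"
  unfolding log_pos_def by measurable

lemma log_neg_measurable [measurable]:
  "(\<lambda>p. log_neg (fst p) (snd p)) \<in> borel_measurable (borel \<Otimes>\<^sub>M borel)"
  unfolding log_neg_def by measurable

lemma log_kernel_measurable [measurable]:
  "(\<lambda>p. log_kernel D (fst p) (snd p)) \<in> borel_measurable (borel \<Otimes>\<^sub>M borel)"
  unfolding log_kernel_def by measurable

lemma log_measurable_right [measurable]:
  "log_pos z \<in> borel_measurable borel" "log_neg z \<in> borel_measurable borel" "log_kernel D z \<in> borel_measurable borel"
  unfolding log_pos_def log_neg_def log_kernel_def by measurable

lemma log_kernel_commute: "log_kernel D z t = log_kernel D t z"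
  by (auto simp: log_kernel_def norm_minus_commute)

lemma log_pos_add_log_kernel:
  assumes "D \<ge> 1" "cmod (z - t) \<le> D"
  shows "log_pos z t + log_kernel D z t = ennreal (ln D) + log_neg z t"
proof (cases "z = t")
  case False
  define l where "l = ln (cmod (z - t))"
  have l: "l \<le> ln D" "ln D \<ge> 0" using False assms by (auto simp: l_def)
  have "ennreal l + ennreal (ln D - l) = ennreal (ln D) + ennreal (- l)"
  proof (cases "l \<ge> 0")
    case True
    then have "ennreal (- l) = 0" by (simp add: ennreal_neg)
    then show ?thesis using l True by (simp flip: ennreal_plus)
  next
    case False
    then have "ennreal l = 0" by (simp add: ennreal_neg)
    then show ?thesis using l False by (simp flip: ennreal_plus)
  qed
  then show ?thesis using False by (simp add: log_pos_def log_kernel_def log_neg_def l_def)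
qed (simp add: log_pos_def log_kernel_def log_neg_def)

lemma log_pos_le:
  assumes "D \<ge> 1" "cmod (z - t) \<le> D"
  shows "log_pos z t \<le> ennreal (ln D)"
  using assms by (auto simp: log_pos_def intro!: ennreal_leI)

text \<open>Turns the difference of two integrals in \<open>pot\<close> into a constant minus a
  single integral. The bound on a excludes \<open>\<infinity> - \<infinity>\<close>, while b and k
  may both be infinite, the case of potential \<open>-\<infinity>\<close>.\<close>

lemma enn2ereal_diff_eq:
  assumes "a + k = ennreal c + b" "a \<le> ennreal c" "c \<ge> 0"
  shows "enn2ereal a - enn2ereal b = ereal c - enn2ereal k"
proof -
  obtain a' where a': "a = ennreal a'" "a' \<ge> 0" using assms(2) by (metis ennreal_cases ennreal_less_top neq_top_trans top.not_eq_extremum)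
  show ?thesis
  proof (cases b)
    case (real b')
    then have "ennreal a' + k = ennreal (c + b')" using assms a' by simp
    then obtain k' where k': "k = ennreal k'" "k' \<ge> 0" by (cases k) (auto simp flip: ennreal_plus)
    have "a' + k' = c + b'" using assms a' k' real by (simp flip: ennreal_plus)
    then show ?thesis using a' k' real assms by (simp add: enn2ereal_ennreal)
  next
    case top
    then have "k = \<infinity>" using assms a' by (cases k) (auto simp flip: ennreal_plus)
    then show ?thesis using top a' by (simp add: enn2ereal_ennreal)
  qed
qed

lemma nn_integral_cmult_const_measure:
  assumes "finite_measure M" "c \<ge> 0"
  shows "(\<integral>\<^sup>+t. ennreal c \<partial>M) = ennreal (c * measure M (space M))"
  using assms by (simp add: finite_measure.emeasure_eq_measure ennreal_mult)

definition reg_pot :: "complex measure \<Rightarrow> real \<Rightarrow> complex \<Rightarrow> real" where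
  "reg_pot \<nu> e z = (\<integral>t. logreg e (z - t) \<partial>\<nu>)"

text \<open>Finite measures instead of probability measures, since the pieces of the family have
  arbitrary masses, possibly 0. The radius is a parameter so that several measures can share
  it.\<close>

locale bounded_support = finite_measure M for M :: "complex measure" +
  fixes R :: real
  assumes sets_M [measurable_cong]: "sets M = sets borel"
    and AE_norm_le: "AE t in M. cmod t \<le> R"
begin

lemma space_M: "space M = UNIV"
  using sets_eq_imp_space_eq[OF sets_M] by simp

lemma nn_integral_log_pos_add:
  assumes "D \<ge> 1" "AE t in M. cmod (z - t) \<le> D"
  shows "(\<integral>\<^sup>+t. log_pos z t \<partial>M) + (\<integral>\<^sup>+t. log_kernel D z t \<partial>M)
     = ennreal (ln D * measure M UNIV) + (\<integral>\<^sup>+t. log_neg z t \<partial>M)"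
proof -
  have "(\<integral>\<^sup>+t. log_pos z t \<partial>M) + (\<integral>\<^sup>+t. log_kernel D z t \<partial>M) = (\<integral>\<^sup>+t. log_pos z t + log_kernel D z t \<partial>M)"
    by (rule nn_integral_add[symmetric]) measurable
  also have "\<dots> = (\<integral>\<^sup>+t. ennreal (ln D) + log_neg z t \<partial>M)"
    using assms(2) by (intro nn_integral_cong_AE) (auto elim!: eventually_mono simp: log_pos_add_log_kernel assms(1))
  also have "\<dots> = (\<integral>\<^sup>+t. ennreal (ln D) \<partial>M) + (\<integral>\<^sup>+t. log_neg z t \<partial>M)"
    by (rule nn_integral_add) measurable
  also have "(\<integral>\<^sup>+t. ennreal (ln D) \<partial>M) = ennreal (ln D * measure M UNIV)"
    using nn_integral_cmult_const_measure[OF finite_measure_axioms, of "ln D"] assms by (simp add: space_M)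
  finally show ?thesis .
qed

lemma nn_integral_log_pos_le:
  assumes "D \<ge> 1" "AE t in M. cmod (z - t) \<le> D"
  shows "(\<integral>\<^sup>+t. log_pos z t \<partial>M) \<le> ennreal (ln D * measure M UNIV)"
proof -
  have "(\<integral>\<^sup>+t. log_pos z t \<partial>M) \<le> (\<integral>\<^sup>+t. ennreal (ln D) \<partial>M)"
    using assms(2) by (intro nn_integral_mono_AE) (auto elim!: eventually_mono simp: log_pos_le assms(1))
  also have "(\<integral>\<^sup>+t. ennreal (ln D) \<partial>M) = ennreal (ln D * measure M UNIV)"
    using nn_integral_cmult_const_measure[OF finite_measure_axioms, of "ln D"] assms by (simp add: space_M)
  finally show ?thesis .
qed

lemma pot_eq_log_kernel:
  assumes "D \<ge> 1" "AE t in M. cmod (z - t) \<le> D"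
  shows "pot M z = ereal (ln D * measure M UNIV) - enn2ereal (\<integral>\<^sup>+t. log_kernel D z t \<partial>M)"
  unfolding pot_def
  by (rule enn2ereal_diff_eq[OF nn_integral_log_pos_add[OF assms] nn_integral_log_pos_le[OF assms]])
     (use assms in auto)

lemma AE_dist_le: "cmod z + R \<le> D \<Longrightarrow> AE t in M. cmod (z - t) \<le> D"
  using AE_norm_le
proof eventually_elim
  case (elim t)
  then show ?case using norm_triangle_ineq4[of z t] by simp
qed

lemma exists_dist_bound: "\<exists>D\<ge>1. AE t in M. cmod (z - t) \<le> D"
  using AE_dist_le[of z "max 1 (cmod z + R)"] by (intro exI[of _ "max 1 (cmod z + R)"]) auto

lemma nn_integral_log_pos_finite: "(\<integral>\<^sup>+t. log_pos z t \<partial>M) \<noteq> \<infinity>"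
  using exists_dist_bound[of z] nn_integral_log_pos_le[of _ z] by (auto simp: top_unique)

section \<open>Regularised potentials and upper semicontinuity\<close>

lemma AE_logreg_bound:
  assumes "e > 0" "cmod z \<le> Z"
  shows "AE t in M. norm (logreg e (z - t)) \<le> max \<bar>ln e\<bar> \<bar>ln (Z + R + e)\<bar>"
  using AE_norm_le
proof eventually_elim
  case (elim t)
  then have "cmod (z - t) \<le> Z + R" using norm_triangle_ineq4[of z t] assms by simp
  from logreg_le[OF assms(1) this] logreg_ge_ln[OF assms(1), of "z - t"]
  show ?case by (auto simp: abs_if max_def)
qed

lemma integrable_logreg: "e > 0 \<Longrightarrow> integrable M (\<lambda>t. logreg e (z - t))"
  by (rule integrable_const_bound[OF AE_logreg_bound[of e z "cmod z"]]) auto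

lemma reg_pot_mono: "0 < e \<Longrightarrow> e \<le> e' \<Longrightarrow> reg_pot M e z \<le> reg_pot M e' z"
  unfolding reg_pot_def
  by (intro integral_mono integrable_logreg logreg_mono) (simp_all add: order_less_le_trans[of 0 e e'])

lemma reg_pot_tendsto:
  assumes e: "e > 0" and u: "u \<longlonglongrightarrow> z"
  shows "(\<lambda>n. reg_pot M e (u n)) \<longlonglongrightarrow> reg_pot M e z"
proof -
  have "Bseq u" using u by (intro convergent_imp_Bseq convergentI)
  then obtain Z where Z: "\<And>n. cmod (u n) \<le> Z" by (auto simp: Bseq_def)
  show ?thesis
    unfolding reg_pot_def
  proof (rule integral_dominated_convergence)
    show "AE t in M. norm (logreg e (u n - t)) \<le> max \<bar>ln e\<bar> \<bar>ln (Z + R + e)\<bar>" for n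
      by (rule AE_logreg_bound[OF e Z])
    have "(\<lambda>n. logreg e (u n - t)) \<longlonglongrightarrow> logreg e (z - t)" for t
    proof -
      have "continuous_on UNIV (\<lambda>w. logreg e (w - t))" using e by (intro continuous_intros)
      then have "isCont (\<lambda>w. logreg e (w - t)) z" by (simp add: continuous_on_eq_continuous_at)
      then show ?thesis using u by (rule isCont_tendsto_compose)
    qed
    then show "AE t in M. (\<lambda>n. logreg e (u n - t)) \<longlonglongrightarrow> logreg e (z - t)" by simp
  qed auto
qed

lemma continuous_reg_pot: "e > 0 \<Longrightarrow> continuous_on A (reg_pot M e)"
  by (intro continuous_on_sequentiallyI reg_pot_tendsto)

lemma log_kernel_eq_SUP:
  assumes "D \<ge> 1" "cmod (z - t) \<le> D"
  shows "log_kernel (D + 1) z t = (SUP n. ennreal (ln (D + 1) - logreg (1 / real (Suc n)) (z - t)))"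
proof (rule LIMSEQ_unique[OF _ LIMSEQ_SUP])
  show "incseq (\<lambda>n. ennreal (ln (D + 1) - logreg (1 / real (Suc n)) (z - t)))"
    by (intro incseq_SucI ennreal_leI diff_left_mono logreg_mono) (auto simp: field_simps)
  show "(\<lambda>n. ennreal (ln (D + 1) - logreg (1 / real (Suc n)) (z - t))) \<longlonglongrightarrow> log_kernel (D + 1) z t"
  proof (cases "z = t")
    case True
    have "filterlim (\<lambda>n. ln (D + 1) + ln (real (Suc n))) at_top sequentially"
      by (intro filterlim_tendsto_add_at_top[OF tendsto_const] filterlim_compose[OF ln_at_top]
           filterlim_compose[OF filterlim_real_sequentially filterlim_Suc])
    then have "(\<lambda>n. ennreal (ln (D + 1) + ln (real (Suc n)))) \<longlonglongrightarrow> \<infinity>"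
      by (simp add: ennreal_tendsto_top_eq_at_top)
    then show ?thesis using True by (simp add: log_kernel_def logreg_def ln_realpow ln_div power_divide)
  next
    case False
    have "(\<lambda>n. logreg (1 / real (Suc n)) (z - t)) \<longlonglongrightarrow> ln ((cmod (z - t))\<^sup>2 + 0\<^sup>2) / 2"
      unfolding logreg_def using False
      by (intro tendsto_intros LIMSEQ_Suc lim_1_over_n) auto
    also have "ln ((cmod (z - t))\<^sup>2 + 0\<^sup>2) / 2 = ln (cmod (z - t))" using False by (simp add: ln_realpow)
    finally show ?thesis using False unfolding log_kernel_def by (auto intro!: tendsto_intros)
  qed
qed

text \<open>Monotone convergence along \<open>e = 1 / Suc n\<close>. The constant is
  \<open>ln (D + 1)\<close> because \<open>logreg e\<close> is bounded by \<open>ln (D + e)\<close>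
  with \<open>e \<le> 1\<close>; this keeps the integrands nonnegative, so that
  \<open>ennreal\<close> cuts nothing off.\<close>

lemma pot_eq_SUP:
  assumes D: "D \<ge> 1" "AE t in M. cmod (z - t) \<le> D"
  shows "pot M z = ereal (ln (D + 1) * measure M UNIV)
     - enn2ereal (SUP n. ennreal (ln (D + 1) * measure M UNIV - reg_pot M (1 / real (Suc n)) z))"
    and "reg_pot M (1 / real (Suc n)) z \<le> ln (D + 1) * measure M UNIV"
proof -
  let ?f = "\<lambda>n t. ln (D + 1) - logreg (1 / real (Suc n)) (z - t)"
  have nonneg: "AE t in M. 0 \<le> ?f n t" for n
    using D(2)
  proof eventually_elim
    case (elim t)
    have "logreg (1 / real (Suc n)) (z - t) \<le> ln (D + 1 / real (Suc n))" by (rule logreg_le) (use elim in auto)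
    also have "\<dots> \<le> ln (D + 1)" using D by (subst ln_le_cancel_iff) (auto intro: add_pos_pos)
    finally show ?case by simp
  qed
  have int: "integrable M (?f n)" for n by (intro Bochner_Integration.integrable_diff integrable_const integrable_logreg) auto
  have int_eq: "integral\<^sup>L M (?f n) = ln (D + 1) * measure M UNIV - reg_pot M (1 / real (Suc n)) z" for n
    unfolding reg_pot_def by (subst Bochner_Integration.integral_diff) (auto intro!: integrable_logreg simp: space_M)
  have "(\<integral>\<^sup>+t. log_kernel (D + 1) z t \<partial>M) = (\<integral>\<^sup>+t. (SUP n. ennreal (?f n t)) \<partial>M)"
    using D by (intro nn_integral_cong_AE) (auto elim!: eventually_mono simp: log_kernel_eq_SUP)
  also have "\<dots> = (SUP n. \<integral>\<^sup>+t. ennreal (?f n t) \<partial>M)"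
  proof (rule nn_integral_monotone_convergence_SUP)
    show "incseq (\<lambda>n t. ennreal (?f n t))"
      by (intro incseq_SucI le_funI ennreal_leI diff_left_mono logreg_mono) (auto simp: field_simps)
  qed measurable
  also have "\<dots> = (SUP n. ennreal (ln (D + 1) * measure M UNIV - reg_pot M (1 / real (Suc n)) z))"
    by (simp add: nn_integral_eq_integral[OF int nonneg] int_eq del: of_nat_Suc)
  finally have *: "(\<integral>\<^sup>+t. log_kernel (D + 1) z t \<partial>M) = (SUP n. ennreal (ln (D + 1) * measure M UNIV - reg_pot M (1 / real (Suc n)) z))" .
  have "AE t in M. cmod (z - t) \<le> D + 1" using D(2) by eventually_elim auto
  from pot_eq_log_kernel[OF _ this] D(1) *
  show "pot M z = ereal (ln (D + 1) * measure M UNIV)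
     - enn2ereal (SUP n. ennreal (ln (D + 1) * measure M UNIV - reg_pot M (1 / real (Suc n)) z))" by simp
  show "reg_pot M (1 / real (Suc n)) z \<le> ln (D + 1) * measure M UNIV"
    using integral_nonneg_AE[OF nonneg] int_eq by simp
qed

lemma pot_le_reg_pot:
  assumes "e > 0"
  shows "pot M z \<le> ereal (reg_pot M e z)"
proof -
  obtain D where D: "D \<ge> 1" "AE t in M. cmod (z - t) \<le> D" using exists_dist_bound by blast
  obtain n where n: "1 / real (Suc n) < e" using assms nat_approx_posE by blast
  define c where "c = ln (D + 1) * measure M UNIV"
  have "ennreal (c - reg_pot M (1 / real (Suc n)) z) \<le> (SUP n. ennreal (c - reg_pot M (1 / real (Suc n)) z))"
    by (rule SUP_upper) auto
  then have "enn2ereal (ennreal (c - reg_pot M (1 / real (Suc n)) z)) \<le> enn2ereal (SUP n. ennreal (c - reg_pot M (1 / real (Suc n)) z))"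
    by (simp only: less_eq_ennreal.rep_eq)
  then have "pot M z \<le> ereal c - ereal (c - reg_pot M (1 / real (Suc n)) z)"
    unfolding pot_eq_SUP(1)[OF D] c_def[symmetric] using pot_eq_SUP(2)[OF D, of n]
    by (intro ereal_minus_mono order_refl) (simp add: enn2ereal_ennreal c_def)
  also have "\<dots> \<le> ereal (reg_pot M e z)" using reg_pot_mono[of "1 / real (Suc n)" e z] n by simp
  finally show ?thesis .
qed

lemma reg_pot_less:
  assumes "pot M z < ereal a"
  obtains n where "reg_pot M (1 / real (Suc n)) z < a"
proof -
  obtain D where D: "D \<ge> 1" "AE t in M. cmod (z - t) \<le> D" using exists_dist_bound by blast
  define c where "c = ln (D + 1) * measure M UNIV"
  have "\<exists>n. reg_pot M (1 / real (Suc n)) z < a"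
  proof (rule ccontr)
    assume "\<not> ?thesis"
    then have a: "a \<le> reg_pot M (1 / real (Suc n)) z" for n by (meson not_le_imp_less)
    have ca: "c - a \<ge> 0" using a[of 0] pot_eq_SUP(2)[OF D, of 0] by (simp add: c_def)
    have "(SUP n. ennreal (c - reg_pot M (1 / real (Suc n)) z)) \<le> ennreal (c - a)"
      using a by (intro SUP_least ennreal_leI) auto
    then have "enn2ereal (SUP n. ennreal (c - reg_pot M (1 / real (Suc n)) z)) \<le> ereal (c - a)"
      using ca by (simp add: less_eq_ennreal.rep_eq enn2ereal_ennreal)
    then have "ereal c - ereal (c - a) \<le> pot M z"
      unfolding pot_eq_SUP(1)[OF D] c_def[symmetric] by (intro ereal_minus_mono order_refl)
    then show False using assms by simp
  qed
  then show ?thesis using that by blast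
qed

text \<open>Upper semicontinuity: the potential is the decreasing limit of its continuous
  regularisations, so this sublevel set is a union of open ones.\<close>

lemma open_pot_less: "open {z. pot M z < ereal a}"
proof -
  have "{z. pot M z < ereal a} = (\<Union>n. {z. reg_pot M (1 / real (Suc n)) z < a})"
  proof (intro set_eqI iffI)
    fix z assume "z \<in> {z. pot M z < ereal a}"
    then show "z \<in> (\<Union>n. {z. reg_pot M (1 / real (Suc n)) z < a})" using reg_pot_less by blast
  next
    fix z assume "z \<in> (\<Union>n. {z. reg_pot M (1 / real (Suc n)) z < a})"
    then obtain n where "reg_pot M (1 / real (Suc n)) z < a" by blast
    then show "z \<in> {z. pot M z < ereal a}" using pot_le_reg_pot[of "1 / real (Suc n)" z]
      by (simp add: order_le_less_trans)
  qed
  also have "open \<dots>"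
    by (intro open_UN ballI open_Collect_less continuous_reg_pot continuous_on_const) auto
  finally show ?thesis .
qed

lemma closed_pot_ge: "closed {z. ereal a \<le> pot M z}"
  using open_pot_less[of a] by (simp add: closed_def Collect_neg_eq[symmetric] not_le)

text \<open>Dini's argument: the open sets increase as the regularisation shrinks, so a finite
  subcover is contained in its largest member.\<close>

lemma exists_reg_pot_less_on_compact:
  assumes "compact A" "\<And>z. z \<in> A \<Longrightarrow> pot M z < ereal a"
  obtains e where "e > 0" "\<And>z. z \<in> A \<Longrightarrow> reg_pot M e z < a"
proof -
  let ?O = "\<lambda>n. {z. reg_pot M (1 / real (Suc n)) z < a}"
  have op: "open (?O n)" for n by (intro open_Collect_less continuous_reg_pot continuous_on_const) auto
  have "A \<subseteq> (\<Union>n\<in>UNIV. ?O n)"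
  proof
    fix z assume "z \<in> A"
    from reg_pot_less[OF assms(2)[OF this]] show "z \<in> (\<Union>n\<in>UNIV. ?O n)" by blast
  qed
  then obtain C where C: "finite C" "A \<subseteq> (\<Union>n\<in>C. ?O n)"
    using op by (elim compactE_image[OF assms(1), of UNIV ?O, rotated])
  define e where "e = 1 / real (Suc (Max (insert 0 C)))"
  have "reg_pot M e z < a" if z: "z \<in> A" for z
  proof -
    obtain n where n: "n \<in> C" "reg_pot M (1 / real (Suc n)) z < a" using C(2) z by blast
    have "n \<le> Max (insert 0 C)" using n C by simp
    then have "e \<le> 1 / real (Suc n)" unfolding e_def by (intro divide_left_mono) auto
    then have "reg_pot M e z \<le> reg_pot M (1 / real (Suc n)) z" by (intro reg_pot_mono) (auto simp: e_def)
    then show ?thesis using n by simp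
  qed
  then show ?thesis using that[of e] by (simp add: e_def)
qed

lemma pot_ge_integral:
  assumes "integrable M g" "AE t in M. z \<noteq> t \<and> g t \<le> ln (cmod (z - t))"
  shows "ereal (integral\<^sup>L M g) \<le> pot M z"
proof (rule ccontr)
  assume "\<not> ?thesis"
  then have "pot M z < ereal (integral\<^sup>L M g)" by simp
  then obtain n where "reg_pot M (1 / real (Suc n)) z < integral\<^sup>L M g" by (rule reg_pot_less)
  moreover have "integral\<^sup>L M g \<le> reg_pot M (1 / real (Suc n)) z"
    unfolding reg_pot_def
  proof (intro integral_mono_AE assms integrable_logreg)
    show "AE t in M. g t \<le> logreg (1 / real (Suc n)) (z - t)" using assms(2)
    proof eventually_elim
      case (elim t)
      then show ?case using logreg_ge_ln_norm[of "z - t" "1 / real (Suc n)"] by auto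
    qed
  qed auto
  ultimately show False by simp
qed

text \<open>Since \<open>ln 0 = 0\<close> and the Bochner integral of a non-integrable function is
  0, the real integral alone would hide an atom at z or a divergent singularity. Finiteness of the
  shifted kernel integral excludes both.\<close>

lemma pot_finite_imp:
  assumes "pot M z \<noteq> -\<infinity>"
  shows "integrable M (\<lambda>t. ln (cmod (z - t)))" "AE t in M. t \<noteq> z"
    "pot M z = ereal (\<integral>t. ln (cmod (z - t)) \<partial>M)"
proof -
  obtain D where D: "D \<ge> 1" "AE t in M. cmod (z - t) \<le> D" using exists_dist_bound by blast
  have fin: "(\<integral>\<^sup>+t. log_kernel D z t \<partial>M) \<noteq> \<infinity>"
    using assms unfolding pot_eq_log_kernel[OF D] by auto
  then have "AE t in M. log_kernel D z t \<noteq> \<infinity>" by (intro nn_integral_PInf_AE) auto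
  then show ne: "AE t in M. t \<noteq> z" by eventually_elim (auto simp: log_kernel_def)
  let ?f = "\<lambda>t. ln D - ln (cmod (z - t))"
  have eq: "(\<integral>\<^sup>+t. log_kernel D z t \<partial>M) = (\<integral>\<^sup>+t. ennreal (?f t) \<partial>M)"
    using ne by (intro nn_integral_cong_AE) (auto elim!: eventually_mono simp: log_kernel_def)
  have nn: "AE t in M. 0 \<le> ?f t" using ne D(2)
    by eventually_elim (use D(1) in auto)
  have int: "integrable M ?f"
    using fin nn eq by (intro integrableI_nonneg) (auto simp: less_top)
  have "integrable M (\<lambda>t. ln D - ?f t)" by (intro Bochner_Integration.integrable_diff integrable_const int)
  then show int': "integrable M (\<lambda>t. ln (cmod (z - t)))" by simp
  have "(\<integral>\<^sup>+t. log_kernel D z t \<partial>M) = ennreal (\<integral>t. ?f t \<partial>M)"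
    unfolding eq by (rule nn_integral_eq_integral[OF int nn])
  moreover have "(\<integral>t. ?f t \<partial>M) = ln D * measure M UNIV - (\<integral>t. ln (cmod (z - t)) \<partial>M)"
    using int' by (subst Bochner_Integration.integral_diff) (auto simp: space_M)
  moreover have "(\<integral>t. ?f t \<partial>M) \<ge> 0" using nn by (rule integral_nonneg_AE)
  ultimately show "pot M z = ereal (\<integral>t. ln (cmod (z - t)) \<partial>M)"
    unfolding pot_eq_log_kernel[OF D] by (simp add: enn2ereal_ennreal)
qed

end

section \<open>Mixtures and mutual energy\<close>

text \<open>The sum is the bind of counting measure with the family. The kernel has to consist of
  subprobability measures, hence the mass bound, but the total mass may exceed 1.\<close>

lemma exists_sum_measure:
  fixes \<nu> :: "'i \<Rightarrow> complex measure"
  assumes "finite I" "I \<noteq> {}" "\<And>i. i \<in> I \<Longrightarrow> sets (\<nu> i) = sets borel" "\<And>i. i \<in> I \<Longrightarrow> emeasure (\<nu> i) UNIV \<le> 1"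
  obtains \<rho> :: "complex measure" where "sets \<rho> = sets borel"
    "\<And>f :: complex \<Rightarrow> ennreal. f \<in> borel_measurable borel \<Longrightarrow> (\<integral>\<^sup>+t. f t \<partial>\<rho>) = (\<Sum>i\<in>I. \<integral>\<^sup>+t. f t \<partial>\<nu> i)"
proof -
  let ?\<rho> = "count_space I \<bind> \<nu>"
  have sp: "space (\<nu> i) = UNIV" if "i \<in> I" for i using sets_eq_imp_space_eq[OF assms(3)[OF that]] by simp
  have meas: "\<nu> \<in> measurable (count_space I) (subprob_algebra borel)"
    using assms(3,4) sp by (auto simp: measurable_count_space_eq1 space_subprob_algebra intro!: subprob_spaceI)
  have "sets ?\<rho> = sets borel" using assms by (intro sets_bind) auto
  moreover have "(\<integral>\<^sup>+t. f t \<partial>?\<rho>) = (\<Sum>i\<in>I. \<integral>\<^sup>+t. f t \<partial>\<nu> i)" if "f \<in> borel_measurable borel" for f :: "complex \<Rightarrow> ennreal"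
    by (subst nn_integral_bind[OF that meas]) (simp add: nn_integral_count_space_finite assms(1))
  ultimately show ?thesis using that by blast
qed

lemma prob_on_AE: "closed E \<Longrightarrow> prob_on E \<mu> \<Longrightarrow> AE t in \<mu>. t \<in> E"
  unfolding prob_on_def
  by (rule AE_I[of _ _ "UNIV - E"]) (auto)

lemma prob_onI:
  assumes "sets \<rho> = sets borel" "emeasure \<rho> UNIV = 1" "closed E" "AE t in \<rho>. t \<in> E"
  shows "prob_on E \<rho>"
proof -
  have sp: "space \<rho> = UNIV" using sets_eq_imp_space_eq[OF assms(1)] by simp
  have "UNIV - E \<in> sets \<rho>" using assms by (auto simp: assms(1))
  then have "emeasure \<rho> (UNIV - E) = 0" using assms(4) sp by (subst (asm) AE_iff_measurable[where N="UNIV - E"]) auto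
  then show ?thesis using assms sp by (auto simp: prob_on_def intro!: prob_spaceI)
qed

lemma exists_mixture:
  assumes E: "closed E" and pr: "prob_on E \<mu>" "prob_on E \<sigma>" and x: "0 \<le> x" "x \<le> 1"
  obtains \<rho> where "prob_on E \<rho>"
    "\<And>f :: complex \<Rightarrow> ennreal. f \<in> borel_measurable borel \<Longrightarrow>
       (\<integral>\<^sup>+t. f t \<partial>\<rho>) = ennreal (1 - x) * (\<integral>\<^sup>+t. f t \<partial>\<mu>) + ennreal x * (\<integral>\<^sup>+t. f t \<partial>\<sigma>)"
proof -
  let ?\<nu> = "\<lambda>b. if b then scale_measure (ennreal (1 - x)) \<mu> else scale_measure (ennreal x) \<sigma>"
  have s: "sets \<mu> = sets borel" "sets \<sigma> = sets borel" using pr by (auto simp: prob_on_def)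
  have sp: "space \<mu> = UNIV" "space \<sigma> = UNIV" using s[THEN sets_eq_imp_space_eq] by auto
  have e: "emeasure \<mu> UNIV = 1" "emeasure \<sigma> UNIV = 1"
    using pr sp prob_space.emeasure_space_1 by (fastforce simp: prob_on_def)+
  have m: "f \<in> borel_measurable \<mu>" "f \<in> borel_measurable \<sigma>" if "f \<in> borel_measurable borel" for f :: "complex \<Rightarrow> ennreal"
    using that s by (auto simp: measurable_def sp cong: measurable_cong_sets)
  obtain \<rho> where \<rho>: "sets \<rho> = sets borel"
    "\<And>f :: complex \<Rightarrow> ennreal. f \<in> borel_measurable borel \<Longrightarrow> (\<integral>\<^sup>+t. f t \<partial>\<rho>) = (\<Sum>i\<in>UNIV. \<integral>\<^sup>+t. f t \<partial>?\<nu> i)"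
  proof (rule exists_sum_measure[of UNIV ?\<nu>])
    show "emeasure (?\<nu> i) UNIV \<le> 1" for i using e x by (auto simp: ennreal_le_1)
  qed (use s in auto)
  have int: "(\<integral>\<^sup>+t. f t \<partial>\<rho>) = ennreal (1 - x) * (\<integral>\<^sup>+t. f t \<partial>\<mu>) + ennreal x * (\<integral>\<^sup>+t. f t \<partial>\<sigma>)"
    if "f \<in> borel_measurable borel" for f :: "complex \<Rightarrow> ennreal"
    using \<rho>(2)[OF that] m[OF that] by (simp add: UNIV_bool nn_integral_scale_measure add.commute)
  have em: "emeasure \<rho> A = ennreal (1 - x) * emeasure \<mu> A + ennreal x * emeasure \<sigma> A" if "A \<in> sets borel" for A
    using int[of "indicator A"] that s \<rho>(1) by (simp)
  have "prob_on E \<rho>"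
    unfolding prob_on_def
  proof (intro conjI \<rho>(1) prob_spaceI)
    have "ennreal (1 - x) + ennreal x = 1" using x by (simp flip: ennreal_plus)
    then show "emeasure \<rho> (space \<rho>) = 1" using em[of UNIV] e sets_eq_imp_space_eq[OF \<rho>(1)] by simp
    show "emeasure \<rho> (UNIV - E) = 0" using em[of "UNIV - E"] pr E by (simp add: prob_on_def)
  qed
  then show ?thesis using that int by blast
qed

text \<open>For probability measures on a set of diameter at most D this is the mutual logarithmic
  energy plus \<open>ln D\<close>, hence nonnegative and well defined in
  \<open>ennreal\<close>.\<close>

definition mutual :: "real \<Rightarrow> complex measure \<Rightarrow> complex measure \<Rightarrow> ennreal" where
  "mutual D \<sigma> \<tau> = (\<integral>\<^sup>+z. \<integral>\<^sup>+t. log_kernel D z t \<partial>\<tau> \<partial>\<sigma>)"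

lemma nn_integral_kernel_measurable:
  assumes "sigma_finite_measure \<tau>" "sets \<tau> = sets borel"
    "(\<lambda>p. k (fst p) (snd p)) \<in> borel_measurable (borel \<Otimes>\<^sub>M borel)"
  shows "(\<lambda>z::complex. \<integral>\<^sup>+t. k z t \<partial>\<tau>) \<in> borel_measurable borel"
proof -
  interpret sigma_finite_measure \<tau> by fact
  have "(\<lambda>p. k (fst p) (snd p)) \<in> borel_measurable (borel \<Otimes>\<^sub>M \<tau>)"
    using assms by (simp cong: measurable_cong_sets sets_pair_measure_cong)
  from borel_measurable_nn_integral[of "\<lambda>z t. k z t" borel] this
  show ?thesis by (simp add: split_beta')
qed

lemma mutual_commute:
  assumes "sigma_finite_measure \<sigma>" "sigma_finite_measure \<tau>" "sets \<sigma> = sets borel" "sets \<tau> = sets borel"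
  shows "mutual D \<sigma> \<tau> = mutual D \<tau> \<sigma>"
proof -
  interpret a: sigma_finite_measure \<sigma> by fact
  interpret b: sigma_finite_measure \<tau> by fact
  interpret pair_sigma_finite \<sigma> \<tau> ..
  have m: "(\<lambda>(z, t). log_kernel D z t) \<in> borel_measurable (\<sigma> \<Otimes>\<^sub>M \<tau>)"
    using log_kernel_measurable[of D] assms by (simp add: split_beta' cong: measurable_cong_sets sets_pair_measure_cong)
  have "mutual D \<tau> \<sigma> = (\<integral>\<^sup>+t. \<integral>\<^sup>+z. log_kernel D z t \<partial>\<sigma> \<partial>\<tau>)"
    unfolding mutual_def by (simp only: log_kernel_commute[of D])
  also have "\<dots> = mutual D \<sigma> \<tau>" unfolding mutual_def using Fubini'[OF m] by simp
  finally show ?thesis by simp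
qed

lemma enn2ereal_diff_eq':
  assumes "a + k = ennreal c + b" "a \<le> ennreal c" "c \<ge> 0"
  shows "enn2ereal b - enn2ereal a = enn2ereal k - ereal c"
proof -
  have "enn2ereal b - enn2ereal a = - (enn2ereal a - enn2ereal b)"
    using assms(2) by (cases a; cases b) (auto simp: enn2ereal_ennreal top_unique)
  also have "\<dots> = - (ereal c - enn2ereal k)" by (simp only: enn2ereal_diff_eq[OF assms])
  also have "\<dots> = enn2ereal k - ereal c" by (cases k) (auto simp: enn2ereal_ennreal)
  finally show ?thesis .
qed

lemma energy_eq_mutual:
  assumes E: "compact E" and pr: "prob_on E \<sigma>" and D: "D \<ge> 1" "\<And>z t. z \<in> E \<Longrightarrow> t \<in> E \<Longrightarrow> cmod (z - t) \<le> D"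
  shows "energy \<sigma> = enn2ereal (mutual D \<sigma> \<sigma>) - ereal (ln D)"
proof -
  interpret prob_space \<sigma> using pr by (simp add: prob_on_def)
  have s [measurable_cong]: "sets \<sigma> = sets borel" using pr by (simp add: prob_on_def)
  have sp: "space \<sigma> = UNIV" using sets_eq_imp_space_eq[OF s] by simp
  have ae: "AE t in \<sigma>. t \<in> E" by (rule prob_on_AE[OF compact_imp_closed[OF E] pr])
  have [measurable]: "(\<lambda>z. \<integral>\<^sup>+t. log_pos z t \<partial>\<sigma>) \<in> borel_measurable borel" "(\<lambda>z. \<integral>\<^sup>+t. log_neg z t \<partial>\<sigma>) \<in> borel_measurable borel"
    "(\<lambda>z. \<integral>\<^sup>+t. log_kernel D z t \<partial>\<sigma>) \<in> borel_measurable borel"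
    by (intro nn_integral_kernel_measurable log_pos_measurable log_neg_measurable log_kernel_measurable s sigma_finite_measure_axioms)+
  have aeD: "AE t in \<sigma>. cmod (z - t) \<le> D" if "z \<in> E" for z using ae by eventually_elim (use D that in auto)
  obtain R where "\<forall>t\<in>E. cmod t \<le> R" using compact_imp_bounded[OF E] by (auto simp: bounded_iff)
  then interpret bounded_support \<sigma> R
    by unfold_locales (use s ae in \<open>auto elim: eventually_mono\<close>)
  have m1: "measure \<sigma> UNIV = 1" using prob_space sp by simp
  have "(\<integral>\<^sup>+z. \<integral>\<^sup>+t. log_pos z t \<partial>\<sigma> \<partial>\<sigma>) + mutual D \<sigma> \<sigma> = (\<integral>\<^sup>+z. (\<integral>\<^sup>+t. log_pos z t \<partial>\<sigma>) + (\<integral>\<^sup>+t. log_kernel D z t \<partial>\<sigma>) \<partial>\<sigma>)"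
    unfolding mutual_def by (rule nn_integral_add[symmetric]) measurable
  also have "\<dots> = (\<integral>\<^sup>+z. ennreal (ln D) + (\<integral>\<^sup>+t. log_neg z t \<partial>\<sigma>) \<partial>\<sigma>)"
    using ae by (intro nn_integral_cong_AE) (auto elim!: eventually_mono simp: nn_integral_log_pos_add[OF D(1) aeD] m1)
  also have "\<dots> = ennreal (ln D) + (\<integral>\<^sup>+z. \<integral>\<^sup>+t. log_neg z t \<partial>\<sigma> \<partial>\<sigma>)"
    by (subst nn_integral_add) (auto simp: emeasure_space_1)
  finally have 1: "(\<integral>\<^sup>+z. \<integral>\<^sup>+t. log_pos z t \<partial>\<sigma> \<partial>\<sigma>) + mutual D \<sigma> \<sigma> = ennreal (ln D) + (\<integral>\<^sup>+z. \<integral>\<^sup>+t. log_neg z t \<partial>\<sigma> \<partial>\<sigma>)" .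
  have "(\<integral>\<^sup>+z. \<integral>\<^sup>+t. log_pos z t \<partial>\<sigma> \<partial>\<sigma>) \<le> (\<integral>\<^sup>+z. ennreal (ln D) \<partial>\<sigma>)"
    using ae nn_integral_log_pos_le[OF D(1) aeD] m1 by (intro nn_integral_mono_AE) (auto elim!: eventually_mono)
  then have 2: "(\<integral>\<^sup>+z. \<integral>\<^sup>+t. log_pos z t \<partial>\<sigma> \<partial>\<sigma>) \<le> ennreal (ln D)" by (simp add: emeasure_space_1)
  show ?thesis unfolding energy_def using enn2ereal_diff_eq'[OF 1 2] D(1) by simp
qed

section \<open>The equilibrium measure\<close>

locale equilibrium =
  fixes E :: "complex set" and \<mu> :: "complex measure"
  assumes compact_E: "compact E" and cap_pos: "log_capacity E > 0"
    and equilibrium: "is_equilibrium_measure E \<mu>"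
begin

lemma closed_E: "closed E" using compact_E by (rule compact_imp_closed)

lemma prob_on_mu: "prob_on E \<mu>" using equilibrium by (simp add: is_equilibrium_measure_def)

text \<open>At least 1, so that the diameter bound \<open>2 * RE\<close> has nonnegative logarithm
  however small E is.\<close>

definition RE :: real where "RE = (SOME R. R \<ge> 1 \<and> (\<forall>z\<in>E. cmod z \<le> R))"

lemma RE: "RE \<ge> 1" "z \<in> E \<Longrightarrow> cmod z \<le> RE"
proof -
  obtain R where "\<forall>z\<in>E. cmod z \<le> R" using compact_imp_bounded[OF compact_E] by (auto simp: bounded_iff)
  then have "\<exists>R. R \<ge> 1 \<and> (\<forall>z\<in>E. cmod z \<le> R)" by (intro exI[of _ "max 1 R"]) auto
  from someI_ex[OF this] show "RE \<ge> 1" "z \<in> E \<Longrightarrow> cmod z \<le> RE" by (auto simp: RE_def)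
qed

abbreviation "D \<equiv> 2 * RE"

lemma D_ge_1: "D \<ge> 1" using RE by simp

lemma dist_le_D: "z \<in> E \<Longrightarrow> t \<in> E \<Longrightarrow> cmod (z - t) \<le> D"
  using norm_triangle_ineq4[of z t] RE(2)[of z] RE(2)[of t] by simp

lemma AE_mu_E: "AE t in \<mu>. t \<in> E" by (rule prob_on_AE[OF closed_E prob_on_mu])

sublocale prob_space \<mu> using prob_on_mu by (simp add: prob_on_def)

sublocale bounded_support \<mu> RE
proof
  show "sets \<mu> = sets borel" using prob_on_mu by (simp add: prob_on_def)
  show "AE t in \<mu>. cmod t \<le> RE" using AE_mu_E by eventually_elim (rule RE)
qed

definition L :: real where "L = - real_of_ereal (robin E)"

lemma ln_cap: "ln (log_capacity E) = L"
  using cap_pos by (auto simp: log_capacity_def L_def split: if_splits)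

text \<open>Positive capacity excludes only the value \<open>\<infinity>\<close>: at
  \<open>-\<infinity>\<close> the function \<open>real_of_ereal\<close> returns 0 and the capacity
  would read 1. That value is impossible because \<mu> attains the infimum and its energy is at
  least \<open>- ln D\<close>.\<close>

lemma robin_eq: "robin E = ereal (- L)"
proof -
  have "robin E \<noteq> \<infinity>" using cap_pos by (auto simp: log_capacity_def split: if_splits)
  moreover have "robin E = enn2ereal (mutual D \<mu> \<mu>) - ereal (ln D)"
    using energy_eq_mutual[OF compact_E prob_on_mu D_ge_1 dist_le_D] equilibrium
    by (simp add: is_equilibrium_measure_def)
  then have "robin E \<noteq> -\<infinity>" by (cases "mutual D \<mu> \<mu>") (auto simp: enn2ereal_ennreal)
  ultimately show ?thesis by (cases "robin E") (auto simp: L_def)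
qed

text \<open>The Robin constant \<open>- L\<close> in the scale shifted by \<open>ln D\<close>, so
  that minimality of \<mu> becomes an inequality in \<open>ennreal\<close>.\<close>

definition g :: real where "g = ln D - L"

lemma g_nonneg: "g \<ge> 0" and mutual_mu: "mutual D \<mu> \<mu> = ennreal g"
proof -
  have "enn2ereal (mutual D \<mu> \<mu>) - ereal (ln D) = ereal (- L)"
    using energy_eq_mutual[OF compact_E prob_on_mu D_ge_1 dist_le_D] equilibrium robin_eq
    by (simp add: is_equilibrium_measure_def)
  then obtain r where r: "mutual D \<mu> \<mu> = ennreal r" "r \<ge> 0" "r - ln D = - L"
    by (cases "mutual D \<mu> \<mu>") (auto simp: enn2ereal_ennreal)
  then show "g \<ge> 0" "mutual D \<mu> \<mu> = ennreal g" by (auto simp: g_def)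
qed

lemma mutual_ge: "prob_on E \<sigma> \<Longrightarrow> ennreal g \<le> mutual D \<sigma> \<sigma>"
proof -
  assume pr: "prob_on E \<sigma>"
  have "robin E \<le> energy \<sigma>" unfolding robin_def using pr by (intro INF_lower) auto
  then have *: "ereal (- L) \<le> enn2ereal (mutual D \<sigma> \<sigma>) - ereal (ln D)"
    using energy_eq_mutual[OF compact_E pr D_ge_1 dist_le_D] robin_eq by simp
  show ?thesis
  proof (cases "mutual D \<sigma> \<sigma>")
    case (real r)
    then show ?thesis using * by (auto simp: enn2ereal_ennreal g_def intro!: ennreal_leI)
  qed simp
qed

abbreviation G :: "complex \<Rightarrow> ennreal" where "G z \<equiv> (\<integral>\<^sup>+t. log_kernel D z t \<partial>\<mu>)"

lemma G_measurable [measurable]: "G \<in> borel_measurable borel"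
  by (intro nn_integral_kernel_measurable sigma_finite_measure_axioms sets_M log_kernel_measurable)

lemma pot_eq_kernel:
  assumes "prob_on E \<sigma>" "z \<in> E"
  shows "pot \<sigma> z = ereal (ln D) - enn2ereal (\<integral>\<^sup>+t. log_kernel D z t \<partial>\<sigma>)"
    and "bounded_support \<sigma> RE"
proof -
  interpret p: prob_space \<sigma> using assms by (simp add: prob_on_def)
  have ae: "AE t in \<sigma>. t \<in> E" by (rule prob_on_AE[OF closed_E assms(1)])
  have "AE t in \<sigma>. cmod t \<le> RE" using ae by eventually_elim (rule RE)
  then show bs: "bounded_support \<sigma> RE" by unfold_locales (use assms in \<open>auto simp: prob_on_def\<close>)
  interpret b: bounded_support \<sigma> RE by (rule bs)
  have "AE t in \<sigma>. cmod (z - t) \<le> D" using ae by eventually_elim (rule dist_le_D[OF assms(2)])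
  from b.pot_eq_log_kernel[OF D_ge_1 this] show "pot \<sigma> z = ereal (ln D) - enn2ereal (\<integral>\<^sup>+t. log_kernel D z t \<partial>\<sigma>)"
    using p.prob_space b.space_M by simp
qed

lemmas pot_eq_G = pot_eq_kernel(1)[OF prob_on_mu]

lemma pot_ge_iff: "z \<in> E \<Longrightarrow> ereal a \<le> pot \<mu> z \<longleftrightarrow> enn2ereal (G z) \<le> ereal (ln D - a)"
  unfolding pot_eq_G by (cases "G z") (auto simp: enn2ereal_ennreal)

text \<open>First variation of the energy along \<open>(1 - x) \<mu> + x \<sigma>\<close>.\<close>

lemma finite_energy_not_pot_ge:
  assumes pr: "prob_on E \<sigma>" and fin: "mutual D \<sigma> \<sigma> < \<infinity>" and \<eta>: "\<eta> > 0"
    and ge: "AE z in \<sigma>. ereal (L + \<eta>) \<le> pot \<mu> z"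
  shows False
proof -
  interpret s: prob_space \<sigma> using pr by (simp add: prob_on_def)
  have ss [measurable_cong]: "sets \<sigma> = sets borel" using pr by (simp add: prob_on_def)
  have aeE: "AE z in \<sigma>. z \<in> E" by (rule prob_on_AE[OF closed_E pr])
  have aeG: "AE z in \<sigma>. g - \<eta> \<ge> 0 \<and> G z \<le> ennreal (g - \<eta>)"
    using aeE ge
  proof eventually_elim
    case (elim z)
    then have *: "enn2ereal (G z) \<le> ereal (g - \<eta>)" by (simp add: pot_ge_iff g_def algebra_simps)
    then have "0 \<le> ereal (g - \<eta>)" using enn2ereal_nonneg order_trans by blast
    then show ?case using * by (simp add: less_eq_ennreal.rep_eq enn2ereal_ennreal)
  qed
  have "AE z in \<sigma>. g - \<eta> \<ge> 0" using aeG by eventually_elim auto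
  then have g\<eta>: "g - \<eta> \<ge> 0" using s.AE_const by blast
  have "mutual D \<sigma> \<mu> \<le> (\<integral>\<^sup>+z. ennreal (g - \<eta>) \<partial>\<sigma>)"
    unfolding mutual_def using aeG by (intro nn_integral_mono_AE) auto
  then have "mutual D \<sigma> \<mu> \<le> ennreal (g - \<eta>)" by (simp add: s.emeasure_space_1)
  then obtain b where b: "mutual D \<sigma> \<mu> = ennreal b" "0 \<le> b" "b \<le> g - \<eta>"
    using g\<eta> by (cases "mutual D \<sigma> \<mu>") (auto simp: top_unique)
  obtain c where c: "mutual D \<sigma> \<sigma> = ennreal c" "0 \<le> c" using fin by (cases "mutual D \<sigma> \<sigma>") auto
  have b': "mutual D \<mu> \<sigma> = ennreal b"
    using mutual_commute[OF sigma_finite_measure_axioms s.sigma_finite_measure_axioms sets_M ss] b by simp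
  \<comment> \<open>Expanding \<open>g \<le> mutual D \<rho> \<rho>\<close> gives
    \<open>2 * (g - b) \<le> x * (g - 2 * b + c)\<close>. With \<open>b \<le> g - \<eta>\<close>
    this makes \<open>2 * \<eta>\<close> at most \<open>x * (g + c + 1)\<close>, which the choice of
    x bounds by \<eta>.\<close>
  define x where "x = min (1/2) (\<eta> / (g + c + 1))"
  have gc: "g + c + 1 > 0" using g_nonneg c by simp
  have x: "0 < x" "x \<le> 1/2" unfolding x_def using \<eta> gc min.cobounded1[of "1/2" "\<eta> / (g + c + 1)"] by simp_all
  have "x \<le> \<eta> / (g + c + 1)" by (simp add: x_def)
  then have x': "x * (g + c + 1) \<le> \<eta>" using gc by (simp add: pos_le_divide_eq)
  obtain \<rho> where \<rho>: "prob_on E \<rho>"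
    "\<And>f :: complex \<Rightarrow> ennreal. f \<in> borel_measurable borel \<Longrightarrow>
       (\<integral>\<^sup>+t. f t \<partial>\<rho>) = ennreal (1 - x) * (\<integral>\<^sup>+t. f t \<partial>\<mu>) + ennreal x * (\<integral>\<^sup>+t. f t \<partial>\<sigma>)"
    using exists_mixture[OF closed_E prob_on_mu pr, of x] x by auto
  have [measurable]: "(\<lambda>z. \<integral>\<^sup>+t. log_kernel D z t \<partial>\<sigma>) \<in> borel_measurable borel"
    by (intro nn_integral_kernel_measurable s.sigma_finite_measure_axioms ss log_kernel_measurable)
  have "mutual D \<rho> \<rho> = (\<integral>\<^sup>+z. ennreal (1 - x) * G z + ennreal x * (\<integral>\<^sup>+t. log_kernel D z t \<partial>\<sigma>) \<partial>\<rho>)"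
    unfolding mutual_def by (simp add: \<rho>(2))
  also have "\<dots> = ennreal (1 - x) * (ennreal (1 - x) * ennreal g + ennreal x * ennreal b)
      + ennreal x * (ennreal (1 - x) * ennreal b + ennreal x * ennreal c)"
    using mutual_mu b b' c unfolding mutual_def by (subst \<rho>(2)) (auto simp: nn_integral_add nn_integral_cmult)
  also have "\<dots> = ennreal ((1 - x) * ((1 - x) * g + x * b) + x * ((1 - x) * b + x * c))"
    using x g_nonneg b c by (simp add: ennreal_mult ennreal_plus)
  finally have "ennreal g \<le> ennreal ((1 - x) * ((1 - x) * g + x * b) + x * ((1 - x) * b + x * c))"
    using mutual_ge[OF \<rho>(1)] by metis
  moreover have "0 \<le> (1 - x) * ((1 - x) * g + x * b) + x * ((1 - x) * b + x * c)"
    using x g_nonneg b c by (intro add_nonneg_nonneg mult_nonneg_nonneg) auto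
  ultimately have "g \<le> (1 - x) * ((1 - x) * g + x * b) + x * ((1 - x) * b + x * c)"
    by (simp only: ennreal_le_iff)
  then have "x * (2 * (g - b)) \<le> x * (x * (g - 2 * b + c))" by (simp add: algebra_simps)
  then have "2 * (g - b) \<le> x * (g - 2 * b + c)" using x by simp
  also have "\<dots> \<le> x * (g + c + 1)" using x b by (intro mult_left_mono) auto
  also note x'
  finally show False using b(3) \<eta> by simp
qed

text \<open>Otherwise \<mu> conditioned on this set A has density at most
  \<open>1 / \<mu>(A)\<close>, hence shifted energy at most \<open>g / \<mu>(A)^2\<close>, and the
  first variation forbids finite energy on A.\<close>

lemma emeasure_pot_ge_eq_0:
  assumes "\<eta> > 0"
  shows "emeasure \<mu> {z\<in>E. ereal (L + \<eta>) \<le> pot \<mu> z} = 0"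
proof (rule ccontr)
  define A where "A = {z\<in>E. ereal (L + \<eta>) \<le> pot \<mu> z}"
  assume "emeasure \<mu> {z\<in>E. ereal (L + \<eta>) \<le> pot \<mu> z} \<noteq> 0"
  then have A0: "emeasure \<mu> A \<noteq> 0" by (simp add: A_def)
  have "closed A" unfolding A_def Collect_conj_eq using closed_E closed_pot_ge by (auto intro: closed_Int)
  then have Am [measurable]: "A \<in> sets borel" by simp
  have Am' [measurable]: "A \<in> sets \<mu>" by (simp add: sets_M)
  define \<sigma> where "\<sigma> = uniform_measure \<mu> A"
  have ss: "sets \<sigma> = sets borel" by (simp add: \<sigma>_def sets_M)
  have fin: "emeasure \<mu> A \<noteq> \<infinity>" by simp
  interpret s: prob_space \<sigma> unfolding \<sigma>_def using A0 fin by (intro prob_space_uniform_measure) auto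
  have aeA: "AE z in \<sigma>. z \<in> A" unfolding \<sigma>_def by (rule AE_uniform_measureI) auto
  have pr: "prob_on E \<sigma>"
  proof (rule prob_onI[OF ss _ closed_E])
    show "emeasure \<sigma> UNIV = 1" using s.emeasure_space_1 sets_eq_imp_space_eq[OF ss] by simp
    show "AE t in \<sigma>. t \<in> E" using aeA by eventually_elim (auto simp: A_def)
  qed
  define c where "c = inverse (emeasure \<mu> A)"
  have c: "c < \<infinity>" using A0 by (simp add: c_def less_top[symmetric])
  have le: "(\<integral>\<^sup>+t. f t \<partial>\<sigma>) \<le> c * (\<integral>\<^sup>+t. f t \<partial>\<mu>)" if [measurable]: "f \<in> borel_measurable borel" for f :: "complex \<Rightarrow> ennreal"
  proof -
    have "(\<integral>\<^sup>+t. f t \<partial>\<sigma>) = (\<integral>\<^sup>+t. f t * indicator A t \<partial>\<mu>) / emeasure \<mu> A"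
      unfolding \<sigma>_def by (rule nn_integral_uniform_measure) auto
    also have "\<dots> \<le> (\<integral>\<^sup>+t. f t \<partial>\<mu>) / emeasure \<mu> A"
      by (intro divide_right_mono_ennreal nn_integral_mono) (auto simp: indicator_def)
    finally show ?thesis by (simp add: c_def divide_ennreal_def mult.commute)
  qed
  have "mutual D \<sigma> \<sigma> \<le> (\<integral>\<^sup>+z. c * G z \<partial>\<sigma>)"
    unfolding mutual_def by (intro nn_integral_mono le) simp
  also have "\<dots> \<le> c * (\<integral>\<^sup>+z. c * G z \<partial>\<mu>)" by (intro le) simp
  also have "\<dots> = c * (c * ennreal g)" using mutual_mu by (simp add: nn_integral_cmult mutual_def)
  also have "\<dots> < \<infinity>" using c by (simp add: ennreal_mult_less_top)
  finally have "mutual D \<sigma> \<sigma> < \<infinity>" .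
  moreover have "AE z in \<sigma>. ereal (L + \<eta>) \<le> pot \<mu> z" using aeA by eventually_elim (auto simp: A_def)
  ultimately show False using finite_energy_not_pot_ge[OF pr _ assms] by blast
qed

text \<open>The previous lemma along \<open>\<eta> = 1 / Suc n\<close> gives
  \<open>G \<ge> g\<close> almost everywhere, while the mean of G is exactly g. Hence G equals g
  almost everywhere, which contains the opposite inequality stated here.\<close>

lemma AE_pot_ge: "AE z in \<mu>. ereal L \<le> pot \<mu> z"
proof -
  have "AE z in \<mu>. \<forall>n. pot \<mu> z < ereal (L + 1 / real (Suc n))"
    unfolding AE_all_countable
  proof
    fix n
    have "AE z in \<mu>. z \<notin> {z\<in>E. ereal (L + 1 / real (Suc n)) \<le> pot \<mu> z}"
    proof (rule AE_not_in, rule null_setsI)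
      show "emeasure \<mu> {z \<in> E. ereal (L + 1 / real (Suc n)) \<le> pot \<mu> z} = 0" by (rule emeasure_pot_ge_eq_0) simp
      show "{z \<in> E. ereal (L + 1 / real (Suc n)) \<le> pot \<mu> z} \<in> sets \<mu>"
        using closed_Int[OF closed_E closed_pot_ge[of "L + 1 / real (Suc n)"]] by (simp add: sets_M Collect_conj_eq borel_closed)
    qed
    then show "AE z in \<mu>. pot \<mu> z < ereal (L + 1 / real (Suc n))" using AE_mu_E by eventually_elim auto
  qed
  then have geG: "AE z in \<mu>. ennreal g \<le> G z"
    using AE_mu_E
  proof eventually_elim
    case (elim z)
    show ?case
    proof (cases "G z")
      case (real r)
      then have "ln D - r < L + 1 / real (Suc n)" for n
        using elim(1)[rule_format, of n] elim(2) by (simp add: pot_eq_G enn2ereal_ennreal)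
      moreover have "(\<lambda>n. L + 1 / real (Suc n)) \<longlonglongrightarrow> L + 0" by (intro tendsto_intros LIMSEQ_Suc lim_1_over_n)
      ultimately have "ln D - r \<le> L + 0" by (intro LIMSEQ_le_const) (auto intro: less_imp_le)
      then show ?thesis using real by (simp add: g_def ennreal_le_iff)
    qed simp
  qed
  have "(\<integral>\<^sup>+z. G z - ennreal g \<partial>\<mu>) = (\<integral>\<^sup>+z. G z \<partial>\<mu>) - (\<integral>\<^sup>+z. ennreal g \<partial>\<mu>)"
    using geG by (intro nn_integral_diff) (auto simp: emeasure_space_1)
  also have "\<dots> = 0" using mutual_mu by (simp add: mutual_def emeasure_space_1)
  finally have "AE z in \<mu>. G z - ennreal g = 0" by (subst (asm) nn_integral_0_iff_AE) auto
  then show ?thesis using AE_mu_E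
  proof eventually_elim
    case (elim z)
    then have "G z \<le> ennreal g" by (simp add: diff_eq_0_iff_ennreal)
    then have "enn2ereal (G z) \<le> ereal g" using g_nonneg by (simp add: less_eq_ennreal.rep_eq enn2ereal_ennreal)
    then show ?case using elim by (simp add: pot_ge_iff g_def)
  qed
qed

text \<open>The carrier of \<mu> on which the lower bound by L holds at every point, and not just
  almost everywhere. It takes over the role of the boundary in the maximum principle.\<close>

definition S :: "complex set" where "S = {z\<in>E. ereal L \<le> pot \<mu> z}"

lemma S_subset: "S \<subseteq> E" by (auto simp: S_def)

lemma compact_S: "compact S"
  unfolding S_def Collect_conj_eq using compact_Int_closed[OF compact_E closed_pot_ge[of L]] by simp

lemma AE_mu_S: "AE t in \<mu>. t \<in> S"
  using AE_mu_E AE_pot_ge by eventually_elim (auto simp: S_def)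

lemma S_nonempty: "S \<noteq> {}"
  using AE_mu_S AE_const by fastforce

end

section \<open>The Bernstein--Walsh inequality\<close>

context equilibrium begin

definition U :: "complex \<Rightarrow> real" where "U z = (\<integral>t. ln (cmod (z - t)) \<partial>\<mu>)"

lemma potential_on_S:
  assumes "z \<in> S"
  shows "integrable \<mu> (\<lambda>t. ln (cmod (z - t)))" "AE t in \<mu>. t \<noteq> z" "U z \<ge> L"
proof -
  have *: "ereal L \<le> pot \<mu> z" using assms by (simp add: S_def)
  then have "pot \<mu> z \<noteq> -\<infinity>" by auto
  from pot_finite_imp[OF this] * show "integrable \<mu> (\<lambda>t. ln (cmod (z - t)))" "AE t in \<mu>. t \<noteq> z" "U z \<ge> L"
    by (auto simp: U_def)
qed

lemma infdist_pos: "z \<notin> S \<Longrightarrow> infdist z S > 0"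
  using in_closed_iff_infdist_zero[OF compact_imp_closed[OF compact_S] S_nonempty, of z] infdist_nonneg[of z S]
  by linarith

lemma AE_infdist_le: "AE t in \<mu>. infdist z S \<le> cmod (z - t)"
  using AE_mu_S by eventually_elim (metis infdist_le dist_norm)

lemma AE_neq: "AE t in \<mu>. t \<noteq> z"
proof (cases "z \<in> S")
  case False
  then show ?thesis using AE_mu_S by (auto elim!: eventually_mono)
qed (use potential_on_S in auto)

lemma integrable_ln_norm: "integrable \<mu> (\<lambda>t. ln (cmod (z - t)))"
proof (cases "z \<in> S")
  case False
  show ?thesis
  proof (rule integrable_ln_between[where \<tau> = "infdist z S" and R = "cmod z + RE"])
    show "AE t in \<mu>. infdist z S \<le> cmod (z - t) \<and> cmod (z - t) \<le> cmod z + RE"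
      using AE_infdist_le[of z] AE_dist_le[OF order_refl, of z] by eventually_elim auto
  qed (use infdist_pos[OF False] in auto)
qed (use potential_on_S in auto)

lemma U_tendsto:
  assumes u: "u \<longlonglongrightarrow> z" and z: "z \<notin> S"
  shows "(\<lambda>n. U (u n)) \<longlonglongrightarrow> U z"
proof -
  define d where "d = infdist z S"
  have d: "d > 0" using infdist_pos[OF z] by (simp add: d_def)
  \<comment> \<open>Dominated convergence asks for a bound at every index, so the finitely many
    terms far from z are replaced by z.\<close>
  define v where "v n = (if cmod (u n - z) < d / 2 then u n else z)" for n
  have ev: "\<forall>\<^sub>F n in sequentially. u n = v n"
    using tendstoD[OF u, of "d / 2"] d by (auto elim!: eventually_mono simp: v_def dist_norm)
  have vz: "cmod (v n - z) < d / 2" for n using d by (auto simp: v_def)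
  have vlim: "v \<longlonglongrightarrow> z" using u by (rule Lim_transform_eventually[OF _ ev])
  have "(\<lambda>n. U (v n)) \<longlonglongrightarrow> U z"
    unfolding U_def
  proof (rule integral_dominated_convergence)
    show "AE t in \<mu>. norm (ln (cmod (v n - t))) \<le> max \<bar>ln (d / 2)\<bar> \<bar>ln (cmod z + RE + d / 2)\<bar>" for n
      using AE_infdist_le[of z] AE_dist_le[OF order_refl, of z]
    proof eventually_elim
      case (elim t)
      have "cmod (v n - t) \<ge> cmod (z - t) - cmod (v n - z)"
        using norm_triangle_ineq2[of "z - t" "z - v n"] by (simp add: norm_minus_commute)
      then have 1: "cmod (v n - t) \<ge> d / 2" using vz[of n] elim by (simp add: d_def)
      have "cmod (v n - t) \<le> cmod (v n - z) + cmod (z - t)"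
        using norm_triangle_ineq[of "v n - z" "z - t"] by simp
      then have 2: "cmod (v n - t) \<le> cmod z + RE + d / 2" using vz[of n] elim by simp
      have "cmod (v n - t) > 0" using 1 d by linarith
      then have "ln (d / 2) \<le> ln (cmod (v n - t))" "ln (cmod (v n - t)) \<le> ln (cmod z + RE + d / 2)"
        using 1 2 d by (auto intro!: ln_mono)
      then show ?case by (auto simp: abs_if max_def)
    qed
    show "AE t in \<mu>. (\<lambda>n. ln (cmod (v n - t))) \<longlonglongrightarrow> ln (cmod (z - t))"
      using AE_neq[of z] by eventually_elim (auto intro!: tendsto_intros vlim)
  qed auto
  then show ?thesis by (rule Lim_transform_eventually) (use ev in \<open>auto elim: eventually_mono\<close>)
qed

text \<open>If \<open>s n\<close> is a nearest point of \<open>S\<close> to \<open>u n\<close>, then \<open>\<bar>s n - t\<bar> \<le> 2 \<bar>u n - t\<bar>\<close> on \<open>S\<close>,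
  which dominates the negative part of \<open>ln \<bar>u n - t\<bar> - ln \<bar>s n - t\<bar>\<close> by \<open>ln 2\<close>.\<close>

lemma U_near_S:
  assumes u: "u \<longlonglongrightarrow> \<zeta>" and \<zeta>: "\<zeta> \<in> S" and uS: "\<And>n. u n \<notin> S" and \<eta>: "\<eta> > 0"
  shows "\<forall>\<^sub>F n in sequentially. U (u n) \<ge> L - \<eta>"
proof -
  have "\<exists>s\<in>S. infdist (u n) S = dist (u n) s" for n
    using infdist_attains_inf[OF compact_imp_closed[OF compact_S] S_nonempty] by metis
  then obtain s where s: "\<And>n. s n \<in> S" "\<And>n. infdist (u n) S = dist (u n) (s n)" by metis
  have near: "dist (u n) (s n) \<le> dist (u n) t" if "t \<in> S" for n t using s(2) infdist_le[OF that] by metis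
  have slim: "s \<longlonglongrightarrow> \<zeta>"
  proof -
    have "(\<lambda>n. dist (s n) \<zeta>) \<longlonglongrightarrow> 0"
    proof (rule tendsto_sandwich[OF _ _ tendsto_const])
      show "\<forall>\<^sub>F n in sequentially. dist (s n) \<zeta> \<le> 2 * dist (u n) \<zeta>"
      proof (rule always_eventually, rule allI)
        fix n show "dist (s n) \<zeta> \<le> 2 * dist (u n) \<zeta>"
          using near[OF \<zeta>, of n] dist_triangle[of "s n" \<zeta> "u n"] by (simp add: dist_commute)
      qed
      have "(\<lambda>n. 2 * dist (u n) \<zeta>) \<longlonglongrightarrow> 2 * 0" by (intro tendsto_mult tendsto_const tendsto_dist_iff[THEN iffD1, OF u])
      then show "(\<lambda>n. 2 * dist (u n) \<zeta>) \<longlonglongrightarrow> 0" by simp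
    qed auto
    then show ?thesis by (rule tendsto_dist_iff[THEN iffD2])
  qed
  define f where "f n t = min 0 (ln (cmod (u n - t)) - ln (cmod (s n - t)))" for n t
  have fb: "AE t in \<mu>. norm (f n t) \<le> ln 2" for n
    using AE_mu_S AE_neq[of "s n"]
  proof eventually_elim
    case (elim t)
    have un: "cmod (u n - t) > 0" using uS[of n] elim by auto
    have "cmod (s n - t) \<le> 2 * cmod (u n - t)"
      using near[OF elim(1), of n] norm_triangle_ineq[of "s n - u n" "u n - t"] by (simp add: dist_norm norm_minus_commute)
    then have "ln (cmod (s n - t)) \<le> ln (2 * cmod (u n - t))" using elim un by (intro ln_mono) auto
    also have "\<dots> = ln 2 + ln (cmod (u n - t))" using un by (simp add: ln_mult)
    finally show ?case by (auto simp: f_def min_def)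
  qed
  have [measurable]: "f n \<in> borel_measurable borel" for n unfolding f_def by measurable
  have fint: "integrable \<mu> (f n)" for n by (rule integrable_const_bound[OF fb]) simp
  have "(\<lambda>n. integral\<^sup>L \<mu> (f n)) \<longlonglongrightarrow> (\<integral>t. 0 \<partial>\<mu>)"
  proof (rule integral_dominated_convergence[OF _ _ _ _ fb])
    show "AE t in \<mu>. (\<lambda>n. f n t) \<longlonglongrightarrow> 0" using AE_neq[of \<zeta>]
    proof eventually_elim
      case (elim t)
      have "(\<lambda>n. f n t) \<longlonglongrightarrow> min 0 (ln (cmod (\<zeta> - t)) - ln (cmod (\<zeta> - t)))"
        unfolding f_def using elim by (intro tendsto_intros u slim) auto
      then show ?case by simp
    qed
  qed auto
  then have "\<forall>\<^sub>F n in sequentially. integral\<^sup>L \<mu> (f n) > - \<eta>" using \<eta> by (intro order_tendstoD) auto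
  then show ?thesis
  proof eventually_elim
    case (elim n)
    have "integral\<^sup>L \<mu> (f n) \<le> (\<integral>t. ln (cmod (u n - t)) - ln (cmod (s n - t)) \<partial>\<mu>)"
      by (intro integral_mono fint Bochner_Integration.integrable_diff integrable_ln_norm) (auto simp: f_def)
    also have "\<dots> = U (u n) - U (s n)" unfolding U_def
      by (intro Bochner_Integration.integral_diff integrable_ln_norm)
    finally show ?case using elim potential_on_S(3)[OF s(1)[of n]] by simp
  qed
qed

text \<open>Maximum principle on the complement of \<open>S\<close>. The factor \<open>1 + \<delta>\<close> makes the function tend to
  \<open>-\<infinity>\<close> at infinity; at a maximum the discrete Laplacian with step \<open>h\<close> would be nonpositive, but the
  regularised part contributes a positive term of order \<open>h\<^sup>2\<close> and the harmonic part only \<open>O(h^4)\<close>.\<close>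

lemma bernstein_walsh_perturbed:
  assumes "bounded_support \<nu> RV" and m1: "measure \<nu> UNIV = 1" and e: "e > 0"
    and bound: "\<And>z. z \<in> E \<Longrightarrow> reg_pot \<nu> e z \<le> c0" and \<delta>: "\<delta> > 0" and z1: "z1 \<notin> S"
  shows "reg_pot \<nu> e z1 - (1 + \<delta>) * U z1 \<le> c0 - (1 + \<delta>) * L"
proof (rule ccontr)
  let ?q = "reg_pot \<nu> e"
  interpret v: bounded_support \<nu> RV by fact
  define u where "u z = ?q z - (1 + \<delta>) * U z" for z
  define c where "c = c0 - (1 + \<delta>) * L"
  assume "\<not> ?thesis"
  then have cz1: "c < u z1" by (simp add: u_def c_def)
  \<comment> \<open>The strict gap above c keeps the superlevel set W away from S: limits of points
    of W that land in S would contradict the bound c there.\<close>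
  define c1 where "c1 = (c + u z1) / 2"
  have c1: "c < c1" "c1 < u z1" using cz1 by (auto simp: c1_def)
  define W where "W = {z. z \<notin> S \<and> c1 \<le> u z}"
  have u_lim: "(\<lambda>n. u (x n)) \<longlonglongrightarrow> u l" if "x \<longlonglongrightarrow> l" "l \<notin> S" for x l
    unfolding u_def using that by (intro tendsto_intros U_tendsto v.reg_pot_tendsto e)
  have "bounded W"
  proof -
    \<comment> \<open>For \<open>cmod z \<ge> 3 * R'\<close> one has
      \<open>cmod z + R' \<le> 2 * (cmod z - R')\<close>. Both potentials are then compared with
      \<open>ln (cmod z - R')\<close>, leaving
      \<open>u z \<le> ln 2 - \<delta> * ln (cmod z - R')\<close>, which tends to
      \<open>-\<infinity>\<close>.\<close>
    define R' where "R' = max \<bar>RV\<bar> RE + e"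
    have R': "R' \<ge> RV + e" "R' \<ge> RE" "R' > 0" using e RE by (auto simp: R'_def)
    have "cmod z \<le> 3 * R' + exp ((ln 2 - c1) / \<delta>)" if "z \<in> W" for z
    proof (cases "cmod z \<ge> 3 * R'")
      case True
      have zR: "cmod z - R' > 0" using True R' by simp
      have "?q z \<le> (\<integral>t. ln (2 * (cmod z - R')) \<partial>\<nu>)"
        unfolding reg_pot_def
      proof (intro integral_mono_AE v.integrable_logreg e v.integrable_const)
        show "AE t in \<nu>. logreg e (z - t) \<le> ln (2 * (cmod z - R'))"
          using v.AE_dist_le[OF order_refl, of z]
        proof eventually_elim
          case (elim t)
          have "logreg e (z - t) \<le> ln (cmod z + RV + e)" using logreg_le[OF e elim] by simp
          also have "\<dots> \<le> ln (2 * (cmod z - R'))"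
          proof (rule ln_mono)
            have "cmod z + RV \<ge> 0" using elim norm_ge_zero order_trans by blast
            then show "cmod z + RV + e > 0" using e by simp
            show "cmod z + RV + e \<le> 2 * (cmod z - R')" using True R' by simp
          qed
          finally show ?case .
        qed
      qed
      also have "\<dots> = ln 2 + ln (cmod z - R')" using m1 zR ln_mult[of 2 "cmod z - R'"] by (simp add: v.space_M)
      finally have q: "?q z \<le> ln 2 + ln (cmod z - R')" .
      have "(\<integral>t. ln (cmod z - R') \<partial>\<mu>) \<le> U z"
        unfolding U_def
      proof (intro integral_mono_AE integrable_ln_norm integrable_const)
        show "AE t in \<mu>. ln (cmod z - R') \<le> ln (cmod (z - t))" using AE_norm_le
        proof eventually_elim
          case (elim t)
          have "cmod z - R' \<le> cmod (z - t)" using elim R' norm_triangle_ineq2[of z t] by simp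
          then show ?case using zR by (intro ln_mono)
        qed
      qed
      then have "ln (cmod z - R') \<le> U z" using prob_space by simp
      then have "(1 + \<delta>) * ln (cmod z - R') \<le> (1 + \<delta>) * U z" using \<delta> by (intro mult_left_mono) auto
      then have "u z \<le> ln 2 - \<delta> * ln (cmod z - R')" using q by (simp add: u_def algebra_simps)
      then have "\<delta> * ln (cmod z - R') \<le> ln 2 - c1" using that by (simp add: W_def)
      then have "ln (cmod z - R') \<le> (ln 2 - c1) / \<delta>" using \<delta> by (simp add: field_simps)
      then have "cmod z - R' \<le> exp ((ln 2 - c1) / \<delta>)" using zR exp_le_cancel_iff[of "ln (cmod z - R')"] by simp
      then show ?thesis using R' by simp
    next
      case False
      then show ?thesis using exp_gt_zero[of "(ln 2 - c1) / \<delta>"] by linarith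
    qed
    then show ?thesis by (auto simp: bounded_iff)
  qed
  moreover have "closed W"
    unfolding closed_sequential_limits
  proof (intro allI impI, elim conjE)
    fix x l assume x: "\<forall>n. x n \<in> W" and l: "x \<longlonglongrightarrow> l"
    show "l \<in> W"
    proof (cases "l \<in> S")
      case False
      have "c1 \<le> u l" using u_lim[OF l False] x by (intro LIMSEQ_le_const) (auto simp: W_def)
      then show ?thesis using False by (simp add: W_def)
    next
      case True
      \<comment> \<open>In the limit the error \<open>(1 + \<delta>) * \<eta>\<close> is half the
        gap \<open>c1 - c\<close>, while the bounds on S force it to be at least the whole
        gap.\<close>
      define \<eta> where "\<eta> = (c1 - c) / (2 * (1 + \<delta>))"
      have \<eta>: "\<eta> > 0" using c1 \<delta> by (simp add: \<eta>_def)
      have "\<forall>\<^sub>F n in sequentially. U (x n) \<ge> L - \<eta>" using x by (intro U_near_S[OF l True _ \<eta>]) (auto simp: W_def)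
      then have ev: "\<forall>\<^sub>F n in sequentially. c1 + (1 + \<delta>) * (L - \<eta>) \<le> ?q (x n)"
      proof eventually_elim
        case (elim n)
        then have "(1 + \<delta>) * (L - \<eta>) \<le> (1 + \<delta>) * U (x n)" using \<delta> by (intro mult_left_mono) auto
        moreover have "c1 \<le> u (x n)" using x by (auto simp: W_def)
        ultimately show ?case by (simp add: u_def)
      qed
      from v.reg_pot_tendsto[OF e l] have "c1 + (1 + \<delta>) * (L - \<eta>) \<le> ?q l" by (rule tendsto_lowerbound[OF _ ev]) simp
      also have "\<dots> \<le> c0" using bound True S_subset by auto
      finally have "c1 - c \<le> (1 + \<delta>) * \<eta>" by (simp add: c_def algebra_simps)
      also have "\<dots> = (c1 - c) / 2" using \<delta> by (simp add: \<eta>_def field_simps)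
      finally show ?thesis using c1 by simp
    qed
  qed
  ultimately have "compact W" by (simp add: compact_eq_bounded_closed)
  moreover have "W \<noteq> {}" using z1 c1 by (auto simp: W_def)
  moreover have "continuous_on W u"
    by (rule continuous_on_sequentiallyI) (auto intro!: u_lim simp: W_def)
  ultimately obtain z0 where z0: "z0 \<in> W" "\<And>z. z \<in> W \<Longrightarrow> u z \<le> u z0"
    using continuous_attains_sup[of W u] by blast
  have max: "u z \<le> u z0" if "z \<notin> S" for z
    using z0 that by (cases "z \<in> W") (auto simp: W_def)
  define \<rho> where "\<rho> = infdist z0 S"
  have \<rho>: "\<rho> > 0" using z0 infdist_pos by (auto simp: W_def \<rho>_def)
  define Rr where "Rr = (cmod z0 + \<bar>RV\<bar>)\<^sup>2 + e\<^sup>2"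
  have Rr: "Rr \<ge> e\<^sup>2" "Rr > 0" using e by (auto simp: Rr_def add_nonneg_pos)
  \<comment> \<open>Chosen so that the gain \<open>x / 4\<close> equals
    \<open>h^2 * ((1 + \<delta>) / \<rho>^4) * K\<close>. The harmonic error is the same expression
    with \<open>h^2\<close> in place of K, so any h with \<open>h^2 < K\<close> is
    contradictory.\<close>
  define K where "K = e\<^sup>2 * \<rho>^4 / (2 * Rr\<^sup>2 * (1 + \<delta>))"
  have K: "K > 0" using e \<rho> Rr \<delta> by (simp add: K_def)
  \<comment> \<open>The three bounds keep the cross outside S, make \<open>logreg_four_point\<close>
    applicable with \<open>x \<le> 1 / 2\<close>, and give \<open>h^2 < K\<close>.\<close>
  define h where "h = min (\<rho> / 2) (min (e / 2) (sqrt K / 2))"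
  have h: "h > 0" "h < \<rho>" "h \<le> e / 2" "h \<le> sqrt K / 2" using \<rho> e K by (auto simp: h_def)
  have h2e: "h\<^sup>2 \<le> e\<^sup>2 / 4" using power_mono[OF h(3), of 2] h by (simp add: power_divide)
  have "h\<^sup>2 \<le> K / 4" using power_mono[OF h(4), of 2] h K by (simp add: power_divide)
  then have h2K: "h\<^sup>2 < K" using K by simp
  define w1 w2 w3 w4 where "w1 = z0 + of_real h" and "w2 = z0 - of_real h" and "w3 = z0 + \<i> * of_real h" and "w4 = z0 - \<i> * of_real h"
  have notS: "w \<notin> S" if "cmod (w - z0) = h" for w
  proof
    assume "w \<in> S"
    then have "\<rho> \<le> dist z0 w" unfolding \<rho>_def by (rule infdist_le)
    then show False using that h by (simp add: dist_norm norm_minus_commute)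
  qed
  have wS: "w1 \<notin> S" "w2 \<notin> S" "w3 \<notin> S" "w4 \<notin> S"
    using h by (auto intro!: notS simp: w1_def w2_def w3_def w4_def norm_mult)
  define x where "x = 2 * h\<^sup>2 * e\<^sup>2 / Rr\<^sup>2"
  have Q: "?q w1 + ?q w2 + ?q w3 + ?q w4 - 4 * ?q z0 \<ge> ln (1 + x) / 2"
  proof -
    have "ln (1 + x) / 2 = (\<integral>t. ln (1 + x) / 2 \<partial>\<nu>)" using m1 by (simp add: v.space_M)
    also have "\<dots> \<le> (\<integral>t. logreg e (w1 - t) + logreg e (w2 - t) + logreg e (w3 - t) + logreg e (w4 - t) - 4 * logreg e (z0 - t) \<partial>\<nu>)"
    proof (intro integral_mono_AE v.integrable_const Bochner_Integration.integrable_diff Bochner_Integration.integrable_add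
        integrable_mult_right v.integrable_logreg e)
      show "AE t in \<nu>. ln (1 + x) / 2 \<le> logreg e (w1 - t) + logreg e (w2 - t) + logreg e (w3 - t) + logreg e (w4 - t) - 4 * logreg e (z0 - t)"
        using v.AE_dist_le[OF order_refl, of z0]
      proof eventually_elim
        case (elim t)
        have "(cmod (z0 - t))\<^sup>2 + e\<^sup>2 \<le> Rr" unfolding Rr_def using elim by (intro add_right_mono power_mono) auto
        moreover have "h\<^sup>2 \<le> e\<^sup>2" using h2e zero_le_power2[of e] by linarith
        ultimately show ?case using logreg_four_point[OF e, of h "z0 - t" Rr]
          by (simp add: x_def w1_def w2_def w3_def w4_def algebra_simps)
      qed
    qed
    also have "\<dots> = ?q w1 + ?q w2 + ?q w3 + ?q w4 - 4 * ?q z0"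
      unfolding reg_pot_def using e by (simp add: v.integrable_logreg)
    finally show ?thesis .
  qed
  have H: "U w1 + U w2 + U w3 + U w4 - 4 * U z0 \<le> h^4 / \<rho>^4"
  proof -
    have "U w1 + U w2 + U w3 + U w4 - 4 * U z0 = (\<integral>t. ln (cmod (w1 - t)) + ln (cmod (w2 - t)) + ln (cmod (w3 - t)) + ln (cmod (w4 - t)) - 4 * ln (cmod (z0 - t)) \<partial>\<mu>)"
      unfolding U_def by (simp add: integrable_ln_norm)
    also have "\<dots> \<le> (\<integral>t. h^4 / \<rho>^4 \<partial>\<mu>)"
    proof (intro integral_mono_AE integrable_const Bochner_Integration.integrable_diff Bochner_Integration.integrable_add
        integrable_mult_right integrable_ln_norm)
      show "AE t in \<mu>. ln (cmod (w1 - t)) + ln (cmod (w2 - t)) + ln (cmod (w3 - t)) + ln (cmod (w4 - t)) - 4 * ln (cmod (z0 - t)) \<le> h^4 / \<rho>^4"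
        using AE_infdist_le[of z0]
      proof eventually_elim
        case (elim t)
        then show ?case using ln_norm_four_point[of \<rho> "z0 - t" h] \<rho> h
          by (simp add: \<rho>_def w1_def w2_def w3_def w4_def algebra_simps)
      qed
    qed
    also have "\<dots> = h^4 / \<rho>^4" using prob_space by simp
    finally show ?thesis .
  qed
  have "u w1 + u w2 + u w3 + u w4 - 4 * u z0 \<le> 0"
    using max[OF wS(1)] max[OF wS(2)] max[OF wS(3)] max[OF wS(4)] by linarith
  moreover have "u w1 + u w2 + u w3 + u w4 - 4 * u z0 =
     (?q w1 + ?q w2 + ?q w3 + ?q w4 - 4 * ?q z0)
      - (1 + \<delta>) * (U w1 + U w2 + U w3 + U w4 - 4 * U z0)"
    unfolding u_def by algebra
  moreover have "(1 + \<delta>) * (U w1 + U w2 + U w3 + U w4 - 4 * U z0) \<le> (1 + \<delta>) * (h^4 / \<rho>^4)"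
    using H \<delta> by (intro mult_left_mono) auto
  ultimately have key: "ln (1 + x) / 2 \<le> (1 + \<delta>) * (h^4 / \<rho>^4)" using Q by linarith
  have x0: "x \<ge> 0" by (simp add: x_def)
  have "x \<le> 1 / 2"
  proof -
    have "2 * h\<^sup>2 * e\<^sup>2 \<le> 2 * (e\<^sup>2 / 4) * e\<^sup>2" using h2e by (intro mult_mono) auto
    also have "\<dots> = e\<^sup>2 * e\<^sup>2 / 2" by simp
    also have "\<dots> \<le> Rr * Rr / 2" using Rr by (intro divide_right_mono mult_mono) auto
    finally show ?thesis using Rr by (simp add: x_def power2_eq_square field_simps)
  qed
  then have "x - x\<^sup>2 \<le> ln (1 + x)" using x0 by (intro ln_one_plus_pos_lower_bound) auto
  moreover have "x\<^sup>2 \<le> x / 2" using x0 \<open>x \<le> 1 / 2\<close> mult_left_mono[of x "1/2" x] by (simp add: power2_eq_square)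
  ultimately have "x / 4 \<le> (1 + \<delta>) * (h^4 / \<rho>^4)" using key by linarith
  also have "(1 + \<delta>) * (h^4 / \<rho>^4) = h\<^sup>2 * (((1 + \<delta>) / \<rho>^4) * h\<^sup>2)" by (simp add: eval_nat_numeral)
  also have "x / 4 = h\<^sup>2 * (((1 + \<delta>) / \<rho>^4) * K)" using \<rho> \<delta> by (simp add: x_def K_def)
  finally have "K \<le> h\<^sup>2" using h \<rho> \<delta> by (simp add: mult_le_cancel_left divide_le_cancel)
  then show False using h2K by simp
qed

text \<open>Off S the number \<open>U z\<close> is fixed and finite, so \<delta> can be sent to 0 in
  the perturbed inequality. On S the claim follows from the bound on E and
  \<open>U z \<ge> L\<close>.\<close>

lemma bernstein_walsh:
  assumes \<nu>: "bounded_support \<nu> RV" "measure \<nu> UNIV = 1" and e: "e > 0"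
    and bound: "\<And>z. z \<in> E \<Longrightarrow> reg_pot \<nu> e z \<le> c0"
  shows "reg_pot \<nu> e z \<le> c0 - L + U z"
proof (cases "z \<in> S")
  case True
  then have "reg_pot \<nu> e z \<le> c0" using bound S_subset by auto
  then show ?thesis using potential_on_S(3)[OF True] by simp
next
  case False
  have *: "reg_pot \<nu> e z - (c0 - L + U z) \<le> \<delta> * \<bar>U z - L\<bar>" if "\<delta> > 0" for \<delta>
  proof -
    have "\<delta> * (U z - L) \<le> \<delta> * \<bar>U z - L\<bar>" using that by (intro mult_left_mono) auto
    then show ?thesis using bernstein_walsh_perturbed[OF \<nu> e bound that False] by (simp add: algebra_simps)
  qed
  have "reg_pot \<nu> e z - (c0 - L + U z) \<le> 0"
  proof (rule field_le_epsilon)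
    fix y :: real assume y: "y > 0"
    have "y / (\<bar>U z - L\<bar> + 1) * \<bar>U z - L\<bar> \<le> y" using y by (simp add: field_simps)
    then show "reg_pot \<nu> e z - (c0 - L + U z) \<le> 0 + y" using *[of "y / (\<bar>U z - L\<bar> + 1)"] y by simp
  qed
  then show ?thesis by simp
qed

end

section \<open>The inequality\<close>

lemma max_power:
  fixes a b :: real
  assumes "a \<ge> 0" "b \<ge> 0"
  shows "max (a ^ k) (b ^ k) = (max a b) ^ k"
proof (cases "a \<le> b")
  case True
  then show ?thesis using power_mono[OF True assms(1), of k] by (simp add: max_absorb2)
next
  case False
  then have "b \<le> a" by simp
  then show ?thesis using power_mono[OF \<open>b \<le> a\<close> assms(2), of k] by (simp add: max_absorb1)
qed

lemma max_norm_power: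
  assumes "\<tau> \<ge> 0"
  shows "max_norm (\<tau> ^ k) (\<lambda>j z. w j z ^ k) m z = max_norm \<tau> w m z ^ k"
proof (induction m)
  case (Suc m)
  have "max_norm \<tau> w m z \<ge> 0" using assms max_norm_ge(1)[of \<tau> w m z] by linarith
  then show ?case using Suc by (simp add: max_power norm_power)
qed simp

text \<open>All summands are monic powers of degree k with nonnegative weights, so the leading
  coefficient is the positive number a. The degree is therefore exactly k, and there are k roots
  with multiplicity.\<close>

lemma sum_linear_powers_factorization:
  fixes c :: "nat \<Rightarrow> complex" and s :: "nat \<Rightarrow> nat"
  assumes a: "a = (\<Sum>j=1..m. s j)" "a > 0"
  obtains r where "\<And>z. (\<Sum>j=1..m. of_nat (s j) * (z - c j) ^ k) = of_nat a * (\<Prod>i<k. z - r i)"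
proof -
  define p where "p = (\<Sum>j=1..m. smult (of_nat (s j)) ([:- c j, 1:] ^ k))"
  have "degree p \<le> k" unfolding p_def
    by (intro degree_sum_le) (auto intro!: order_trans[OF degree_smult_le] simp: degree_linear_power)
  moreover have co: "coeff p k = of_nat a"
  proof -
    have "coeff ([:- c j, 1:] ^ k) k = 1" for j
      using lead_coeff_power[of "[:- c j, 1:]" k] by (simp add: degree_linear_power)
    then show ?thesis by (simp add: p_def coeff_sum a)
  qed
  moreover have "coeff p k \<noteq> 0" unfolding co using a(2) by (simp only: of_nat_eq_0_iff)
  ultimately have deg: "degree p = k" using le_degree by (metis le_antisym)
  obtain r where r: "smult (lead_coeff p) (\<Prod>i<degree p. [:- r i, 1:]) = p" using complex_poly_decompose' by blast
  have "(\<Sum>j=1..m. of_nat (s j) * (z - c j) ^ k) = of_nat a * (\<Prod>i<k. z - r i)" for z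
  proof -
    have "(\<Sum>j=1..m. of_nat (s j) * (z - c j) ^ k) = poly p z" by (simp add: p_def poly_sum poly_power)
    also have "\<dots> = poly (smult (lead_coeff p) (\<Prod>i<degree p. [:- r i, 1:])) z" by (simp only: r)
    also have "\<dots> = of_nat a * (\<Prod>i<k. z - r i)" by (simp add: deg co poly_prod)
    finally show ?thesis .
  qed
  then show ?thesis using that by blast
qed

text \<open>Each \<open>exp (logreg e (r i - z))\<close> dominates both e and
  \<open>cmod (z - r i)\<close>. The floor \<open>e ^ k\<close> can thus be distributed over the k
  factors, one e for each root.\<close>

lemma ln_max_prod_le:
  fixes a :: real
  assumes "e > 0" "a \<ge> 1"
  shows "ln (max (e ^ k) (a * (\<Prod>i<k. cmod (z - r i)))) \<le> ln a + (\<Sum>i<k. logreg e (r i - z))"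
proof -
  define b where "b i = exp (logreg e (r i - z))" for i
  have b1: "e \<le> b i" for i
    using logreg_ge_ln[OF assms(1), of "r i - z"] assms(1) unfolding b_def by (metis exp_le_cancel_iff exp_ln)
  have b2: "cmod (z - r i) \<le> b i" for i
  proof (cases "r i = z")
    case False
    then have "ln (cmod (r i - z)) \<le> logreg e (r i - z)" by (intro logreg_ge_ln_norm) auto
    then have "exp (ln (cmod (r i - z))) \<le> b i" unfolding b_def by simp
    then show ?thesis using False by (simp add: norm_minus_commute)
  qed (simp add: b_def)
  have "e ^ k = (\<Prod>i<k. e)" by simp
  also have "\<dots> \<le> (\<Prod>i<k. b i)" using assms b1 by (intro prod_mono) auto
  also have "\<dots> \<le> a * (\<Prod>i<k. b i)"
    using mult_right_mono[of 1 a "\<Prod>i<k. b i"] assms by (simp add: b_def prod_nonneg)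
  finally have 1: "e ^ k \<le> a * (\<Prod>i<k. b i)" .
  have 2: "a * (\<Prod>i<k. cmod (z - r i)) \<le> a * (\<Prod>i<k. b i)"
    using assms b2 by (intro mult_left_mono prod_mono) auto
  have "ln (max (e ^ k) (a * (\<Prod>i<k. cmod (z - r i)))) \<le> ln (a * (\<Prod>i<k. b i))"
    using 1 2 assms by (intro ln_mono) (auto simp: less_max_iff_disj)
  also have "\<dots> = ln a + (\<Sum>i<k. logreg e (r i - z))"
    using assms by (simp add: ln_mult ln_prod b_def prod_pos)
  finally show ?thesis .
qed

context equilibrium begin

section \<open>The farthest-distance function\<close>

lemma E_nonempty: "E \<noteq> {}" using S_nonempty S_subset by auto

lemma dE_ge: "t \<in> E \<Longrightarrow> cmod (z - t) \<le> dE E z"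
proof -
  assume t: "t \<in> E"
  have "bdd_above ((\<lambda>t. cmod (z - t)) ` E)"
  proof (rule bdd_aboveI2)
    show "cmod (z - t) \<le> cmod z + RE" if "t \<in> E" for t using norm_triangle_ineq4[of z t] RE(2)[OF that] by simp
  qed
  then show ?thesis unfolding dE_def using t by (intro cSup_upper) auto
qed

lemma dE_le: "(\<And>t. t \<in> E \<Longrightarrow> cmod (z - t) \<le> B) \<Longrightarrow> dE E z \<le> B"
  unfolding dE_def using E_nonempty by (intro cSup_least) auto

lemma dE_attained: "\<exists>t\<in>E. cmod (z - t) = dE E z"
proof -
  have "continuous_on E (\<lambda>t. cmod (z - t))" by (intro continuous_intros)
  then obtain t where t: "t \<in> E" "\<And>y. y \<in> E \<Longrightarrow> cmod (z - y) \<le> cmod (z - t)"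
    using continuous_attains_sup[OF compact_E E_nonempty] by blast
  then show ?thesis using dE_le[of z] dE_ge[of t z] by (intro bexI[of _ t] antisym) auto
qed

lemma dE_lipschitz: "dE E z \<le> dE E z' + cmod (z - z')"
proof (rule dE_le)
  fix t assume "t \<in> E"
  then show "cmod (z - t) \<le> dE E z' + cmod (z - z')"
    using dE_ge[of t z'] norm_triangle_ineq[of "z - z'" "z' - t"] by simp
qed

lemma dE_continuous: "continuous_on A (dE E)"
proof -
  have "1-lipschitz_on A (dE E)"
  proof (rule lipschitz_onI)
    fix x y :: complex
    show "dist (dE E x) (dE E y) \<le> 1 * dist x y"
      using dE_lipschitz[of x y] dE_lipschitz[of y x] by (simp add: dist_norm norm_minus_commute abs_le_iff)
  qed simp
  then show ?thesis by (rule lipschitz_on_continuous_on)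
qed

lemma dE_measurable [measurable]: "dE E \<in> borel_measurable borel"
  by (rule borel_measurable_continuous_onI) (rule dE_continuous)

text \<open>\<mu> has no atoms, so E contains two distinct points, and every z is at least half
  their distance away from one of them. This makes \<open>ln (dE E z)\<close> bounded below.\<close>

lemma exists_dE_lower_bound: "\<exists>d>0. \<forall>z. d \<le> dE E z"
proof -
  obtain a where a: "a \<in> S" using S_nonempty by blast
  have "\<exists>b\<in>E. b \<noteq> a"
  proof (rule ccontr)
    assume no: "\<not> ?thesis"
    have "AE t in \<mu>. False" using AE_mu_E AE_neq[of a] by eventually_elim (use no in auto)
    then show False by simp
  qed
  then obtain b where b: "b \<in> E" "b \<noteq> a" by blast
  have "cmod (a - b) / 2 \<le> dE E z" for z
    using dE_ge[of a z] dE_ge[of b z] a b S_subset norm_triangle_ineq4[of "z - b" "z - a"] by auto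
  then show ?thesis using b by (intro exI[of _ "cmod (a - b) / 2"]) auto
qed

definition d0 :: real where "d0 = (SOME d. d > 0 \<and> (\<forall>z. d \<le> dE E z))"

lemma d0: "d0 > 0" "d0 \<le> dE E z"
  using someI_ex[OF exists_dE_lower_bound] by (auto simp: d0_def)

lemma dE_le_D: "z \<in> E \<Longrightarrow> dE E z \<le> D" by (intro dE_le dist_le_D)

lemma dE_pos: "dE E z > 0" using d0(1) d0(2)[of z] by linarith

lemma integrable_ln_dE: "prob_on E \<sigma> \<Longrightarrow> integrable \<sigma> (\<lambda>z. ln (dE E z))"
proof -
  assume pr: "prob_on E \<sigma>"
  interpret s: prob_space \<sigma> using pr by (simp add: prob_on_def)
  have [measurable_cong]: "sets \<sigma> = sets borel" using pr by (simp add: prob_on_def)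
  show ?thesis
  proof (rule s.integrable_ln_between[where \<tau> = d0 and R = D])
    show "AE t in \<sigma>. d0 \<le> dE E t \<and> dE E t \<le> D"
      using prob_on_AE[OF closed_E pr] by eventually_elim (auto simp: d0 dE_le_D)
  qed (auto simp: d0)
qed

lemma C_E_eq: "C_E E \<mu> = (\<integral>z. ln (dE E z) \<partial>\<mu>) - L"
  by (simp add: C_E_def ln_cap)

text \<open>The roots of P serve only as an intermediary: an integral of log |P| against \<nu>
  becomes potentials at the roots, Bernstein--Walsh exchanges \<nu> for \<mu> there, and the sum is
  read back as an integral of log |P| against \<mu>. As Bernstein--Walsh holds in the whole plane,
  the position of the roots is immaterial. The error is explicit so that both limits can be taken
  later.\<close>

lemma power_bound:
  assumes \<nu>: "bounded_support \<nu> RV" "prob_space \<nu>" and e: "e > 0" "e \<le> 1"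
    and bound: "\<And>z. z \<in> E \<Longrightarrow> reg_pot \<nu> e z \<le> c0"
    and c: "\<And>j. j \<in> {1..m} \<Longrightarrow> c j \<in> E" and m: "m \<ge> 1" and k: "k \<ge> 1" and N: "N \<ge> 1"
    and R: "R \<ge> 1" "\<And>j. j \<in> {1..m} \<Longrightarrow> AE t in \<nu>. cmod (t - c j) \<le> R"
  shows "real k * (\<integral>t. ln (max_norm e (\<lambda>j t. t - c j) m t) \<partial>\<nu>) \<le> real k * (c0 + C_E E \<mu>)
     + (ln (real (m * N)) + real m * (ln (4 * real N) + (ln (1 + real (m * N)) + real k * ln (R / e)) / real N))"
proof -
  interpret v: bounded_support \<nu> RV by fact
  interpret vp: prob_space \<nu> by fact
  have m1: "measure \<nu> UNIV = 1" using vp.prob_space v.space_M by simp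
  define w where "w j t = (t - c j) ^ k" for j t
  let ?P = "\<lambda>(s :: nat \<Rightarrow> nat) t. \<Sum>j=1..m. of_nat (s j) * w j t"
  let ?N = "max_norm e (\<lambda>j t. t - c j) m"
  have wR: "AE t in \<nu>. \<forall>j\<in>{1..m}. cmod (t - c j) \<le> R"
    using R(2) by (subst AE_finite_all) auto
  \<comment> \<open>Applied to k-th powers, with floor \<open>e ^ k\<close>, bound
    \<open>R ^ k\<close> and \<open>u = 0\<close>. The only part of the loss that grows with k is
    then \<open>k * ln (R / e) / N\<close> per coefficient.\<close>
  have "\<exists>s. (\<forall>j\<in>{1..m}. s j \<in> {1..N}) \<and>
     (\<integral>t. ln (max (e ^ k) (norm (0 + (?P s t)))) \<partial>\<nu>)
      \<ge> (\<integral>t. ln (max (norm (0::complex)) (max_norm (e ^ k) w m t)) \<partial>\<nu>)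
         - m * (ln (4 * real N) + ln ((1 + real ((0 + m) * N)) * R ^ k / e ^ k) / N)"
  proof (rule exists_coefficients_integral_ln_ge[OF \<nu>(2) v.sets_M])
    show "e ^ k \<le> R ^ k" using e R by (intro power_mono) auto
    show "AE t in \<nu>. (\<forall>j\<in>{1..m}. cmod (w j t) \<le> R ^ k) \<and> cmod 0 \<le> (1 + real (0 * N)) * R ^ k"
      using wR by eventually_elim (use R in \<open>auto simp: w_def norm_power intro!: power_mono\<close>)
    show "w j \<in> borel_measurable borel" for j unfolding w_def by measurable
  qed (use N e in auto)
  then obtain s where s': "\<forall>j\<in>{1..m}. s j \<in> {1..N}" and
    s_ge: "(\<integral>t. ln (max (e ^ k) (norm (?P s t))) \<partial>\<nu>)
      \<ge> (\<integral>t. ln (max 0 (max_norm (e ^ k) w m t)) \<partial>\<nu>)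
         - m * (ln (4 * real N) + ln ((1 + real (m * N)) * R ^ k / e ^ k) / N)"
    unfolding norm_zero add_0 by blast
  note s = s'[rule_format]
  have mx: "max 0 (max_norm (e ^ k) w m t) = ?N t ^ k" for t
  proof -
    have "?N t \<ge> 0" using e max_norm_ge(1)[of e "\<lambda>j t. t - c j" m t] by linarith
    then show ?thesis using e unfolding w_def[abs_def] by (simp add: max_norm_power)
  qed
  have lnpow: "(\<integral>t. ln (max 0 (max_norm (e ^ k) w m t)) \<partial>\<nu>) = k * (\<integral>t. ln (?N t) \<partial>\<nu>)"
  proof -
    have "?N t > 0" for t using e max_norm_ge(1)[of e "\<lambda>j t. t - c j" m t] by linarith
    then show ?thesis unfolding mx by (simp add: ln_realpow)
  qed
  have lnR: "ln ((1 + real (m * N)) * R ^ k / e ^ k) = ln (1 + real (m * N)) + k * ln (R / e)"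
  proof -
    have "1 + real (m * N) > 0" by (simp add: add_pos_nonneg)
    then have "ln ((1 + real (m * N)) * (R / e) ^ k) = ln (1 + real (m * N)) + ln ((R / e) ^ k)"
      using e R(1) by (subst ln_mult) auto
    also have "ln ((R / e) ^ k) = k * ln (R / e)" using e R by (simp add: ln_realpow)
    finally show ?thesis by (simp add: power_divide)
  qed
  define a where "a = (\<Sum>j=1..m. s j)"
  have "(\<Sum>j=1..m. 1) \<le> a" unfolding a_def using s by (intro sum_mono) auto
  then have a1: "a \<ge> 1" using m by simp
  obtain r where r: "\<And>z. (\<Sum>j=1..m. of_nat (s j) * (z - c j) ^ k) = of_nat a * (\<Prod>i<k. z - r i)"
    using sum_linear_powers_factorization[OF a_def, where c = c and k = k] a1 by auto
  have normr: "norm (?P s t) = a * (\<Prod>i<k. cmod (t - r i))" for t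
    unfolding w_def r by (simp add: norm_mult prod_norm)
  have "(\<integral>t. ln (max (e ^ k) (norm (?P s t))) \<partial>\<nu>)
     \<le> (\<integral>t. ln a + (\<Sum>i<k. logreg e (r i - t)) \<partial>\<nu>)"
  proof (rule integral_mono)
    show "integrable \<nu> (\<lambda>t. ln a + (\<Sum>i<k. logreg e (r i - t)))"
      using e by (intro Bochner_Integration.integrable_add v.integrable_const Bochner_Integration.integrable_sum v.integrable_logreg)
    show "ln (max (e ^ k) (norm (?P s t))) \<le> ln a + (\<Sum>i<k. logreg e (r i - t))" for t
      unfolding normr using ln_max_prod_le[OF e(1), of "real a"] a1 by simp
    have [measurable]: "w j \<in> borel_measurable borel" for j unfolding w_def by measurable
    show "integrable \<nu> (\<lambda>t. ln (max (e ^ k) (norm (?P s t))))"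
    proof (rule v.integrable_ln_between[where \<tau> = "e ^ k" and R = "max (e ^ k) (real (m * N) * R ^ k)"])
      show "AE t in \<nu>. e ^ k \<le> max (e ^ k) (norm (?P s t))
          \<and> max (e ^ k) (norm (?P s t)) \<le> max (e ^ k) (real (m * N) * R ^ k)"
        using wR
      proof eventually_elim
        case (elim t)
        have "norm (?P s t) \<le> (\<Sum>j=1..m. N * R ^ k)"
        proof (rule sum_norm_le)
          fix j assume j: "j \<in> {1..m}"
          have "cmod (w j t) \<le> R ^ k" using elim j by (auto simp: w_def norm_power intro!: power_mono)
          then show "norm (of_nat (s j) * w j t) \<le> N * R ^ k" using s[OF j] by (auto simp: norm_mult intro!: mult_mono)
        qed
        then have "norm (?P s t) \<le> real (m * N) * R ^ k" by simp
        then show ?case by (auto intro: max.coboundedI2)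
      qed
    qed (use e in auto)
  qed
  also have "\<dots> = ln a + (\<Sum>i<k. reg_pot \<nu> e (r i))"
    unfolding reg_pot_def using e m1 by (simp add: Bochner_Integration.integral_sum v.integrable_logreg v.space_M)
  also have "\<dots> \<le> ln a + (\<Sum>i<k. c0 - L + U (r i))"
    using bernstein_walsh[OF \<nu>(1) m1 e(1) bound] by (intro add_left_mono sum_mono) auto
  also have "\<dots> = k * (c0 - L) + (ln a + (\<Sum>i<k. U (r i)))" by (simp add: sum.distrib)
  \<comment> \<open>The \<mu>-potentials at the roots recombine into the integral of log |P|;
    splitting the logarithm of the product is legitimate because \<mu> does not charge the
    roots.\<close>
  also have "ln a + (\<Sum>i<k. U (r i)) = (\<integral>t. ln a + (\<Sum>i<k. ln (cmod (r i - t))) \<partial>\<mu>)"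
    unfolding U_def using prob_space by (simp add: Bochner_Integration.integral_sum integrable_ln_norm)
  also have "\<dots> \<le> (\<integral>t. ln (real (m * N)) + k * ln (dE E t) \<partial>\<mu>)"
  proof (rule integral_mono_AE)
    show "integrable \<mu> (\<lambda>t. ln a + (\<Sum>i<k. ln (cmod (r i - t))))"
      by (intro Bochner_Integration.integrable_add integrable_const Bochner_Integration.integrable_sum integrable_ln_norm)
    show "integrable \<mu> (\<lambda>t. ln (real (m * N)) + k * ln (dE E t))"
      by (intro Bochner_Integration.integrable_add integrable_const integrable_mult_right integrable_ln_dE prob_on_mu)
    have "AE t in \<mu>. \<forall>i\<in>{..<k}. t \<noteq> r i" using AE_neq by (subst AE_finite_all) auto
    then show "AE t in \<mu>. ln a + (\<Sum>i<k. ln (cmod (r i - t))) \<le> ln (real (m * N)) + k * ln (dE E t)"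
      using AE_mu_E
    proof eventually_elim
      case (elim t)
      have pos: "cmod (t - r i) > 0" if "i < k" for i using elim that by auto
      have "ln (\<Prod>i<k. cmod (t - r i)) = (\<Sum>i<k. ln (cmod (t - r i)))"
        using pos by (intro ln_prod) auto
      moreover have "(\<Prod>i<k. cmod (t - r i)) > 0" using pos by (intro prod_pos) auto
      ultimately have "ln a + (\<Sum>i<k. ln (cmod (r i - t))) = ln (a * (\<Prod>i<k. cmod (t - r i)))"
        using a1 by (simp add: ln_mult_pos norm_minus_commute)
      also have "\<dots> \<le> ln (real (m * N) * dE E t ^ k)"
      proof (rule ln_mono)
        show "0 < a * (\<Prod>i<k. cmod (t - r i))" using pos a1 by (auto intro!: mult_pos_pos prod_pos)
        have "a * (\<Prod>i<k. cmod (t - r i)) = norm (?P s t)" by (simp only: normr)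
        also have "\<dots> \<le> (\<Sum>j=1..m. N * dE E t ^ k)"
        proof (rule sum_norm_le)
          fix j assume j: "j \<in> {1..m}"
          have "cmod (w j t) \<le> dE E t ^ k" using dE_ge[OF c[OF j], of t] by (auto simp: w_def norm_power intro!: power_mono)
          then show "norm (of_nat (s j) * w j t) \<le> N * dE E t ^ k" using s[OF j] by (auto simp: norm_mult intro!: mult_mono)
        qed
        finally show "a * (\<Prod>i<k. cmod (t - r i)) \<le> real (m * N) * dE E t ^ k" by simp
      qed
      also have "\<dots> = ln (real (m * N)) + k * ln (dE E t)"
      proof -
        have "real (m * N) > 0" using m N by simp
        then show ?thesis using dE_pos[of t] by (subst ln_mult) (auto simp: ln_realpow)
      qed
      finally show ?case .
    qed
  qed
  also have "\<dots> = ln (real (m * N)) + k * (\<integral>t. ln (dE E t) \<partial>\<mu>)"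
    using prob_space integrable_ln_dE[OF prob_on_mu] by simp
  finally show ?thesis using s_ge unfolding lnpow lnR C_E_eq by (simp add: algebra_simps)
qed

text \<open>Dividing \<open>power_bound\<close> by k and letting k tend to infinity at fixed N
  leaves the error \<open>m * ln (R / e) / N\<close>, which vanishes as N grows. The reverse order
  would fail because of the term \<open>ln (4 * N)\<close>.\<close>

lemma integral_ln_max_norm_le:
  assumes \<nu>: "bounded_support \<nu> RV" "prob_space \<nu>" and e: "e > 0" "e \<le> 1"
    and bound: "\<And>z. z \<in> E \<Longrightarrow> reg_pot \<nu> e z \<le> c0"
    and c: "\<And>j. j \<in> {1..m} \<Longrightarrow> c j \<in> E" and m: "m \<ge> 1"
  shows "(\<integral>t. ln (max_norm e (\<lambda>j t. t - c j) m t) \<partial>\<nu>) \<le> c0 + C_E E \<mu>"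
proof -
  interpret v: bounded_support \<nu> RV by fact
  define I where "I = (\<integral>t. ln (max_norm e (\<lambda>j t. t - c j) m t) \<partial>\<nu>)"
  define X where "X = c0 + C_E E \<mu>"
  define R where "R = 1 + \<bar>RV\<bar> + RE"
  have R1: "R \<ge> 1" using RE by (simp add: R_def)
  have Rb: "AE t in \<nu>. cmod (t - c j) \<le> R" if "j \<in> {1..m}" for j
    using v.AE_norm_le
  proof eventually_elim
    case (elim t)
    then show ?case using norm_triangle_ineq4[of t "c j"] RE(2)[OF c[OF that]] by (simp add: R_def)
  qed
  have stepN: "I - X \<le> m * ln (R / e) / N" if N: "N \<ge> 1" for N :: nat
  proof -
    define A where "A = ln (real (m * N)) + real m * (ln (4 * real N) + ln (1 + real (m * N)) / real N)"
    have "I - X - m * ln (R / e) / N \<le> A / real k" if k: "k \<ge> 1" for k :: nat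
    proof -
      have "k * I \<le> k * X + (A + k * (m * ln (R / e) / N))"
        using power_bound[OF \<nu> e bound c m k N R1 Rb] by (simp add: I_def X_def A_def algebra_simps add_divide_distrib)
      then have "real k * (I - X - m * ln (R / e) / N) \<le> A" by (simp add: algebra_simps)
      then show ?thesis using k by (simp add: field_simps)
    qed
    moreover have "(\<lambda>k. A / real k) \<longlonglongrightarrow> 0" by (rule lim_const_over_n)
    ultimately have "I - X - m * ln (R / e) / N \<le> 0" by (intro LIMSEQ_le_const) auto
    then show ?thesis by simp
  qed
  have "(\<lambda>N. (m * ln (R / e)) / real N) \<longlonglongrightarrow> 0" by (rule lim_const_over_n)
  then have "I - X \<le> 0" using stepN by (intro LIMSEQ_le_const) auto
  then show ?thesis by (simp add: I_def X_def)
qed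

end

section \<open>From chosen points to suprema\<close>

lemma enn2ereal_sum_diff:
  assumes "finite I" "\<And>i. i \<in> I \<Longrightarrow> a i \<noteq> \<infinity>"
  shows "enn2ereal (\<Sum>i\<in>I. a i) - enn2ereal (\<Sum>i\<in>I. b i) = (\<Sum>i\<in>I. enn2ereal (a i) - enn2ereal (b i))"
  using assms
proof (induction I)
  case (insert i I)
  have fin: "(\<Sum>i\<in>I. a i) \<noteq> \<infinity>" "a i \<noteq> \<infinity>" using insert by (auto simp: ennreal_sum_less_top less_top)
  have "enn2ereal (x + y) - enn2ereal (u + v) = (enn2ereal x - enn2ereal u) + (enn2ereal y - enn2ereal v)"
    if "x \<noteq> \<infinity>" "y \<noteq> \<infinity>" for x y u v
    using that by (cases x; cases y; cases u; cases v) (auto simp: plus_ennreal.rep_eq enn2ereal_ennreal)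
  then show ?case using insert fin by simp
qed (simp add: zero_ennreal.rep_eq)

text \<open>If all suprema are finite, near-maximisers with finite values exist, which is why
  \<open>le\<close> is asked only for such points. If one supremum is \<open>-\<infinity>\<close>,
  so is the sum, because none is \<open>\<infinity>\<close>; in \<open>ereal\<close> the value
  \<open>\<infinity>\<close> would absorb \<open>-\<infinity>\<close>.\<close>

lemma sum_SUP_le:
  fixes f :: "'i \<Rightarrow> 'a \<Rightarrow> ereal"
  assumes I: "finite I" and A: "A \<noteq> {}" and fin: "\<And>i. i \<in> I \<Longrightarrow> (SUP z\<in>A. f i z) < \<infinity>"
    and le: "\<And>c. (\<And>i. i \<in> I \<Longrightarrow> c i \<in> A) \<Longrightarrow> (\<And>i. i \<in> I \<Longrightarrow> f i (c i) \<noteq> -\<infinity>) \<Longrightarrow> (\<Sum>i\<in>I. f i (c i)) \<le> ereal x"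
  shows "(\<Sum>i\<in>I. SUP z\<in>A. f i z) \<le> ereal x"
proof (cases "\<exists>i\<in>I. (SUP z\<in>A. f i z) = -\<infinity>")
  case True
  then obtain i where i: "i \<in> I" "(SUP z\<in>A. f i z) = -\<infinity>" by blast
  have "(\<Sum>i\<in>I. SUP z\<in>A. f i z) = -\<infinity>"
  proof -
    have "(\<Sum>i\<in>I - {i}. SUP z\<in>A. f i z) \<noteq> \<infinity>" unfolding sum_Pinfty using fin by fastforce
    then show ?thesis using i I by (simp add: sum.remove[of I i])
  qed
  then show ?thesis by simp
next
  case False
  define r where "r i = real_of_ereal (SUP z\<in>A. f i z)" for i
  have r: "(SUP z\<in>A. f i z) = ereal (r i)" if "i \<in> I" for i
    using False fin[OF that] that unfolding r_def by (cases "SUP z\<in>A. f i z") auto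
  have *: "(\<Sum>i\<in>I. r i) \<le> x + real (card I) * \<eta>" if \<eta>: "\<eta> > 0" for \<eta>
  proof -
    have "\<exists>c\<in>A. ereal (r i - \<eta>) < f i c" if "i \<in> I" for i
    proof -
      have "ereal (r i - \<eta>) < (SUP z\<in>A. f i z)" using r[OF that] \<eta> by simp
      then show ?thesis by (simp add: less_SUP_iff)
    qed
    then obtain c where c: "\<And>i. i \<in> I \<Longrightarrow> c i \<in> A" "\<And>i. i \<in> I \<Longrightarrow> ereal (r i - \<eta>) < f i (c i)" by metis
    have "ereal (\<Sum>i\<in>I. r i - \<eta>) = (\<Sum>i\<in>I. ereal (r i - \<eta>))" by simp
    also have "\<dots> \<le> (\<Sum>i\<in>I. f i (c i))" using c by (intro sum_mono less_imp_le) auto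
    also have "\<dots> \<le> ereal x"
    proof (rule le)
      show "f i (c i) \<noteq> -\<infinity>" if "i \<in> I" for i using c(2)[OF that] by auto
    qed (use c in auto)
    finally show ?thesis by (simp add: sum_subtractf)
  qed
  have "(\<Sum>i\<in>I. r i) \<le> x"
  proof (rule field_le_epsilon)
    fix y :: real assume y: "y > 0"
    have "real (card I) * (y / (real (card I) + 1)) \<le> y" using y by (simp add: field_simps)
    then show "(\<Sum>i\<in>I. r i) \<le> x + y" using *[of "y / (real (card I) + 1)"] y by simp
  qed
  moreover have "(\<Sum>i\<in>I. SUP z\<in>A. f i z) = ereal (\<Sum>i\<in>I. r i)" using r by simp
  ultimately show ?thesis by simp
qed

lemma (in bounded_support) SUP_pot_less_PInf:
  assumes "compact A"
  shows "(SUP z\<in>A. pot M z) < \<infinity>"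
proof -
  have "bounded (reg_pot M 1 ` A)"
    by (intro compact_imp_bounded compact_continuous_image continuous_reg_pot assms) simp
  then obtain B where B: "\<And>z. z \<in> A \<Longrightarrow> reg_pot M 1 z \<le> B"
    unfolding bounded_iff by (metis abs_le_D1 image_eqI real_norm_def)
  have "(SUP z\<in>A. pot M z) \<le> ereal B"
    using B pot_le_reg_pot[of 1] by (intro SUP_least) (meson ereal_less_eq(3) order_trans zero_less_one)
  then show ?thesis by (rule le_less_trans) simp
qed

text \<open>The sum measure is specified by nonnegative integrals. A real function bounded below is
  therefore shifted by B first, and the shift cancels because the total mass is 1. Finite positive
  parts make the potentials additive even where they are \<open>-\<infinity>\<close>.\<close>

lemma admissible_family_sum:
  assumes adm: "admissible_family m \<nu>"
  shows "\<exists>\<rho> R. m \<ge> 1 \<and> (\<forall>j\<in>{1..m}. bounded_support (\<nu> j) R) \<and> bounded_support \<rho> R \<and> prob_space \<rho>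
    \<and> (\<forall>z. pot \<rho> z = (\<Sum>j=1..m. pot (\<nu> j) z))
    \<and> (\<forall>(f :: complex \<Rightarrow> real) B. f \<in> borel_measurable borel \<longrightarrow> integrable \<rho> f \<longrightarrow> (\<forall>t. B \<le> f t) \<longrightarrow> (\<forall>j\<in>{1..m}. integrable (\<nu> j) f) \<longrightarrow>
       (\<integral>t. f t \<partial>\<rho>) = (\<Sum>j=1..m. \<integral>t. f t \<partial>\<nu> j))"
proof -
  have s: "sets (\<nu> j) = sets borel" if "j \<in> {1..m}" for j using adm that by (auto simp: admissible_family_def)
  have sp: "space (\<nu> j) = UNIV" if "j \<in> {1..m}" for j using sets_eq_imp_space_eq[OF s[OF that]] by simp
  have total: "(\<Sum>j=1..m. emeasure (\<nu> j) UNIV) = 1" using adm by (auto simp: admissible_family_def)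
  have m: "m \<ge> 1" using total by (cases m) auto
  have e1: "emeasure (\<nu> j) UNIV \<le> 1" if "j \<in> {1..m}" for j
  proof -
    have "emeasure (\<nu> j) UNIV \<le> (\<Sum>j=1..m. emeasure (\<nu> j) UNIV)" using that by (intro member_le_sum) auto
    then show ?thesis using total by simp
  qed
  have "\<exists>Rj. AE t in \<nu> j. cmod t \<le> Rj" if j: "j \<in> {1..m}" for j
  proof -
    obtain K where K: "compact K" "emeasure (\<nu> j) (UNIV - K) = 0" using adm j unfolding admissible_family_def by blast
    obtain Rj where Rj: "\<forall>t\<in>K. cmod t \<le> Rj" using compact_imp_bounded[OF K(1)] by (auto simp: bounded_iff)
    have "UNIV - K \<in> sets (\<nu> j)" using compact_imp_closed[OF K(1)] by (simp add: s[OF j] borel_closed)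
    then have "AE t in \<nu> j. t \<in> K" using K(2) by (intro AE_I[of _ _ "UNIV - K"]) auto
    then show ?thesis using Rj by (intro exI[of _ Rj]) (auto elim!: eventually_mono)
  qed
  then obtain Rj where Rj: "\<And>j. j \<in> {1..m} \<Longrightarrow> AE t in \<nu> j. cmod t \<le> Rj j" by metis
  define R where "R = (\<Sum>j=1..m. \<bar>Rj j\<bar>)"
  have RjR: "Rj j \<le> R" if "j \<in> {1..m}" for j
  proof -
    have "\<bar>Rj j\<bar> \<le> R" unfolding R_def using that by (intro member_le_sum) auto
    then show ?thesis by simp
  qed
  have bs: "bounded_support (\<nu> j) R" if j: "j \<in> {1..m}" for j
  proof -
    interpret finite_measure "\<nu> j" by (rule finite_measureI) (use e1[OF j] sp[OF j] in \<open>auto simp: top_unique\<close>)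
    show ?thesis
  proof
    show "sets (\<nu> j) = sets borel" by (rule s[OF j])
    show "AE t in \<nu> j. cmod t \<le> R" using Rj[OF j] by eventually_elim (use RjR[OF j] in auto)
  qed
  qed
  obtain \<rho> where \<rho>: "sets \<rho> = sets borel"
    "\<And>f :: complex \<Rightarrow> ennreal. f \<in> borel_measurable borel \<Longrightarrow> (\<integral>\<^sup>+t. f t \<partial>\<rho>) = (\<Sum>j\<in>{1..m}. \<integral>\<^sup>+t. f t \<partial>\<nu> j)"
    using exists_sum_measure[of "{1..m}" \<nu>] m s e1 by auto
  have sp\<rho>: "space \<rho> = UNIV" using sets_eq_imp_space_eq[OF \<rho>(1)] by simp
  have em: "emeasure \<rho> A = (\<Sum>j=1..m. emeasure (\<nu> j) A)" if "A \<in> sets borel" for A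
  proof -
    have "emeasure \<rho> A = (\<Sum>j\<in>{1..m}. \<integral>\<^sup>+t. indicator A t \<partial>\<nu> j)"
      using \<rho>(2)[of "indicator A"] that \<rho>(1) by simp
    also have "\<dots> = (\<Sum>j=1..m. emeasure (\<nu> j) A)"
      using that s by (intro sum.cong nn_integral_indicator) auto
    finally show ?thesis .
  qed
  interpret r: prob_space \<rho> by (rule prob_spaceI) (use em[of UNIV] total sp\<rho> in simp)
  have bsr: "bounded_support \<rho> R"
  proof
    let ?A = "{t. \<not> cmod t \<le> R}"
    have A: "?A \<in> sets borel" by measurable
    have "emeasure (\<nu> j) ?A = 0" if j: "j \<in> {1..m}" for j
    proof -
      interpret bounded_support "\<nu> j" R by (rule bs[OF j])
      show ?thesis using AE_norm_le A by (subst (asm) AE_iff_measurable[where N = ?A]) (auto simp: space_M sets_M)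
    qed
    then have "emeasure \<rho> ?A = 0" using em[OF A] by simp
    then show "AE t in \<rho>. cmod t \<le> R" using A by (intro AE_I[of _ _ ?A]) (auto simp: \<rho>(1))
  qed (rule \<rho>(1))
  have pot: "pot \<rho> z = (\<Sum>j=1..m. pot (\<nu> j) z)" for z
  proof -
    have fin: "(\<integral>\<^sup>+t. log_pos z t \<partial>\<nu> j) \<noteq> \<infinity>" if "j \<in> {1..m}" for j
      by (rule bounded_support.nn_integral_log_pos_finite[OF bs[OF that]])
    show ?thesis unfolding pot_def using \<rho>(2) enn2ereal_sum_diff[OF _ fin, of "{1..m}"] by simp
  qed
  have int: "(\<integral>t. f t \<partial>\<rho>) = (\<Sum>j=1..m. \<integral>t. f t \<partial>\<nu> j)"
    if f: "f \<in> borel_measurable borel" and ir: "integrable \<rho> f" and B: "\<And>t. B \<le> f t"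
      and ij: "\<And>j. j \<in> {1..m} \<Longrightarrow> integrable (\<nu> j) f" for f :: "complex \<Rightarrow> real" and B
  proof -
    have shift: "(\<integral>\<^sup>+t. ennreal (f t - B) \<partial>\<nu> j) = ennreal ((\<integral>t. f t \<partial>\<nu> j) - B * measure (\<nu> j) UNIV)"
      "(\<integral>t. f t \<partial>\<nu> j) - B * measure (\<nu> j) UNIV \<ge> 0" if j: "j \<in> {1..m}" for j
    proof -
      interpret bounded_support "\<nu> j" R by (rule bs[OF j])
      have i: "integrable (\<nu> j) (\<lambda>t. f t - B)" by (intro Bochner_Integration.integrable_diff ij j integrable_const)
      have v: "(\<integral>t. f t - B \<partial>\<nu> j) = (\<integral>t. f t \<partial>\<nu> j) - B * measure (\<nu> j) UNIV"
        using ij[OF j] by (subst Bochner_Integration.integral_diff) (auto simp: space_M)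
      show "(\<integral>\<^sup>+t. ennreal (f t - B) \<partial>\<nu> j) = ennreal ((\<integral>t. f t \<partial>\<nu> j) - B * measure (\<nu> j) UNIV)"
        using nn_integral_eq_integral[OF i] B v by simp
      show "(\<integral>t. f t \<partial>\<nu> j) - B * measure (\<nu> j) UNIV \<ge> 0"
        unfolding v[symmetric] using B by (intro Bochner_Integration.integral_nonneg) simp
    qed
    have "(\<integral>t. f t \<partial>\<rho>) - B = (\<integral>t. f t - B \<partial>\<rho>)" using ir r.prob_space by simp
    also have "ennreal \<dots> = (\<integral>\<^sup>+t. ennreal (f t - B) \<partial>\<rho>)"
      using ir B by (subst nn_integral_eq_integral) (auto intro!: Bochner_Integration.integrable_diff)
    also have "\<dots> = (\<Sum>j=1..m. ennreal ((\<integral>t. f t \<partial>\<nu> j) - B * measure (\<nu> j) UNIV))"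
      using f shift(1) by (subst \<rho>(2)) auto
    also have "\<dots> = ennreal (\<Sum>j=1..m. (\<integral>t. f t \<partial>\<nu> j) - B * measure (\<nu> j) UNIV)"
      using shift(2) by (intro sum_ennreal) auto
    finally have "ennreal ((\<integral>t. f t \<partial>\<rho>) - B) = ennreal (\<Sum>j=1..m. (\<integral>t. f t \<partial>\<nu> j) - B * measure (\<nu> j) UNIV)" .
    moreover have "(\<integral>t. f t \<partial>\<rho>) - B \<ge> 0"
    proof -
      have "(\<integral>t. f t - B \<partial>\<rho>) \<ge> 0" using B by (intro Bochner_Integration.integral_nonneg) simp
      then show ?thesis using ir r.prob_space by simp
    qed
    moreover have "(\<Sum>j=1..m. (\<integral>t. f t \<partial>\<nu> j) - B * measure (\<nu> j) UNIV) \<ge> 0" using shift(2) by (intro sum_nonneg) auto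
    ultimately have "(\<integral>t. f t \<partial>\<rho>) - B = (\<Sum>j=1..m. (\<integral>t. f t \<partial>\<nu> j)) - B * (\<Sum>j=1..m. measure (\<nu> j) UNIV)"
      by (simp add: sum_subtractf sum_distrib_left)
    moreover have "(\<Sum>j=1..m. measure (\<nu> j) UNIV) = 1"
    proof -
      have "(\<Sum>j=1..m. ennreal (measure (\<nu> j) UNIV)) = (\<Sum>j=1..m. emeasure (\<nu> j) UNIV)"
      proof (rule sum.cong)
        fix j assume j: "j \<in> {1..m}"
        interpret bounded_support "\<nu> j" R by (rule bs[OF j])
        show "ennreal (measure (\<nu> j) UNIV) = emeasure (\<nu> j) UNIV" by (simp add: emeasure_eq_measure)
      qed simp
      then have "ennreal (\<Sum>j=1..m. measure (\<nu> j) UNIV) = ennreal 1" using total by (simp add: sum_ennreal)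
      then show ?thesis by (simp add: sum_nonneg)
    qed
    ultimately show ?thesis by simp
  qed
  show ?thesis
  proof (intro exI[of _ \<rho>] exI[of _ R] conjI ballI allI impI)
    fix f :: "complex \<Rightarrow> real" and B assume "f \<in> borel_measurable borel" "integrable \<rho> f" "\<forall>t. B \<le> f t" "\<forall>j\<in>{1..m}. integrable (\<nu> j) f"
    then show "(\<integral>t. f t \<partial>\<rho>) = (\<Sum>j=1..m. \<integral>t. f t \<partial>\<nu> j)" by (intro int[of f B]) blast+
  qed (fact m bs bsr r.prob_space_axioms pot | erule bs)+
qed

context equilibrium begin

text \<open>For c0 strictly above the supremum on the right, compactness provides one e with
  regularised potential below c0 on E. The same e serves as floor in \<open>max_norm\<close> and
  drops out of the resulting bound, so only c0 has to approach the supremum.\<close>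

lemma sum_SUP_pot_le:
  assumes adm: "admissible_family m \<nu>"
  shows "(\<Sum>j=1..m. SUP z\<in>E. pot (\<nu> j) z) \<le> ereal (C_E E \<mu>) + (SUP z\<in>E. \<Sum>j=1..m. pot (\<nu> j) z)"
proof -
  obtain \<rho> R where m: "m \<ge> 1" and bs': "\<forall>j\<in>{1..m}. bounded_support (\<nu> j) R"
    and bsr: "bounded_support \<rho> R" and pr: "prob_space \<rho>"
    and pot: "\<forall>z. pot \<rho> z = (\<Sum>j=1..m. pot (\<nu> j) z)"
    and int: "\<forall>(f :: complex \<Rightarrow> real) B. f \<in> borel_measurable borel \<longrightarrow> integrable \<rho> f \<longrightarrow> (\<forall>t. B \<le> f t) \<longrightarrow> (\<forall>j\<in>{1..m}. integrable (\<nu> j) f) \<longrightarrow>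
       (\<integral>t. f t \<partial>\<rho>) = (\<Sum>j=1..m. \<integral>t. f t \<partial>\<nu> j)"
    using admissible_family_sum[OF adm] by (elim exE conjE)
  note bs = bs'[rule_format]
  interpret r: bounded_support \<rho> R by fact
  define M where "M = (SUP z\<in>E. pot \<rho> z)"
  have key: "(\<Sum>j=1..m. SUP z\<in>E. pot (\<nu> j) z) \<le> ereal (c0 + C_E E \<mu>)" if c0: "M < ereal c0" for c0
  proof (rule sum_SUP_le)
    show "(SUP z\<in>E. pot (\<nu> j) z) < \<infinity>" if "j \<in> {1..m}" for j
      by (rule bounded_support.SUP_pot_less_PInf[OF bs[OF that] compact_E])
    fix c assume c: "\<And>j. j \<in> {1..m} \<Longrightarrow> c j \<in> E" "\<And>j. j \<in> {1..m} \<Longrightarrow> pot (\<nu> j) (c j) \<noteq> -\<infinity>"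
    have "pot \<rho> z < ereal c0" if "z \<in> E" for z
    proof -
      have "pot \<rho> z \<le> M" unfolding M_def using that by (rule SUP_upper)
      then show ?thesis using c0 by simp
    qed
    then obtain e' where e': "e' > 0" "\<And>z. z \<in> E \<Longrightarrow> reg_pot \<rho> e' z < c0"
      using r.exists_reg_pot_less_on_compact[OF compact_E] by blast
    define e where "e = min 1 e'"
    have e: "e > 0" "e \<le> 1" using e' by (auto simp: e_def)
    have bound: "reg_pot \<rho> e z \<le> c0" if "z \<in> E" for z
      using r.reg_pot_mono[OF e(1), of e' z] e'(2)[OF that] by (simp add: e_def)
    let ?N = "max_norm e (\<lambda>j t. t - c j) m"
    \<comment> \<open>One function majorises all kernels \<open>ln (cmod (c j - t))\<close>, so the
      integrals against the separate measures merge into one against \<rho>.\<close>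
    define f where "f t = ln (?N t)" for t
    have mn [measurable]: "?N \<in> borel_measurable borel"
      by (rule max_norm_measurable) simp
    have fm: "f \<in> borel_measurable borel" unfolding f_def by measurable
    have fB: "ln e \<le> f t" for t unfolding f_def using max_norm_ge(1)[of e "\<lambda>j t. t - c j" m t] e by (intro ln_mono) auto
    have fi: "integrable \<kappa> f" if "bounded_support \<kappa> R" for \<kappa>
    proof -
      interpret k: bounded_support \<kappa> R by fact
      show ?thesis unfolding f_def
      proof (rule k.integrable_ln_between[where \<tau> = e and R = "max e (R + RE)"])
        show "AE t in \<kappa>. e \<le> ?N t \<and> ?N t \<le> max e (R + RE)"
          using k.AE_norm_le
        proof eventually_elim
          case (elim t)
          have "cmod (t - c j) \<le> max e (R + RE)" if "j \<in> {1..m}" for j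
            using norm_triangle_ineq4[of t "c j"] RE(2)[OF c(1)[OF that]] elim by (intro max.coboundedI2) simp
          then show ?case by (auto intro!: max_norm_ge max_norm_le)
        qed
      qed (use e in auto)
    qed
    have le: "pot (\<nu> j) (c j) \<le> ereal (\<integral>t. f t \<partial>\<nu> j)" if j: "j \<in> {1..m}" for j
    proof -
      interpret k: bounded_support "\<nu> j" R by (rule bs[OF j])
      note p = k.pot_finite_imp[OF c(2)[OF j]]
      have "(\<integral>t. ln (cmod (c j - t)) \<partial>\<nu> j) \<le> (\<integral>t. f t \<partial>\<nu> j)"
      proof (rule integral_mono_AE[OF p(1) fi[OF bs[OF j]]])
        show "AE t in \<nu> j. ln (cmod (c j - t)) \<le> f t" using p(2)
        proof eventually_elim
          case (elim t)
          then show ?case using max_norm_ge(2)[OF j, of "\<lambda>j t. t - c j" t e] unfolding f_def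
            by (intro ln_mono) (auto simp: norm_minus_commute)
        qed
      qed
      then show ?thesis using p(3) by simp
    qed
    have "(\<Sum>j=1..m. pot (\<nu> j) (c j)) \<le> (\<Sum>j=1..m. ereal (\<integral>t. f t \<partial>\<nu> j))" using le by (intro sum_mono)
    also have "\<dots> = ereal (\<integral>t. f t \<partial>\<rho>)"
      using int[rule_format, of f "ln e"] fm fi[OF bsr] fB fi[OF bs] by simp
    also have "\<dots> \<le> ereal (c0 + C_E E \<mu>)"
      unfolding f_def using integral_ln_max_norm_le[OF bsr pr e bound c(1) m] by simp
    finally show "(\<Sum>j=1..m. pot (\<nu> j) (c j)) \<le> ereal (c0 + C_E E \<mu>)" .
  qed (use E_nonempty in auto)
  have "(\<Sum>j=1..m. SUP z\<in>E. pot (\<nu> j) z) \<le> ereal (C_E E \<mu>) + M"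
  proof (cases M)
    case (real x)
    show ?thesis
    proof (rule ereal_le_epsilon2)
      fix y :: real assume "y > 0"
      then show "(\<Sum>j=1..m. SUP z\<in>E. pot (\<nu> j) z) \<le> ereal (C_E E \<mu>) + M + ereal y"
        using key[of "x + y"] real by (simp add: algebra_simps)
    qed
  next
    \<comment> \<open>Every real c0 is now admissible, so the left-hand side lies below every real
      number.\<close>
    case MInf
    have "(\<Sum>j=1..m. SUP z\<in>E. pot (\<nu> j) z) = -\<infinity>"
    proof (rule ereal_bot)
      fix B show "(\<Sum>j=1..m. SUP z\<in>E. pot (\<nu> j) z) \<le> ereal B" using key[of "B - C_E E \<mu>"] MInf by simp
    qed
    then show ?thesis by simp
  qed simp
  then show ?thesis by (simp add: M_def pot)
qed

end

section \<open>Compact sets without measures of finite energy\<close>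

text \<open>This is \<open>min n (max 0 (ln (D / cmod (z - w))))\<close> with both truncations
  inside the logarithm: a bounded kernel that is continuous also on the diagonal.\<close>

definition trunc_kernel :: "real \<Rightarrow> nat \<Rightarrow> complex \<Rightarrow> complex \<Rightarrow> real" where
  "trunc_kernel D n z w = - ln (max (exp (- real n)) (min 1 (cmod (z - w) / D)))"

lemma trunc_kernel_bounds:
  "0 \<le> trunc_kernel D n z w" "trunc_kernel D n z w \<le> real n"
proof -
  have "ln (max (exp (- real n)) (min 1 (cmod (z - w) / D))) \<le> ln 1" by (intro ln_mono) (auto simp: less_max_iff_disj)
  then show "0 \<le> trunc_kernel D n z w" by (simp add: trunc_kernel_def)
  have "ln (exp (- real n)) \<le> ln (max (exp (- real n)) (min 1 (cmod (z - w) / D)))" by (intro ln_mono) auto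
  then show "trunc_kernel D n z w \<le> real n" by (simp add: trunc_kernel_def)
qed

lemma trunc_kernel_le:
  assumes "D \<ge> 1" "z \<noteq> w" "cmod (z - w) \<le> D"
  shows "trunc_kernel D n z w \<le> ln D - ln (cmod (z - w))"
proof -
  have "ln (cmod (z - w) / D) \<le> ln (max (exp (- real n)) (min 1 (cmod (z - w) / D)))"
    using assms by (intro ln_mono) (auto simp: max.coboundedI2)
  then show ?thesis using assms by (simp add: trunc_kernel_def ln_div)
qed

lemma continuous_trunc_kernel:
  "D \<ge> 1 \<Longrightarrow> continuous_on UNIV (\<lambda>p. trunc_kernel D n (fst p) (snd p))"
proof -
  assume D: "D \<ge> 1"
  have "max (exp (- real n)) a \<noteq> 0" for a :: real using exp_gt_zero[of "- real n"] max.cobounded1[of "exp (- real n)" a] by linarith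
  then show ?thesis unfolding trunc_kernel_def using D by (intro continuous_intros) auto
qed

lemma incseq_trunc_kernel: "incseq (\<lambda>n. ennreal (trunc_kernel D n z w))"
  unfolding trunc_kernel_def
  by (intro incseq_SucI ennreal_leI le_imp_neg_le ln_mono max.mono) (auto simp: less_max_iff_disj)

lemma log_kernel_eq_SUP_trunc:
  assumes "D \<ge> 1"
  shows "log_kernel D z w = (SUP n. ennreal (trunc_kernel D n z w))"
proof (rule LIMSEQ_unique[OF _ LIMSEQ_SUP])
  show "incseq (\<lambda>n. ennreal (trunc_kernel D n z w))" by (rule incseq_trunc_kernel)
  show "(\<lambda>n. ennreal (trunc_kernel D n z w)) \<longlonglongrightarrow> log_kernel D z w"
  proof (cases "z = w")
    case True
    have "trunc_kernel D n z w = real n" for n using True by (simp add: trunc_kernel_def max_absorb1)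
    moreover have "(\<lambda>n. ennreal (real n)) \<longlonglongrightarrow> \<infinity>"
      by (simp add: ennreal_tendsto_top_eq_at_top filterlim_real_sequentially)
    ultimately show ?thesis using True by (simp add: log_kernel_def)
  next
    case False
    define a where "a = min 1 (cmod (z - w) / D)"
    have a: "a > 0" "a \<le> 1" using False assms by (auto simp: a_def)
    have "\<forall>\<^sub>F n in sequentially. - ln a \<le> real n"
      using filterlim_real_sequentially by (auto simp: filterlim_at_top)
    then have "\<forall>\<^sub>F n in sequentially. log_kernel D z w = ennreal (trunc_kernel D n z w)"
    proof eventually_elim
      case (elim n)
      have "exp (- real n) \<le> exp (ln a)" using elim by (intro exp_mono) simp
      then have "trunc_kernel D n z w = - ln a" unfolding trunc_kernel_def a_def[symmetric] using a by (simp add: max_absorb2)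
      moreover have "ennreal (- ln a) = ennreal (ln D - ln (cmod (z - w)))"
      proof (cases "cmod (z - w) \<le> D")
        case True
        then have "a = cmod (z - w) / D" using assms by (simp add: a_def)
        then show ?thesis using False assms by (simp add: ln_div)
      next
        case gt: False
        then have "a = 1" using assms by (simp add: a_def)
        moreover have "ln D \<le> ln (cmod (z - w))" using gt assms by (intro ln_mono) auto
        ultimately show ?thesis by (simp add: ennreal_neg)
      qed
      ultimately show ?case using False by (simp add: log_kernel_def)
    qed
    then show ?thesis by (rule tendsto_eventually[OF eventually_mono]) simp
  qed
qed

text \<open>Each diagonal term costs at most T, a share of order T/n after division by
  \<open>n^2\<close>. Off the diagonal, the row added by point n is controlled by
  \<open>low\<close>, which also forces the points to be distinct, and symmetry counts each row
  twice.\<close>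

lemma sum_trunc_kernel_le:
  assumes D: "D \<ge> 1" "\<And>i j. cmod (z i - z j) \<le> D"
    and low: "\<And>n. (\<Prod>i<n. cmod (z n - z i)) \<ge> exp (- K * real n)"
  shows "(\<Sum>i<n. \<Sum>j<n. trunc_kernel D T (z i) (z j)) \<le> real n * real T + (real n)\<^sup>2 * (\<bar>K\<bar> + ln D)"
proof (induction n)
  case (Suc n)
  let ?k = "trunc_kernel D T"
  have sym: "?k a b = ?k b a" for a b by (simp add: trunc_kernel_def norm_minus_commute)
  have pos: "cmod (z n - z i) > 0" if "i < n" for i
  proof -
    have "(\<Prod>i<n. cmod (z n - z i)) \<noteq> 0" using low[of n] exp_gt_zero[of "- K * real n"] by linarith
    then have "cmod (z n - z i) \<noteq> 0" using that by (simp only: prod_zero_iff finite_lessThan) blast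
    then show ?thesis by simp
  qed
  have "(\<Sum>i<n. ?k (z n) (z i)) \<le> (\<Sum>i<n. ln D - ln (cmod (z n - z i)))"
    using pos D by (intro sum_mono trunc_kernel_le) auto
  also have "\<dots> = n * ln D - ln (\<Prod>i<n. cmod (z n - z i))"
    using pos by (subst ln_prod) (auto simp: sum_subtractf)
  also have "\<dots> \<le> n * ln D + K * n"
  proof -
    have "ln (exp (- K * real n)) \<le> ln (\<Prod>i<n. cmod (z n - z i))" using low[of n] by (intro ln_mono) auto
    then show ?thesis by simp
  qed
  also have "\<dots> \<le> n * (\<bar>K\<bar> + ln D)"
  proof -
    have "K * n \<le> \<bar>K\<bar> * n" by (intro mult_right_mono) auto
    then show ?thesis by (simp add: algebra_simps)
  qed
  finally have row: "(\<Sum>i<n. ?k (z n) (z i)) \<le> n * (\<bar>K\<bar> + ln D)" .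
  have "(\<Sum>i<Suc n. \<Sum>j<Suc n. ?k (z i) (z j))
      = (\<Sum>i<n. \<Sum>j<n. ?k (z i) (z j)) + 2 * (\<Sum>i<n. ?k (z n) (z i)) + ?k (z n) (z n)"
  proof -
    have "(\<Sum>i<n. ?k (z i) (z n)) = (\<Sum>i<n. ?k (z n) (z i))" by (intro sum.cong sym refl)
    then show ?thesis by (simp add: sum.distrib)
  qed
  also have "\<dots> \<le> (real n * real T + (real n)\<^sup>2 * (\<bar>K\<bar> + ln D)) + 2 * (n * (\<bar>K\<bar> + ln D)) + real T"
    using Suc.IH row trunc_kernel_bounds(2) by (intro add_mono mult_left_mono) auto
  also have "\<dots> \<le> real (Suc n) * real T + (real (Suc n))\<^sup>2 * (\<bar>K\<bar> + ln D)"
    using D(1) by (simp add: algebra_simps power2_eq_square)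
  finally show ?case .
qed simp

text \<open>The counting measures are lifted to \<open>{0..1}\<close> along a space-filling curve, where Helly's selection
  theorem and Skorohod's representation are available.\<close>

lemma exists_finite_energy_measure:
  assumes F: "compact F" and zF: "\<And>i. z i \<in> F" and D: "D \<ge> 1" "\<And>a b. a \<in> F \<Longrightarrow> b \<in> F \<Longrightarrow> cmod (a - b) \<le> D"
    and low: "\<And>n. (\<Prod>i<n. cmod (z n - z i)) \<ge> exp (- K * real n)"
  shows "\<exists>\<sigma>. prob_on F \<sigma> \<and> mutual D \<sigma> \<sigma> < \<infinity>"
proof -
  let ?k = "trunc_kernel D"
  obtain R where "\<forall>a\<in>F. cmod a \<le> R" using compact_imp_bounded[OF F] by (auto simp: bounded_iff)
  then have FR: "F \<subseteq> cball 0 R" by auto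
  obtain \<phi> :: "real \<Rightarrow> complex" where \<phi>: "continuous_on UNIV \<phi>" "cball 0 R \<subseteq> \<phi> ` {0..1}"
    using exists_space_filling_curve by blast
  have [measurable]: "\<phi> \<in> borel_measurable borel" using \<phi>(1) by (rule borel_measurable_continuous_onI)
  have "z i \<in> \<phi> ` {0..1}" for i by (rule subsetD[OF \<phi>(2) subsetD[OF FR zF]])
  then have "\<exists>s. s \<in> {0..1} \<and> \<phi> s = z i" for i by (metis imageE)
  then obtain x where x: "\<And>i. x i \<in> {0..1}" "\<And>i. \<phi> (x i) = z i" by metis
  define p where "p n = pmf_of_set {..<Suc n}" for n
  define m where "m n = distr (measure_pmf (p n)) borel x" for n
  have rd: "real_distribution (m n)" for n
    unfolding m_def by (rule prob_space.real_distribution_distr[OF measure_pmf.prob_space_axioms]) simp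
  have "tight m"
    unfolding tight_def
  proof (intro conjI allI impI rd)
    fix \<epsilon> :: real assume "\<epsilon> > 0"
    \<comment> \<open>Tightness is expressed with half-open intervals, so the left end lies below 0,
      a point that may carry mass.\<close>
    have "measure (m n) {-1<..1} = 1" for n
    proof -
      interpret real_distribution "m n" by (rule rd)
      have "AE s in m n. s \<in> {-1<..1}" unfolding m_def using x(1)
        by (subst AE_distr_iff) (auto intro!: AE_pmfI intro: order_less_le_trans[of "-1" 0])
      then show ?thesis by (subst prob_eq_1) auto
    qed
    then show "\<exists>a b. a < b \<and> (\<forall>n. 1 - \<epsilon> < measure (m n) {a<..b})" using \<open>\<epsilon> > 0\<close>
      by (intro exI[of _ "-1"] exI[of _ 1]) auto
  qed
  from tight_imp_convergent_subsubsequence[OF this strict_mono_id]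
  obtain r M where r: "strict_mono r" "real_distribution M" "weak_conv_m (m \<circ> r) M"
    by (auto simp: id_def o_def)
  have "real_distribution ((m \<circ> r) n)" for n using rd by simp
  \<comment> \<open>Weak convergence is exchanged for pointwise convergence on one space, so that
    double integrals live on the fixed product of \<Omega> with itself and Fatou's lemma applies
    there.\<close>
  from Skorohod[OF this r(2,3)]
  obtain \<Omega> :: "real measure" and Y :: "nat \<Rightarrow> real \<Rightarrow> real" and Y' :: "real \<Rightarrow> real" where
    \<Omega>: "prob_space \<Omega>" and Ym': "\<forall>n. Y n \<in> measurable \<Omega> borel" and Yd': "\<forall>n. distr \<Omega> borel (Y n) = (m \<circ> r) n"
    and Y'm: "Y' \<in> measurable \<Omega> lborel" and lim': "\<forall>\<omega>\<in>space \<Omega>. (\<lambda>n. Y n \<omega>) \<longlonglongrightarrow> Y' \<omega>"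
    by (elim exE conjE)
  note Ym = Ym'[rule_format] and Yd = Yd'[rule_format, unfolded o_apply] and lim = lim'[rule_format]
  interpret O: prob_space \<Omega> by fact
  note [measurable] = Ym
  have [measurable]: "Y' \<in> borel_measurable \<Omega>" using Y'm by simp
  define \<sigma> where "\<sigma> = distr \<Omega> borel (\<lambda>\<omega>. \<phi> (Y' \<omega>))"
  have \<sigma>: "prob_space \<sigma>" unfolding \<sigma>_def by (intro O.prob_space_distr) measurable
  have \<sigma>s: "sets \<sigma> = sets borel" by (simp add: \<sigma>_def)
  interpret s: prob_space \<sigma> by fact
  have int\<sigma>: "(\<integral>\<^sup>+a. f a \<partial>\<sigma>) = (\<integral>\<^sup>+\<omega>. f (\<phi> (Y' \<omega>)) \<partial>\<Omega>)" if "f \<in> borel_measurable borel" for f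
    unfolding \<sigma>_def using that by (subst nn_integral_distr) auto
  have lim\<phi>: "(\<lambda>n. \<phi> (Y n \<omega>)) \<longlonglongrightarrow> \<phi> (Y' \<omega>)" if "\<omega> \<in> space \<Omega>" for \<omega>
  proof -
    have "isCont \<phi> (Y' \<omega>)" using \<phi>(1) by (simp add: continuous_on_eq_continuous_at)
    then show ?thesis using lim[OF that] by (rule isCont_tendsto_compose)
  qed
  have closedF: "closed F" using F by (rule compact_imp_closed)
  have Fm: "F \<in> sets borel" using closedF by simp
  have "AE \<omega> in \<Omega>. \<forall>n. \<phi> (Y n \<omega>) \<in> F"
    unfolding AE_all_countable
  proof
    fix n
    have set: "{s \<in> space borel. \<phi> s \<in> F} \<in> sets borel" using Fm by measurable
    have "AE s in m (r n). \<phi> s \<in> F"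
      unfolding m_def using x(2) zF set by (subst AE_distr_iff) (auto intro!: AE_pmfI)
    then show "AE \<omega> in \<Omega>. \<phi> (Y n \<omega>) \<in> F"
      unfolding Yd[symmetric] using set by (subst (asm) AE_distr_iff) auto
  qed
  then have aeF: "AE \<omega> in \<Omega>. \<phi> (Y' \<omega>) \<in> F"
  proof (rule AE_mp, intro AE_I2 impI)
    fix \<omega> assume "\<omega> \<in> space \<Omega>" "\<forall>n. \<phi> (Y n \<omega>) \<in> F"
    then show "\<phi> (Y' \<omega>) \<in> F" using closed_sequentially[OF closedF _ lim\<phi>] by auto
  qed
  have pr: "prob_on F \<sigma>"
  proof (rule prob_onI[OF \<sigma>s _ closedF])
    show "emeasure \<sigma> UNIV = 1" using s.emeasure_space_1 by (simp add: \<sigma>_def)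
    show "AE t in \<sigma>. t \<in> F" unfolding \<sigma>_def using aeF Fm by (subst AE_distr_iff) auto
  qed
  have kmeas [measurable]: "(\<lambda>q. ?k T (fst q) (snd q)) \<in> borel_measurable (borel \<Otimes>\<^sub>M borel)" for T
    unfolding borel_prod using continuous_trunc_kernel[OF D(1)] by (rule borel_measurable_continuous_onI)
  have kmeas': "(\<lambda>q. ?k T (f q) (g q)) \<in> borel_measurable N"
    if [measurable]: "f \<in> borel_measurable N" "g \<in> borel_measurable N" for T f g and N :: "'z measure"
    using measurable_compose[OF measurable_Pair[OF that] kmeas[of T]] by simp
  define c where "c = \<bar>K\<bar> + ln D"
  have c0: "c \<ge> 0" using D(1) by (simp add: c_def)
  have disc: "(\<integral>\<^sup>+\<omega>. \<integral>\<^sup>+\<omega>'. ennreal (?k T (\<phi> (Y n \<omega>)) (\<phi> (Y n \<omega>'))) \<partial>\<Omega> \<partial>\<Omega>) \<le> ennreal (real T / real (Suc (r n)) + c)" for T n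
  proof -
    let ?N = "Suc (r n)"
    have inner: "(\<integral>\<^sup>+\<omega>'. ennreal (?k T a (\<phi> (Y n \<omega>'))) \<partial>\<Omega>)
        = ennreal ((\<Sum>j<?N. ?k T a (z j)) / real ?N)" for a
    proof -
      have [measurable]: "(\<lambda>s. ?k T a (\<phi> s)) \<in> borel_measurable borel" by (rule kmeas') measurable
      have "(\<integral>\<^sup>+\<omega>'. ennreal (?k T a (\<phi> (Y n \<omega>'))) \<partial>\<Omega>) = (\<integral>\<^sup>+s. ennreal (?k T a (\<phi> s)) \<partial>m (r n))"
        unfolding Yd[symmetric] by (subst nn_integral_distr) auto
      also have "\<dots> = (\<integral>\<^sup>+j. ennreal (?k T a (z j)) \<partial>p (r n))"
        unfolding m_def by (subst nn_integral_distr) (auto simp: x(2))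
      also have "\<dots> = (\<Sum>j<?N. ennreal (?k T a (z j))) / of_nat ?N"
        unfolding p_def by (subst nn_integral_pmf_of_set) auto
      also have "\<dots> = ennreal ((\<Sum>j<?N. ?k T a (z j)) / real ?N)"
        by (simp add: sum_ennreal trunc_kernel_bounds divide_ennreal sum_nonneg ennreal_of_nat_eq_real_of_nat del: of_nat_Suc sum.lessThan_Suc)
      finally show ?thesis .
    qed
    have [measurable]: "(\<lambda>s. ?k T (\<phi> s) (z j)) \<in> borel_measurable borel" for j by (rule kmeas') measurable
    have "(\<integral>\<^sup>+\<omega>. \<integral>\<^sup>+\<omega>'. ennreal (?k T (\<phi> (Y n \<omega>)) (\<phi> (Y n \<omega>'))) \<partial>\<Omega> \<partial>\<Omega>)
       = (\<integral>\<^sup>+\<omega>. ennreal ((\<Sum>j<?N. ?k T (\<phi> (Y n \<omega>)) (z j)) / real ?N) \<partial>\<Omega>)"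
      by (simp only: inner)
    also have "\<dots> = (\<integral>\<^sup>+s. ennreal ((\<Sum>j<?N. ?k T (\<phi> s) (z j)) / real ?N) \<partial>m (r n))"
      unfolding Yd[symmetric] by (subst nn_integral_distr) auto
    also have "\<dots> = (\<integral>\<^sup>+i. ennreal ((\<Sum>j<?N. ?k T (z i) (z j)) / real ?N) \<partial>p (r n))"
      unfolding m_def by (subst nn_integral_distr) (auto simp: x(2))
    also have "\<dots> = (\<Sum>i<?N. ennreal ((\<Sum>j<?N. ?k T (z i) (z j)) / real ?N)) / of_nat ?N"
      unfolding p_def by (subst nn_integral_pmf_of_set) auto
    also have "\<dots> = ennreal ((\<Sum>i<?N. \<Sum>j<?N. ?k T (z i) (z j)) / (real ?N)\<^sup>2)"
      by (simp add: sum_ennreal trunc_kernel_bounds divide_ennreal sum_nonneg ennreal_of_nat_eq_real_of_nat power2_eq_square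
          sum_divide_distrib[symmetric] del: of_nat_Suc sum.lessThan_Suc)
    also have "\<dots> \<le> ennreal (real T / real ?N + c)"
    proof (rule ennreal_leI)
      have "(\<Sum>i<?N. \<Sum>j<?N. ?k T (z i) (z j)) \<le> real ?N * real T + (real ?N)\<^sup>2 * c"
        unfolding c_def using D zF low by (intro sum_trunc_kernel_le) auto
      then show "(\<Sum>i<?N. \<Sum>j<?N. ?k T (z i) (z j)) / (real ?N)\<^sup>2 \<le> real T / real ?N + c"
        by (simp add: field_simps power2_eq_square del: of_nat_Suc sum.lessThan_Suc)
    qed
    finally show ?thesis .
  qed
  \<comment> \<open>T is fixed while n tends to infinity, so the diagonal share
    \<open>T / Suc (r n)\<close> vanishes and the bound c is uniform in T. Monotone convergence in T
    then reaches the full kernel.\<close>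
  have bound: "(\<integral>\<^sup>+a. \<integral>\<^sup>+b. ennreal (?k T a b) \<partial>\<sigma> \<partial>\<sigma>) \<le> ennreal c" for T
  proof -
    let ?g = "\<lambda>n q. ennreal (?k T (\<phi> (Y n (fst q))) (\<phi> (Y n (snd q))))"
    let ?P = "\<Omega> \<Otimes>\<^sub>M \<Omega>"
    have gm [measurable]: "?g n \<in> borel_measurable ?P" for n
      by (intro measurable_compose[OF kmeas' measurable_ennreal]) measurable
    have g'm: "(\<lambda>q. ennreal (?k T (\<phi> (Y' (fst q))) (\<phi> (Y' (snd q))))) \<in> borel_measurable ?P"
      by (intro measurable_compose[OF kmeas' measurable_ennreal]) measurable
    have [measurable]: "(\<lambda>s. ?k T a s) \<in> borel_measurable borel" for a by (rule kmeas') measurable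
    have "(\<integral>\<^sup>+a. \<integral>\<^sup>+b. ennreal (?k T a b) \<partial>\<sigma> \<partial>\<sigma>)
      = (\<integral>\<^sup>+\<omega>. \<integral>\<^sup>+b. ennreal (?k T (\<phi> (Y' \<omega>)) b) \<partial>\<sigma> \<partial>\<Omega>)"
    proof -
      have "(\<lambda>a. \<integral>\<^sup>+b. ennreal (?k T a b) \<partial>\<sigma>) \<in> borel_measurable borel"
        by (intro nn_integral_kernel_measurable s.sigma_finite_measure_axioms \<sigma>s) measurable
      then show ?thesis by (rule int\<sigma>)
    qed
    also have "\<dots> = (\<integral>\<^sup>+\<omega>. \<integral>\<^sup>+\<omega>'. ennreal (?k T (\<phi> (Y' \<omega>)) (\<phi> (Y' \<omega>'))) \<partial>\<Omega> \<partial>\<Omega>)"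
      by (intro nn_integral_cong int\<sigma>) measurable
    also have "\<dots> = (\<integral>\<^sup>+q. ennreal (?k T (\<phi> (Y' (fst q))) (\<phi> (Y' (snd q)))) \<partial>?P)"
      using O.nn_integral_fst[OF g'm] by simp
    also have "\<dots> = (\<integral>\<^sup>+q. liminf (\<lambda>n. ?g n q) \<partial>?P)"
    proof (rule nn_integral_cong)
      fix q assume "q \<in> space ?P"
      then have q: "fst q \<in> space \<Omega>" "snd q \<in> space \<Omega>" by (auto simp: space_pair_measure)
      have "isCont (\<lambda>q. ?k T (fst q) (snd q)) (\<phi> (Y' (fst q)), \<phi> (Y' (snd q)))"
        using continuous_trunc_kernel[OF D(1)] by (simp add: continuous_on_eq_continuous_at)
      from isCont_tendsto_compose[OF this tendsto_Pair[OF lim\<phi>[OF q(1)] lim\<phi>[OF q(2)]]]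
      have "(\<lambda>n. ?g n q) \<longlonglongrightarrow> ennreal (?k T (\<phi> (Y' (fst q))) (\<phi> (Y' (snd q))))"
        by (intro tendsto_ennrealI) simp
      then show "ennreal (?k T (\<phi> (Y' (fst q))) (\<phi> (Y' (snd q)))) = liminf (\<lambda>n. ?g n q)"
        by (intro lim_imp_Liminf[symmetric]) auto
    qed
    also have "\<dots> \<le> liminf (\<lambda>n. \<integral>\<^sup>+q. ?g n q \<partial>?P)" by (rule nn_integral_liminf) (rule gm)
    also have "\<dots> \<le> liminf (\<lambda>n. ennreal (real T / real (Suc (r n)) + c))"
    proof (rule Liminf_mono, rule always_eventually, rule allI)
      fix n
      show "(\<integral>\<^sup>+q. ?g n q \<partial>?P) \<le> ennreal (real T / real (Suc (r n)) + c)"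
        using disc[of T n] O.nn_integral_fst[OF gm[of n]] by simp
    qed
    also have "\<dots> = ennreal (0 + c)"
    proof (rule lim_imp_Liminf)
      have "(\<lambda>n. real T / real (Suc (r n))) \<longlonglongrightarrow> 0"
        using LIMSEQ_subseq_LIMSEQ[OF LIMSEQ_Suc[OF lim_const_over_n[of "real T"]] r(1)] by (simp add: o_def)
      then show "(\<lambda>n. ennreal (real T / real (Suc (r n)) + c)) \<longlonglongrightarrow> ennreal (0 + c)"
        by (intro tendsto_ennrealI tendsto_add tendsto_const)
    qed simp
    finally show ?thesis by simp
  qed
  have km1: "(\<lambda>b. ennreal (?k T a b)) \<in> borel_measurable \<sigma>" for T a
    by (intro measurable_compose[OF kmeas' measurable_ennreal]) (simp_all add: \<sigma>_def)
  have km2: "(\<lambda>a. \<integral>\<^sup>+b. ennreal (?k T a b) \<partial>\<sigma>) \<in> borel_measurable \<sigma>" for T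
  proof -
    have "(\<lambda>a. \<integral>\<^sup>+b. ennreal (?k T a b) \<partial>\<sigma>) \<in> borel_measurable borel"
      by (intro nn_integral_kernel_measurable s.sigma_finite_measure_axioms \<sigma>s) measurable
    then show ?thesis by (simp add: \<sigma>_def)
  qed
  have "mutual D \<sigma> \<sigma> = (\<integral>\<^sup>+a. \<integral>\<^sup>+b. (SUP T. ennreal (?k T a b)) \<partial>\<sigma> \<partial>\<sigma>)"
    unfolding mutual_def by (intro nn_integral_cong log_kernel_eq_SUP_trunc D)
  also have "\<dots> = (\<integral>\<^sup>+a. (SUP T. \<integral>\<^sup>+b. ennreal (?k T a b) \<partial>\<sigma>) \<partial>\<sigma>)"
    using incseq_trunc_kernel by (intro nn_integral_cong nn_integral_monotone_convergence_SUP km1) (auto simp: incseq_def le_fun_def)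
  also have "\<dots> = (SUP T. \<integral>\<^sup>+a. \<integral>\<^sup>+b. ennreal (?k T a b) \<partial>\<sigma> \<partial>\<sigma>)"
    using incseq_trunc_kernel by (intro nn_integral_monotone_convergence_SUP km2) (auto simp: incseq_def le_fun_def intro!: nn_integral_mono)
  also have "\<dots> \<le> ennreal c" using bound by (intro SUP_least)
  also have "\<dots> < \<infinity>" by simp
  finally show ?thesis using pr by blast
qed

text \<open>If every monic polynomial with roots in F were large somewhere on F, points could be
  added one by one, each with a large product of distances to its predecessors. Such a sequence
  produces a measure of finite energy on F.\<close>

lemma exists_small_monic_polynomial:
  assumes F: "compact F" "F \<noteq> {}" and D: "D \<ge> 1" "\<And>a b. a \<in> F \<Longrightarrow> b \<in> F \<Longrightarrow> cmod (a - b) \<le> D"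
    and no: "\<And>\<sigma>. prob_on F \<sigma> \<Longrightarrow> mutual D \<sigma> \<sigma> = \<infinity>"
  shows "\<exists>n\<ge>1. \<exists>y. (\<forall>i<n. y i \<in> F) \<and> (\<forall>z\<in>F. (\<Prod>i<n. cmod (z - y i)) < exp (- K * real n))"
proof (rule ccontr)
  assume neg: "\<not> ?thesis"
  have ex: "\<exists>z\<in>F. (\<Prod>i<length xs. cmod (z - xs ! i)) \<ge> exp (- K * real (length xs))" if "set xs \<subseteq> F" for xs
  proof (cases "length xs \<ge> 1")
    case True
    have "\<forall>i<length xs. xs ! i \<in> F" using that by auto
    then show ?thesis using neg True by (meson not_le)
  next
    case False
    then have "length xs = 0" by linarith
    then show ?thesis using F(2) by auto
  qed
  define step where "step xs = (SOME z. z \<in> F \<and> (\<Prod>i<length xs. cmod (z - xs ! i)) \<ge> exp (- K * real (length xs)))" for xs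
  have step: "step xs \<in> F \<and> (\<Prod>i<length xs. cmod (step xs - xs ! i)) \<ge> exp (- K * real (length xs))" if "set xs \<subseteq> F" for xs
    unfolding step_def by (rule someI_ex) (use ex[OF that] in blast)
  \<comment> \<open>Each new point depends on all earlier ones, so the recursion carries the whole
    list.\<close>
  define zs where "zs = rec_nat [] (\<lambda>_ xs. xs @ [step xs])"
  have zs: "zs 0 = []" "zs (Suc n) = zs n @ [step (zs n)]" for n by (simp_all add: zs_def)
  have sub: "set (zs n) \<subseteq> F" for n by (induction n) (auto simp: zs step)
  define z where "z n = step (zs n)" for n
  have zs_eq: "zs n = map z [0..<n]" for n by (induction n) (auto simp: zs z_def)
  have "z n \<in> F" for n using step[OF sub[of n]] by (simp add: z_def)
  moreover have "(\<Prod>i<n. cmod (z n - z i)) \<ge> exp (- K * real n)" for n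
    using step[OF sub[of n]] by (simp add: zs_eq flip: z_def) (simp add: z_def zs_eq)
  ultimately obtain \<sigma> where "prob_on F \<sigma>" "mutual D \<sigma> \<sigma> < \<infinity>"
    using exists_finite_energy_measure[OF F(1) _ D, of z K] by blast
  then show False using no by auto
qed

text \<open>A finite substitute for an Evans measure: the uniform distribution over the indices of
  the roots has potential \<open>1/n log |P|\<close>, below \<open>- K\<close> on F. Repeated roots
  only add weight, and at a root itself the potential is \<open>-\<infinity>\<close>.\<close>

lemma exists_measure_pot_le:
  assumes F: "compact F" "F \<noteq> {}" and D: "D \<ge> 1" "\<And>a b. a \<in> F \<Longrightarrow> b \<in> F \<Longrightarrow> cmod (a - b) \<le> D"
    and no: "\<And>\<sigma>. prob_on F \<sigma> \<Longrightarrow> mutual D \<sigma> \<sigma> = \<infinity>"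
  shows "\<exists>\<rho>. prob_on F \<rho> \<and> (\<forall>z\<in>F. pot \<rho> z \<le> ereal (- K))"
proof -
  obtain n y where n: "n \<ge> 1" and y: "\<forall>i<n. y i \<in> F" and small: "\<forall>z\<in>F. (\<Prod>i<n. cmod (z - y i)) < exp (- K * real n)"
    using exists_small_monic_polynomial[OF assms] by blast
  define p where "p = pmf_of_set {..<n}"
  have ne: "{..<n} \<noteq> {}" using n by (simp add: lessThan_empty_iff)
  have setp: "set_pmf p = {..<n}" unfolding p_def using ne by (subst set_pmf_of_set) auto
  define \<rho> where "\<rho> = distr (measure_pmf p) borel y"
  have closedF: "closed F" using F(1) by (rule compact_imp_closed)
  have \<rho>s: "sets \<rho> = sets borel" by (simp add: \<rho>_def)
  interpret r: prob_space \<rho> unfolding \<rho>_def by (intro measure_pmf.prob_space_distr) auto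
  have ae: "AE t in \<rho>. P t" if "\<And>i. i < n \<Longrightarrow> P (y i)" "{t. P t} \<in> sets borel" for P
    unfolding \<rho>_def using that by (subst AE_distr_iff) (auto intro!: AE_pmfI simp: setp)
  have ae': "P (y i)" if "AE t in \<rho>. P t" "{t. P t} \<in> sets borel" "i < n" for P i
    using that unfolding \<rho>_def by (subst (asm) AE_distr_iff) (auto simp: AE_measure_pmf_iff setp)
  have aeF: "AE t in \<rho>. t \<in> F" using y closedF by (intro ae) auto
  have pr: "prob_on F \<rho>"
    by (rule prob_onI[OF \<rho>s _ closedF aeF]) (use r.emeasure_space_1 in \<open>simp add: \<rho>_def\<close>)
  obtain R where R: "\<forall>a\<in>F. cmod a \<le> R" using compact_imp_bounded[OF F(1)] by (auto simp: bounded_iff)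
  interpret b: bounded_support \<rho> R
    by unfold_locales (use \<rho>s aeF R in \<open>auto elim!: eventually_mono\<close>)
  have "pot \<rho> z \<le> ereal (- K)" if z: "z \<in> F" for z
  proof (cases "pot \<rho> z = -\<infinity>")
    case False
    note p = b.pot_finite_imp[OF False]
    have yz: "y i \<noteq> z" if "i < n" for i using ae'[OF p(2) _ that] by simp
    have "(\<integral>t. ln (cmod (z - t)) \<partial>\<rho>) = (\<integral>i. ln (cmod (z - y i)) \<partial>measure_pmf p)"
      unfolding \<rho>_def by (subst integral_distr) auto
    also have "\<dots> = (\<Sum>i<n. ln (cmod (z - y i))) / real n"
      unfolding p_def using ne by (subst integral_pmf_of_set) auto
    also have "(\<Sum>i<n. ln (cmod (z - y i))) = ln (\<Prod>i<n. cmod (z - y i))"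
      using yz by (subst ln_prod) auto
    also have "\<dots> \<le> ln (exp (- K * real n))"
    proof (rule ln_mono)
      show "(\<Prod>i<n. cmod (z - y i)) \<le> exp (- K * real n)" using small z by (auto intro: less_imp_le)
      show "0 < (\<Prod>i<n. cmod (z - y i))" using yz by (intro prod_pos) auto
    qed
    also have "\<dots> / real n = - K" using n by simp
    finally have "(\<integral>t. ln (cmod (z - t)) \<partial>\<rho>) \<le> - K" using n by (simp add: divide_right_mono)
    then show ?thesis using p(3) by simp
  qed simp
  then show ?thesis using pr by blast
qed

section \<open>Sharpness\<close>

lemma prob_on_mono:
  assumes "closed F" "F \<subseteq> E" "prob_on F \<sigma>"
  shows "prob_on E \<sigma>"
proof -
  have "UNIV - F \<in> sets \<sigma>" using assms by (auto simp: prob_on_def)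
  then have "emeasure \<sigma> (UNIV - E) \<le> emeasure \<sigma> (UNIV - F)" using assms by (intro emeasure_mono) auto
  then show ?thesis using assms by (auto simp: prob_on_def)
qed

context equilibrium begin

lemma pot_le_iff:
  assumes "prob_on E \<sigma>" "z \<in> E" "a \<le> ln D"
  shows "pot \<sigma> z \<le> ereal a \<longleftrightarrow> ennreal (ln D - a) \<le> (\<integral>\<^sup>+t. log_kernel D z t \<partial>\<sigma>)"
  unfolding pot_eq_kernel(1)[OF assms(1,2)] using assms(3)
  by (cases "\<integral>\<^sup>+t. log_kernel D z t \<partial>\<sigma>") (auto simp: enn2ereal_ennreal)

lemma pot_le_ln_D: "prob_on E \<sigma> \<Longrightarrow> z \<in> E \<Longrightarrow> pot \<sigma> z \<le> ereal (ln D)"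
  by (simp add: pot_le_iff)

text \<open>\<mu> serves directly when its potential stays below \<open>L + \<eta>\<close> on E.
  Otherwise the exceptional set F carries only measures of infinite energy, and a small admixture
  \<rho> with very negative potential on F lowers the supremum while hardly changing the integral of
  \<open>ln (dE E z)\<close>.\<close>

lemma exists_almost_extremal_measure:
  assumes \<eta>: "\<eta> > 0"
  shows "\<exists>\<nu>. prob_on E \<nu> \<and> (\<forall>z\<in>E. pot \<nu> z \<le> ereal (L + 2 * \<eta>)) \<and> (\<integral>z. ln (dE E z) \<partial>\<nu>) \<ge> (\<integral>z. ln (dE E z) \<partial>\<mu>) - \<eta>"
proof -
  define F where "F = {z\<in>E. ereal (L + \<eta>) \<le> pot \<mu> z}"
  have FE: "F \<subseteq> E" by (auto simp: F_def)
  have cF: "compact F" unfolding F_def Collect_conj_eq using compact_Int_closed[OF compact_E closed_pot_ge] by simp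
  show ?thesis
  proof (cases "F = {}")
    case True
    have "pot \<mu> z \<le> ereal (L + 2 * \<eta>)" if "z \<in> E" for z
    proof -
      have "pot \<mu> z < ereal (L + \<eta>)" using True that by (auto simp: F_def not_le)
      also have "\<dots> \<le> ereal (L + 2 * \<eta>)" using \<eta> by simp
      finally show ?thesis by simp
    qed
    then show ?thesis using prob_on_mu \<eta> by (intro exI[of _ \<mu>]) auto
  next
    case False
    define I where "I = (\<integral>z. ln (dE E z) \<partial>\<mu>)"
    \<comment> \<open>The second bound limits the rise off F, where the potential of \<rho> is only
      known to be at most \<open>ln D\<close>; the third limits the loss in the integral of
      \<open>ln (dE E z)\<close>. The summands 1 keep the denominators positive.\<close>
    define \<delta> where "\<delta> = min (1/2) (min (\<eta> / (g + 1)) (\<eta> / (\<bar>I - ln d0\<bar> + 1)))"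
    have g1: "g + 1 > 0" using g_nonneg by simp
    have I1: "\<bar>I - ln d0\<bar> + 1 > 0" by simp
    have \<delta>: "0 < \<delta>" unfolding \<delta>_def using \<eta> g1 I1 by (simp add: divide_pos_pos)
    have \<delta>1: "\<delta> \<le> 1/2" unfolding \<delta>_def by (rule min.cobounded1)
    have "\<delta> \<le> \<eta> / (g + 1)" unfolding \<delta>_def by (intro min.coboundedI2 min.cobounded1)
    then have \<delta>g: "\<delta> * (g + 1) \<le> \<eta>" using g1 by (simp only: pos_le_divide_eq)
    have "\<delta> \<le> \<eta> / (\<bar>I - ln d0\<bar> + 1)" unfolding \<delta>_def by (intro min.coboundedI2 min.cobounded2)
    then have \<delta>I: "\<delta> * (\<bar>I - ln d0\<bar> + 1) \<le> \<eta>" using I1 by (simp only: pos_le_divide_eq)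
    have lnD: "ln D \<ge> 0" using D_ge_1 by simp
    \<comment> \<open>On F the mixture has potential at most
      \<open>(1 - \<delta>) * ln D - \<delta> * K\<close>, and this K makes that at most
      \<open>- \<bar>L\<bar>\<close>.\<close>
    define K where "K = (ln D + \<bar>L\<bar>) / \<delta>"
    have K: "K \<ge> 0" "\<delta> * K = ln D + \<bar>L\<bar>" using \<delta> lnD by (auto simp: K_def)
    have "mutual D \<sigma> \<sigma> = \<infinity>" if pr: "prob_on F \<sigma>" for \<sigma>
    proof (rule ccontr)
      assume "mutual D \<sigma> \<sigma> \<noteq> \<infinity>"
      then have fin: "mutual D \<sigma> \<sigma> < \<infinity>" by (simp add: less_top)
      have "AE z in \<sigma>. ereal (L + \<eta>) \<le> pot \<mu> z"
        using prob_on_AE[OF compact_imp_closed[OF cF] pr] by eventually_elim (simp add: F_def)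
      then show False
        using finite_energy_not_pot_ge[OF prob_on_mono[OF compact_imp_closed[OF cF] FE pr] fin \<eta>] by blast
    qed
    moreover have "cmod (a - b) \<le> D" if "a \<in> F" "b \<in> F" for a b using that FE by (intro dist_le_D) auto
    ultimately obtain \<rho> where \<rho>: "prob_on F \<rho>" "\<forall>z\<in>F. pot \<rho> z \<le> ereal (- K)"
      using exists_measure_pot_le[OF cF False D_ge_1] by metis
    have \<rho>E: "prob_on E \<rho>" by (rule prob_on_mono[OF compact_imp_closed[OF cF] FE \<rho>(1)])
    obtain \<nu> where \<nu>: "prob_on E \<nu>"
      "\<And>f :: complex \<Rightarrow> ennreal. f \<in> borel_measurable borel \<Longrightarrow>
       (\<integral>\<^sup>+t. f t \<partial>\<nu>) = ennreal (1 - \<delta>) * (\<integral>\<^sup>+t. f t \<partial>\<mu>) + ennreal \<delta> * (\<integral>\<^sup>+t. f t \<partial>\<rho>)"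
      using exists_mixture[OF closed_E prob_on_mu \<rho>E, of \<delta>] \<delta> \<delta>1 by auto
    have mix: "pot \<nu> z \<le> ereal ((1 - \<delta>) * a + \<delta> * b)"
      if z: "z \<in> E" and a: "pot \<mu> z \<le> ereal a" "a \<le> ln D" and b: "pot \<rho> z \<le> ereal b" "b \<le> ln D" for z a b
    proof -
      have "(1 - \<delta>) * a + \<delta> * b \<le> (1 - \<delta>) * ln D + \<delta> * ln D"
        using \<delta> \<delta>1 a b by (intro add_mono mult_left_mono) auto
      then have le: "(1 - \<delta>) * a + \<delta> * b \<le> ln D" by (simp add: algebra_simps)
      have "ennreal (ln D - ((1 - \<delta>) * a + \<delta> * b)) = ennreal ((1 - \<delta>) * (ln D - a) + \<delta> * (ln D - b))"
        by (simp add: algebra_simps)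
      also have "\<dots> = ennreal (1 - \<delta>) * ennreal (ln D - a) + ennreal \<delta> * ennreal (ln D - b)"
        using \<delta> \<delta>1 a b by (simp add: ennreal_plus ennreal_mult)
      also have "\<dots> \<le> ennreal (1 - \<delta>) * (\<integral>\<^sup>+t. log_kernel D z t \<partial>\<mu>) + ennreal \<delta> * (\<integral>\<^sup>+t. log_kernel D z t \<partial>\<rho>)"
        using pot_le_iff[OF prob_on_mu z a(2)] pot_le_iff[OF \<rho>E z b(2)] a b by (intro add_mono mult_left_mono) auto
      also have "\<dots> = (\<integral>\<^sup>+t. log_kernel D z t \<partial>\<nu>)" by (rule \<nu>(2)[symmetric]) simp
      finally show ?thesis using pot_le_iff[OF \<nu>(1) z le] by simp
    qed
    have "pot \<nu> z \<le> ereal (L + 2 * \<eta>)" if z: "z \<in> E" for z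
    proof (cases "z \<in> F")
      case True
      have "pot \<nu> z \<le> ereal ((1 - \<delta>) * ln D + \<delta> * (- K))"
        using mix[OF z pot_le_ln_D[OF prob_on_mu z], of "- K"] \<rho>(2) True K lnD by simp
      also have "(1 - \<delta>) * ln D + \<delta> * (- K) \<le> L + 2 * \<eta>"
      proof -
        have "(1 - \<delta>) * ln D \<le> 1 * ln D" using \<delta> lnD by (intro mult_right_mono) auto
        then show ?thesis using K(2) \<eta> by simp
      qed
      finally show ?thesis by simp
    next
      case False
      \<comment> \<open>The cap at \<open>ln D\<close> meets the side condition of
        \<open>mix\<close>, and still \<open>ln D - a \<le> g + 1\<close>.\<close>
      define a where "a = min (L + \<eta>) (ln D)"
      have "pot \<mu> z \<le> ereal (L + \<eta>)" using False z by (auto simp: F_def not_le intro: less_imp_le)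
      then have "pot \<mu> z \<le> ereal a" using pot_le_ln_D[OF prob_on_mu z] by (simp add: a_def min_def)
      then have "pot \<nu> z \<le> ereal ((1 - \<delta>) * a + \<delta> * ln D)"
        using mix[OF z _ _ pot_le_ln_D[OF \<rho>E z]] by (simp add: a_def)
      also have "(1 - \<delta>) * a + \<delta> * ln D \<le> L + 2 * \<eta>"
      proof -
        have "ln D - a \<le> g + 1" using g_nonneg \<eta> by (auto simp: a_def g_def min_def)
        then have "\<delta> * (ln D - a) \<le> \<delta> * (g + 1)" using \<delta> by (intro mult_left_mono) auto
        then have "\<delta> * (ln D - a) \<le> \<eta>" using \<delta>g by linarith
        moreover have "a \<le> L + \<eta>" by (simp add: a_def)
        moreover have "(1 - \<delta>) * a + \<delta> * ln D = a + \<delta> * (ln D - a)" by (simp add: algebra_simps)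
        ultimately show ?thesis by linarith
      qed
      finally show ?thesis by simp
    qed
    moreover have "(\<integral>z. ln (dE E z) \<partial>\<nu>) \<ge> I - \<eta>"
    proof -
      interpret v: prob_space \<nu> using \<nu>(1) by (simp add: prob_on_def)
      \<comment> \<open>The shift by \<open>ln d0\<close> makes the function nonnegative, so the
        contribution of \<rho> to the mixture can simply be dropped.\<close>
      define f where "f z = ln (dE E z) - ln d0" for z
      have f0: "f z \<ge> 0" for z unfolding f_def using d0(1) d0(2)[of z] by simp
      have [measurable]: "f \<in> borel_measurable borel" unfolding f_def by measurable
      have i\<mu>: "integrable \<mu> f" unfolding f_def using integrable_ln_dE[OF prob_on_mu] by simp
      have i\<nu>: "integrable \<nu> f" unfolding f_def using integrable_ln_dE[OF \<nu>(1)] by simp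
      have e\<mu>: "(\<integral>z. f z \<partial>\<mu>) = I - ln d0" unfolding f_def I_def using integrable_ln_dE[OF prob_on_mu] prob_space by simp
      have e\<nu>: "(\<integral>z. f z \<partial>\<nu>) = (\<integral>z. ln (dE E z) \<partial>\<nu>) - ln d0" unfolding f_def using integrable_ln_dE[OF \<nu>(1)] v.prob_space by simp
      have nn: "(\<integral>z. f z \<partial>\<mu>) \<ge> 0" "(\<integral>z. f z \<partial>\<nu>) \<ge> 0" using f0 by (auto intro: Bochner_Integration.integral_nonneg)
      have "ennreal ((1 - \<delta>) * (\<integral>z. f z \<partial>\<mu>)) = ennreal (1 - \<delta>) * (\<integral>\<^sup>+z. ennreal (f z) \<partial>\<mu>)"
        using nn_integral_eq_integral[OF i\<mu>] f0 \<delta>1 nn by (simp add: ennreal_mult)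
      also have "\<dots> \<le> (\<integral>\<^sup>+z. ennreal (f z) \<partial>\<nu>)" by (subst \<nu>(2)) auto
      also have "\<dots> = ennreal (\<integral>z. f z \<partial>\<nu>)" using nn_integral_eq_integral[OF i\<nu>] f0 by simp
      finally have "(1 - \<delta>) * (I - ln d0) \<le> (\<integral>z. ln (dE E z) \<partial>\<nu>) - ln d0"
        using nn by (simp add: e\<mu> e\<nu>)
      moreover have "\<delta> * (I - ln d0) \<le> \<delta> * (\<bar>I - ln d0\<bar> + 1)" using \<delta> by (intro mult_left_mono) auto
      ultimately show ?thesis using \<delta>I by (simp add: algebra_simps)
    qed
    ultimately show ?thesis using \<nu>(1) unfolding I_def by blast
  qed
qed

text \<open>On a piece within r of its centre \<open>a j\<close>, the farthest point
  \<open>c j\<close> of E from that centre is nearly farthest from every point of the piece.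
  Evaluating the potential of the piece at \<open>c j\<close> therefore recovers the integral of
  \<open>ln (dE E t)\<close> up to \<eta> times its mass, while cutting leaves the total potential
  unchanged.\<close>

lemma exists_fine_decomposition:
  assumes pr: "prob_on E \<nu>" and \<eta>: "\<eta> > 0"
  shows "\<exists>m \<kappa>. admissible_family m \<kappa> \<and> (\<forall>z. (\<Sum>j=1..m. pot (\<kappa> j) z) = pot \<nu> z)
     \<and> ereal ((\<integral>z. ln (dE E z) \<partial>\<nu>) - \<eta>) \<le> (\<Sum>j=1..m. SUP z\<in>E. pot (\<kappa> j) z)"
proof -
  interpret v: prob_space \<nu> using pr by (simp add: prob_on_def)
  have vs [measurable_cong]: "sets \<nu> = sets borel" using pr by (simp add: prob_on_def)
  have vsp: "space \<nu> = UNIV" using sets_eq_imp_space_eq[OF vs] by simp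
  have aeE: "AE t in \<nu>. t \<in> E" by (rule prob_on_AE[OF closed_E pr])
  \<comment> \<open>Distances drop by at most \<open>2 * r\<close> on a piece. As all values of
    \<open>dE E\<close> are at least d0, this choice makes that drop at most a factor
    \<open>exp (- \<eta>)\<close>, an additive \<eta> in the logarithm.\<close>
  define r where "r = d0 * (1 - exp (- \<eta>)) / 2"
  have r: "r > 0" using d0(1) \<eta> by (simp add: r_def)
  have rd: "d * exp (- \<eta>) \<le> d - 2 * r" if "d \<ge> d0" for d
  proof -
    have "d0 * (1 - exp (- \<eta>)) \<le> d * (1 - exp (- \<eta>))" using that \<eta> by (intro mult_right_mono) auto
    moreover have "2 * r = d0 * (1 - exp (- \<eta>))" by (simp add: r_def)
    ultimately show ?thesis by (simp add: algebra_simps)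
  qed
  obtain T where T: "finite T" "T \<subseteq> E" "E \<subseteq> (\<Union>a\<in>T. ball a r)"
    by (rule compactE_image[OF compact_E, of E "\<lambda>a. ball a r"]) (use r in auto)
  obtain a where a: "bij_betw a {1..card T} T" using ex_bij_betw_nat_finite_1[OF T(1)] by blast
  define m where "m = card T"
  have aT: "a ` {1..m} = T" using a by (simp add: m_def bij_betw_def)
  define A where "A j = ball (a j) r - (\<Union>i\<in>{1..<j}. ball (a i) r)" for j
  have Am [measurable]: "A j \<in> sets borel" for j unfolding A_def by measurable
  have part: "(\<Sum>j=1..m. indicat_real (A j) t) = 1" if t: "t \<in> E" for t
  proof -
    have ex: "\<exists>j. j \<in> {1..m} \<and> t \<in> ball (a j) r"
      using subsetD[OF T(3) t] unfolding aT[symmetric] by blast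
    define J where "J = (LEAST j. j \<in> {1..m} \<and> t \<in> ball (a j) r)"
    have J: "J \<in> {1..m} \<and> t \<in> ball (a J) r" unfolding J_def by (rule LeastI_ex[OF ex])
    have min: "t \<notin> ball (a i) r" if "i < J" "i \<in> {1..m}" for i using not_less_Least[of i] that unfolding J_def by blast
    have "indicat_real (A j) t = (if j = J then 1 else 0)" if j: "j \<in> {1..m}" for j
    proof (cases "j = J")
      case True
      have "t \<in> A J" unfolding A_def using J min by force
      then show ?thesis using True by simp
    next
      case False
      have "t \<notin> A j"
      proof (cases "j < J")
        case True then show ?thesis using min[OF True j] by (auto simp: A_def)
      next
        case False
        with \<open>j \<noteq> J\<close> have "J < j" by simp
        then show ?thesis using J by (auto simp: A_def)
      qed
      then show ?thesis using False by simp
    qed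
    then have "(\<Sum>j=1..m. indicat_real (A j) t) = (\<Sum>j=1..m. if j = J then 1 else 0)" by (intro sum.cong) auto
    also have "\<dots> = 1" using J by simp
    finally show ?thesis .
  qed
  define \<kappa> where "\<kappa> j = density \<nu> (\<lambda>t. ennreal (indicat_real (A j) t))" for j
  have ks: "sets (\<kappa> j) = sets borel" for j by (simp add: \<kappa>_def vs)
  have knn: "(\<Sum>j=1..m. \<integral>\<^sup>+t. f t \<partial>\<kappa> j) = (\<integral>\<^sup>+t. f t \<partial>\<nu>)" if [measurable]: "f \<in> borel_measurable borel" for f
  proof -
    have "(\<Sum>j=1..m. \<integral>\<^sup>+t. f t \<partial>\<kappa> j) = (\<Sum>j=1..m. \<integral>\<^sup>+t. ennreal (indicat_real (A j) t) * f t \<partial>\<nu>)"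
      unfolding \<kappa>_def by (intro sum.cong refl nn_integral_density) auto
    also have "\<dots> = (\<integral>\<^sup>+t. (\<Sum>j=1..m. ennreal (indicat_real (A j) t) * f t) \<partial>\<nu>)"
      by (rule nn_integral_sum[symmetric]) measurable
    also have "\<dots> = (\<integral>\<^sup>+t. f t \<partial>\<nu>)"
    proof (rule nn_integral_cong_AE)
      show "AE t in \<nu>. (\<Sum>j=1..m. ennreal (indicat_real (A j) t) * f t) = f t" using aeE
      proof eventually_elim
        case (elim t)
        have "(\<Sum>j=1..m. ennreal (indicat_real (A j) t) * f t) = ennreal (\<Sum>j=1..m. indicat_real (A j) t) * f t"
          by (simp add: sum_distrib_right sum_ennreal[symmetric] del: sum_ennreal)
        then show ?case using part[OF elim] by simp
      qed
    qed
    finally show ?thesis .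
  qed
  have bk: "bounded_support (\<kappa> j) RE" for j
  proof -
    have le: "emeasure (\<kappa> j) UNIV \<le> 1"
    proof -
      have "emeasure (\<kappa> j) UNIV = (\<integral>\<^sup>+t. ennreal (indicat_real (A j) t) * indicator UNIV t \<partial>\<nu>)"
        unfolding \<kappa>_def by (rule emeasure_density) (auto simp: vs)
      also have "\<dots> \<le> (\<integral>\<^sup>+t. 1 \<partial>\<nu>)" by (intro nn_integral_mono) (auto simp: indicator_def)
      finally show ?thesis using v.emeasure_space_1 by simp
    qed
    interpret finite_measure "\<kappa> j" by (rule finite_measureI) (use le in \<open>auto simp: \<kappa>_def vsp top_unique\<close>)
    have "AE t in \<kappa> j. cmod t \<le> RE"
      unfolding \<kappa>_def using aeE by (subst AE_density) (auto elim!: eventually_mono simp: RE)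
    then show ?thesis by unfold_locales (simp_all add: ks)
  qed
  have adm: "admissible_family m \<kappa>"
    unfolding admissible_family_def
  proof (intro conjI ballI)
    fix j
    have "AE t in \<kappa> j. t \<in> E"
      unfolding \<kappa>_def using aeE by (subst AE_density) (auto elim!: eventually_mono)
    then have "emeasure (\<kappa> j) (UNIV - E) = 0"
      using closed_E sets_eq_imp_space_eq[OF ks[of j]] by (subst (asm) AE_iff_measurable[where N="UNIV - E"]) (auto simp: ks)
    then show "\<exists>K. compact K \<and> emeasure (\<kappa> j) (UNIV - K) = 0" using compact_E by blast
    show "sets (\<kappa> j) = sets borel" by (rule ks)
  next
    have "(\<Sum>j=1..m. emeasure (\<kappa> j) UNIV) = (\<Sum>j=1..m. \<integral>\<^sup>+t. 1 \<partial>\<kappa> j)"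
      by (simp add: \<kappa>_def vsp)
    also have "\<dots> = (\<integral>\<^sup>+t. 1 \<partial>\<nu>)" by (rule knn) simp
    also have "\<dots> = 1" using v.emeasure_space_1 by simp
    finally show "(\<Sum>j=1..m. emeasure (\<kappa> j) UNIV) = 1" .
  qed
  have pots: "(\<Sum>j=1..m. pot (\<kappa> j) z) = pot \<nu> z" for z
  proof -
    have fin: "(\<integral>\<^sup>+t. log_pos z t \<partial>\<kappa> j) \<noteq> \<infinity>" for j
      by (rule bounded_support.nn_integral_log_pos_finite[OF bk])
    have "(\<Sum>j=1..m. pot (\<kappa> j) z) = enn2ereal (\<Sum>j=1..m. \<integral>\<^sup>+t. log_pos z t \<partial>\<kappa> j) - enn2ereal (\<Sum>j=1..m. \<integral>\<^sup>+t. log_neg z t \<partial>\<kappa> j)"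
      unfolding pot_def by (rule enn2ereal_sum_diff[OF finite_atLeastAtMost fin, symmetric])
    then show ?thesis by (simp only: pot_def knn log_measurable_right)
  qed
  have "\<exists>c. c \<in> E \<and> cmod (a j - c) = dE E (a j)" for j using dE_attained by blast
  then obtain c where c: "\<And>j. c j \<in> E" "\<And>j. cmod (a j - c j) = dE E (a j)" by metis
  have lower: "z \<noteq> t \<and> ln (dE E t) - \<eta> \<le> ln (cmod (z - t))" if t: "t \<in> A j" and z: "z = c j" for t z j
  proof -
    have ta: "cmod (a j - t) < r" using t by (auto simp: A_def dist_norm)
    have "dE E t - 2 * r \<le> cmod (c j - t)"
      using dE_lipschitz[of t "a j"] ta norm_triangle_ineq[of "a j - t" "t - c j"] c(2)[of j] by (simp add: norm_minus_commute)
    then have le: "dE E t * exp (- \<eta>) \<le> cmod (z - t)" unfolding z using rd[OF d0(2), of t] by linarith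
    moreover have pos: "dE E t * exp (- \<eta>) > 0" using dE_pos by simp
    ultimately have "ln (dE E t * exp (- \<eta>)) \<le> ln (cmod (z - t))" by (intro ln_mono)
    moreover have "ln (dE E t * exp (- \<eta>)) = ln (dE E t) - \<eta>" using dE_pos[of t] by (simp add: ln_mult_pos)
    moreover have "z \<noteq> t" using le pos by auto
    ultimately show ?thesis by simp
  qed
  let ?f = "\<lambda>t. ln (dE E t) - \<eta>"
  have i: "integrable \<nu> ?f" using integrable_ln_dE[OF pr] by simp
  have ij: "integrable \<nu> (\<lambda>t. indicat_real (A j) t *\<^sub>R ?f t)" for j
    by (rule integrable_mult_indicator[OF _ i]) (simp add: vs)
  have ik: "integrable (\<kappa> j) ?f" for j
    unfolding \<kappa>_def using ij by (subst integrable_density) auto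
  have ek: "(\<integral>t. ?f t \<partial>\<kappa> j) = (\<integral>t. indicat_real (A j) t *\<^sub>R ?f t \<partial>\<nu>)" for j
    unfolding \<kappa>_def by (rule integral_density) auto
  have le: "ereal (\<integral>t. ?f t \<partial>\<kappa> j) \<le> (SUP z\<in>E. pot (\<kappa> j) z)" for j
  proof -
    interpret k: bounded_support "\<kappa> j" RE by (rule bk)
    have "ereal (\<integral>t. ?f t \<partial>\<kappa> j) \<le> pot (\<kappa> j) (c j)"
    proof (rule k.pot_ge_integral[OF ik])
      have "AE t in \<kappa> j. t \<in> A j" unfolding \<kappa>_def by (subst AE_density) (auto simp: indicator_def)
      then show "AE t in \<kappa> j. c j \<noteq> t \<and> ?f t \<le> ln (cmod (c j - t))"
        by eventually_elim (rule lower, auto)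
    qed
    also have "\<dots> \<le> (SUP z\<in>E. pot (\<kappa> j) z)" using c by (intro SUP_upper) auto
    finally show ?thesis .
  qed
  have "(\<integral>z. ln (dE E z) \<partial>\<nu>) - \<eta> = (\<integral>t. ?f t \<partial>\<nu>)"
    using integrable_ln_dE[OF pr] v.prob_space by simp
  also have "\<dots> = (\<integral>t. (\<Sum>j=1..m. indicat_real (A j) t *\<^sub>R ?f t) \<partial>\<nu>)"
  proof (rule integral_cong_AE)
    show "AE t in \<nu>. ?f t = (\<Sum>j=1..m. indicat_real (A j) t *\<^sub>R ?f t)"
      using aeE by eventually_elim (simp add: sum_distrib_right[symmetric] part[unfolded One_nat_def])
  qed measurable
  also have "\<dots> = (\<Sum>j=1..m. \<integral>t. ?f t \<partial>\<kappa> j)"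
    unfolding ek using ij by (intro Bochner_Integration.integral_sum)
  finally have "ereal ((\<integral>z. ln (dE E z) \<partial>\<nu>) - \<eta>) = (\<Sum>j=1..m. ereal (\<integral>t. ?f t \<partial>\<kappa> j))" by simp
  also have "\<dots> \<le> (\<Sum>j=1..m. SUP z\<in>E. pot (\<kappa> j) z)" by (intro sum_mono le)
  finally show ?thesis using adm pots by blast
qed

lemma C_E_sharp:
  assumes C: "C < C_E E \<mu>"
  shows "\<exists>m \<nu>. admissible_family m \<nu> \<and>
     \<not> ((\<Sum>j=1..m. SUP z\<in>E. pot (\<nu> j) z) \<le> ereal C + (SUP z\<in>E. \<Sum>j=1..m. pot (\<nu> j) z))"
proof -
  \<comment> \<open>The losses are \<eta> from \<nu>, \<eta> from the cutting and
    \<open>2 * \<eta>\<close> in the supremum; their total of \<open>4 * \<eta>\<close> stays below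
    \<open>C_E E \<mu> - C\<close>.\<close>
  define \<eta> where "\<eta> = (C_E E \<mu> - C) / 5"
  have \<eta>: "\<eta> > 0" using C by (simp add: \<eta>_def)
  obtain \<nu> where \<nu>: "prob_on E \<nu>" "\<forall>z\<in>E. pot \<nu> z \<le> ereal (L + 2 * \<eta>)"
    "(\<integral>z. ln (dE E z) \<partial>\<nu>) \<ge> (\<integral>z. ln (dE E z) \<partial>\<mu>) - \<eta>" using exists_almost_extremal_measure[OF \<eta>] by blast
  obtain m \<kappa> where k: "admissible_family m \<kappa>" "\<forall>z. (\<Sum>j=1..m. pot (\<kappa> j) z) = pot \<nu> z"
    "ereal ((\<integral>z. ln (dE E z) \<partial>\<nu>) - \<eta>) \<le> (\<Sum>j=1..m. SUP z\<in>E. pot (\<kappa> j) z)"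
    using exists_fine_decomposition[OF \<nu>(1) \<eta>] by blast
  have "\<not> ((\<Sum>j=1..m. SUP z\<in>E. pot (\<kappa> j) z) \<le> ereal C + (SUP z\<in>E. \<Sum>j=1..m. pot (\<kappa> j) z))"
  proof
    assume "(\<Sum>j=1..m. SUP z\<in>E. pot (\<kappa> j) z) \<le> ereal C + (SUP z\<in>E. \<Sum>j=1..m. pot (\<kappa> j) z)"
    also have "\<dots> \<le> ereal C + ereal (L + 2 * \<eta>)"
      using \<nu>(2) k(2) by (intro add_left_mono SUP_least) auto
    finally have "ereal ((\<integral>z. ln (dE E z) \<partial>\<nu>) - \<eta>) \<le> ereal C + ereal (L + 2 * \<eta>)"
      by (rule order_trans[OF k(3)])
    then have "(\<integral>z. ln (dE E z) \<partial>\<mu>) - 2 * \<eta> \<le> C + L + 2 * \<eta>" using \<nu>(3) by simp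
    then have "C_E E \<mu> - C \<le> 4 * \<eta>" by (simp add: C_E_eq)
    then show False using \<eta> by (simp add: \<eta>_def)
  qed
  then show ?thesis using k(1) by blast
qed

end

theorem theorem2p1:
  fixes E :: "complex set" and \<mu> :: "complex measure"
  assumes "compact E" and "log_capacity E > 0" and "is_equilibrium_measure E \<mu>"
  shows "(\<forall>m (\<nu> :: nat \<Rightarrow> complex measure). admissible_family m \<nu> \<longrightarrow>
            (\<Sum>j=1..m. SUP z\<in>E. pot (\<nu> j) z)
              \<le> ereal (C_E E \<mu>) + (SUP z\<in>E. \<Sum>j=1..m. pot (\<nu> j) z))
       \<and> (\<forall>C < C_E E \<mu>. \<exists>m (\<nu> :: nat \<Rightarrow> complex measure). admissible_family m \<nu> \<and>
            \<not> ((\<Sum>j=1..m. SUP z\<in>E. pot (\<nu> j) z)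
                 \<le> ereal C + (SUP z\<in>E. \<Sum>j=1..m. pot (\<nu> j) z)))"
proof -
  interpret equilibrium E \<mu> by unfold_locales fact+
  show ?thesis using sum_SUP_pot_le C_E_sharp by blast
qed

end
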